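(* Let $\Phi_1,\Phi_2$ be quasi-Young functions and let $\omega_1,\omega_2\in\mathscr P_E(\mathbf R^{2d})$. Then the injection map $$i:M^{\Phi_1,\Phi_2}_{(\omega_1)}(\mathbf R^d)\to M^{\Phi_1,\Phi_2}_{(\omega_2)}(\mathbf R^d)$$ is compact if and only if $$\lim_{|X|\to\infty}\frac{\omega_2(X)}{\omega_1(X)}=0.$$
   Context: Weights: a weight on $\mathbf R^n$ is a positive $\omega\in L^\infty_{loc}$ with $1/\omega\in L^\infty_{loc}$; $\mathscr P_E(\mathbf R^n)$ is the set of moderate weights, i.e. weights $\omega$ for which there is a positive weight $v$ with $\omega(x+y)\lesssim\omega(x)v(y)$ for all $x,y\in\mathbf R^n$. $A\lesssim B$ means $A\le cB$ with a constant $c>0$. Young functions: a Young function is a convex $\Phi_0:[0,\infty)\to[0,\infty]$ with $\Phi_0(0)=0$, $\lim_{t\to\infty}\Phi_0(t)=\infty$; a quasi-Young function of order $r_0\in(0,1]$ is $\Phi(t)=\Phi_0(t^{r_0})$ with $\Phi_0$ Young; a quasi-Young function is one of some order $r_0\in(0,1]$. Orlicz quasi-norms: $\|f\|_{L^\Phi(\mathbf R^d)}=\inf\{\lambda>0:\int\Phi(|f(x)|/\lambda)\,dx\le1\}$, and $\|F\|_{L^{\Phi_1,\Phi_2}_{(\omega)}(\mathbf R^{2d})}=\big\|\,\xi\mapsto\|F(\cdot,\xi)\omega(\cdot,\xi)\|_{L^{\Phi_1}(\mathbf R^d)}\big\|_{L^{\Phi_2}(\mathbf R^d)}$. Modulation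 spaces: with $\phi_0(x)=\pi^{-d/4}e^{-|x|^2/2}$, $M^{\Phi_1,\Phi_2}_{(\omega)}(\mathbf R^d)=\{f\in\mathcal H'_\flat(\mathbf R^d):\|f\|_{M^{\Phi_1,\Phi_2}_{(\omega)}}:=\|V_{\phi_0}f\|_{L^{\Phi_1,\Phi_2}_{(\omega)}}<\infty\}$, where $V_{\phi_0}f(x,\xi)=(2\pi)^{-d/2}(f,e^{i\langle\cdot,\xi\rangle}\phi_0(\cdot-x))$. Here $\mathcal H'_\flat(\mathbf R^d)$ is the space of formal Hermite series $\sum_\alpha c(\alpha)h_\alpha$ with $|c(\alpha)|\lesssim r^{|\alpha|}\alpha!^{1/2}$ for every $r>0$ ($h_\alpha$ the $L^2$-normalized Hermite functions), dual via the extended $L^2$-form to the space $\mathcal H_\flat(\mathbf R^d)$ of Hermite series with $|c(\alpha)|\lesssim r^{|\alpha|}\alpha!^{-1/2}$ for some $r>0$.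
   Formalization: Each quasi-Young function is additionally required to be finite at some t>0; the literal definition admits the function equal to ∞ on all of (0,∞), for which both modulation spaces are {0} and the injection is compact for all weights, so the equivalence would fail. *)

theory Defs
  imports "HOL-Analysis.Analysis"
begin

section \<open>Weights\<close>

definition Linfty_loc :: "('a::euclidean_space \<Rightarrow> real) \<Rightarrow> bool" where
  "Linfty_loc f \<longleftrightarrow> f \<in> borel_measurable lebesgue \<and>
     (\<forall>K. compact K \<longrightarrow> (\<exists>C. AE x in lebesgue. x \<in> K \<longrightarrow> \<bar>f x\<bar> \<le> C))"

definition weight :: "('a::euclidean_space \<Rightarrow> real) \<Rightarrow> bool" where
  "weight \<omega> \<longleftrightarrow> (\<forall>x. 0 < \<omega> x) \<and> Linfty_loc \<omega> \<and> Linfty_loc (\<lambda>x. 1 / \<omega> x)"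

definition moderate_weights :: "('a::euclidean_space \<Rightarrow> real) set" where
  "moderate_weights = {\<omega>. weight \<omega> \<and>
     (\<exists>v. weight v \<and> (\<exists>c>0. \<forall>x y. \<omega> (x + y) \<le> c * \<omega> x * v y))}"

section \<open>Quasi-Young functions and Orlicz quasi-norms\<close>

text \<open>
  A function from $[0,\infty)$ to $[0,\infty]$ is a function on the reals of which only the
  values at nonnegative arguments are used. The definition admits the degenerate function that
  is infinite on all of $(0,\infty)$, whose Orlicz space is trivial.
\<close>

definition young_function :: "(real \<Rightarrow> ennreal) \<Rightarrow> bool" where
  "young_function \<Phi> \<longleftrightarrow>
     (\<forall>s\<ge>0. \<forall>t\<ge>0. \<forall>a\<in>{0..1}.
        \<Phi> (a * s + (1 - a) * t) \<le> ennreal a * \<Phi> s + ennreal (1 - a) * \<Phi> t) \<and>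
     \<Phi> 0 = 0 \<and> (\<Phi> \<longlongrightarrow> \<infinity>) at_top"

definition quasi_young_of_order :: "real \<Rightarrow> (real \<Rightarrow> ennreal) \<Rightarrow> bool" where
  "quasi_young_of_order r \<Phi> \<longleftrightarrow>
     (\<exists>\<Phi>\<^sub>0. young_function \<Phi>\<^sub>0 \<and> (\<forall>t\<ge>0. \<Phi> t = \<Phi>\<^sub>0 (t powr r)))"

definition quasi_young :: "(real \<Rightarrow> ennreal) \<Rightarrow> bool" where
  "quasi_young \<Phi> \<longleftrightarrow> (\<exists>r\<in>{0<..1}. quasi_young_of_order r \<Phi>)"

text \<open>
  In a mixed quasi-norm the outer quasi-norm is applied to a function that may itself take the
  value infinity; there a quasi-Young function is given its limit value at infinity.
\<close>

definition extend_infinity :: "(real \<Rightarrow> ennreal) \<Rightarrow> ennreal \<Rightarrow> ennreal" where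
  "extend_infinity \<Phi> t = (if t = \<infinity> then \<infinity> else \<Phi> (enn2real t))"

definition orlicz_norm ::
  "(real \<Rightarrow> ennreal) \<Rightarrow> ('a::euclidean_space \<Rightarrow> ennreal) \<Rightarrow> ennreal" where
  "orlicz_norm \<Phi> f =
     Inf {ennreal l | l. 0 < l \<and> (\<integral>\<^sup>+x. extend_infinity \<Phi> (f x / ennreal l) \<partial>lebesgue) \<le> 1}"

definition mixed_orlicz_norm ::
  "(real \<Rightarrow> ennreal) \<Rightarrow> (real \<Rightarrow> ennreal) \<Rightarrow> ('a::euclidean_space \<times> 'a \<Rightarrow> real) \<Rightarrow>
   ('a \<times> 'a \<Rightarrow> complex) \<Rightarrow> ennreal" where
  "mixed_orlicz_norm \<Phi>\<^sub>1 \<Phi>\<^sub>2 \<omega> F =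
     orlicz_norm \<Phi>\<^sub>2 (\<lambda>\<xi>. orlicz_norm \<Phi>\<^sub>1 (\<lambda>x. ennreal (cmod (F (x, \<xi>) * \<omega> (x, \<xi>)))))"

section \<open>Formal Hermite series\<close>

definition hermite_fun_1d :: "nat \<Rightarrow> real \<Rightarrow> real" where
  "hermite_fun_1d n t =
     (-1) ^ n / sqrt (2 ^ n * fact n * sqrt pi) * exp (t\<^sup>2 / 2) * (deriv ^^ n) (\<lambda>s. exp (- s\<^sup>2)) t"

definition hermite_fun :: "('d::finite \<Rightarrow> nat) \<Rightarrow> real ^ 'd \<Rightarrow> real" where
  "hermite_fun \<alpha> x = (\<Prod>i\<in>UNIV. hermite_fun_1d (\<alpha> i) (x $ i))"

text \<open>
  A formal Hermite series on the space of type \<^typ>\<open>real ^ 'd\<close> is identified with its family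
  of coefficients, indexed by the multi-indices \<open>'d \<Rightarrow> nat\<close>.
\<close>

type_synonym 'd hermite_series = "('d \<Rightarrow> nat) \<Rightarrow> complex"

definition Hflat_dual :: "'d::finite hermite_series set" where
  "Hflat_dual = {c. \<forall>r>0. \<exists>C. \<forall>\<alpha>.
     cmod (c \<alpha>) \<le> C * r ^ (\<Sum>i\<in>UNIV. \<alpha> i) * sqrt (\<Prod>i\<in>UNIV. fact (\<alpha> i))}"

definition Hflat :: "'d::finite hermite_series set" where
  "Hflat = {c. \<exists>r>0. \<exists>C. \<forall>\<alpha>.
     cmod (c \<alpha>) \<le> C * r ^ (\<Sum>i\<in>UNIV. \<alpha> i) / sqrt (\<Prod>i\<in>UNIV. fact (\<alpha> i))}"

definition hermite_coeffs :: "(real ^ 'd \<Rightarrow> complex) \<Rightarrow> 'd::finite hermite_series" where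
  "hermite_coeffs \<psi> \<alpha> = (LINT x|lborel. \<psi> x * of_real (hermite_fun \<alpha> x))"

text \<open>
  The extension of the $L^2$ form, linear in the first argument, to the duality between
  \<^const>\<open>Hflat_dual\<close> and \<^const>\<open>Hflat\<close>, on which the series converges absolutely.
\<close>

definition hermite_pairing :: "'d::finite hermite_series \<Rightarrow> 'd hermite_series \<Rightarrow> complex" where
  "hermite_pairing c b = (\<Sum>\<^sub>\<infinity>\<alpha>. c \<alpha> * cnj (b \<alpha>))"

section \<open>Modulation spaces\<close>

definition gauss_window :: "real ^ 'd::finite \<Rightarrow> real" where
  "gauss_window x = pi powr (- real CARD('d) / 4) * exp (- (norm x)\<^sup>2 / 2)"

text \<open>
  The translated and modulated Gaussian windows have Hermite coefficients in \<^const>\<open>Hflat\<close>.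
\<close>

definition stft :: "'d::finite hermite_series \<Rightarrow> (real ^ 'd) \<times> (real ^ 'd) \<Rightarrow> complex" where
  "stft f = (\<lambda>(x, \<xi>). of_real ((2 * pi) powr (- real CARD('d) / 2)) *
     hermite_pairing f (hermite_coeffs (\<lambda>y. exp (\<i> * of_real (y \<bullet> \<xi>)) * of_real (gauss_window (y - x)))))"

definition modulation_norm ::
  "(real \<Rightarrow> ennreal) \<Rightarrow> (real \<Rightarrow> ennreal) \<Rightarrow> ((real ^ 'd::finite) \<times> (real ^ 'd) \<Rightarrow> real) \<Rightarrow>
   'd hermite_series \<Rightarrow> ennreal" where
  "modulation_norm \<Phi>\<^sub>1 \<Phi>\<^sub>2 \<omega> f = mixed_orlicz_norm \<Phi>\<^sub>1 \<Phi>\<^sub>2 \<omega> (stft f)"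

definition modulation_space ::
  "(real \<Rightarrow> ennreal) \<Rightarrow> (real \<Rightarrow> ennreal) \<Rightarrow> ((real ^ 'd::finite) \<times> (real ^ 'd) \<Rightarrow> real) \<Rightarrow>
   'd hermite_series set" where
  "modulation_space \<Phi>\<^sub>1 \<Phi>\<^sub>2 \<omega> = {f \<in> Hflat_dual. modulation_norm \<Phi>\<^sub>1 \<Phi>\<^sub>2 \<omega> f < \<infinity>}"

section \<open>Compact maps between quasi-normed spaces\<close>

definition quasi_norm_topology :: "'a::minus set \<Rightarrow> ('a \<Rightarrow> ennreal) \<Rightarrow> 'a topology" where
  "quasi_norm_topology E N =
     topology (\<lambda>U. U \<subseteq> E \<and> (\<forall>f\<in>U. \<exists>\<epsilon>>0. \<forall>g\<in>E. N (g - f) < \<epsilon> \<longrightarrow> g \<in> U))"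

lemma openin_quasi_norm_topology:
  "openin (quasi_norm_topology E N) U \<longleftrightarrow>
     U \<subseteq> E \<and> (\<forall>f\<in>U. \<exists>\<epsilon>>0. \<forall>g\<in>E. N (g - f) < \<epsilon> \<longrightarrow> g \<in> U)"
proof -
  let ?P = "\<lambda>U. U \<subseteq> E \<and> (\<forall>f\<in>U. \<exists>\<epsilon>>0. \<forall>g\<in>E. N (g - f) < \<epsilon> \<longrightarrow> g \<in> U)"
  have "istopology ?P"
    unfolding istopology_def
  proof (intro conjI allI impI)
    fix S T assume S: "?P S" and T: "?P T"
    show "S \<inter> T \<subseteq> E" using S by blast
    show "\<forall>f\<in>S \<inter> T. \<exists>\<epsilon>>0. \<forall>g\<in>E. N (g - f) < \<epsilon> \<longrightarrow> g \<in> S \<inter> T"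
    proof
      fix f assume f: "f \<in> S \<inter> T"
      obtain a where a: "a > 0" "\<forall>g\<in>E. N (g - f) < a \<longrightarrow> g \<in> S" using S f by blast
      obtain b where b: "b > 0" "\<forall>g\<in>E. N (g - f) < b \<longrightarrow> g \<in> T" using T f by blast
      show "\<exists>\<epsilon>>0. \<forall>g\<in>E. N (g - f) < \<epsilon> \<longrightarrow> g \<in> S \<inter> T"
        using a b by (intro exI[of _ "min a b"]) simp
    qed
  next
    fix K assume K: "\<forall>S\<in>K. ?P S"
    then show "\<Union>K \<subseteq> E" by blast
    show "\<forall>f\<in>\<Union>K. \<exists>\<epsilon>>0. \<forall>g\<in>E. N (g - f) < \<epsilon> \<longrightarrow> g \<in> \<Union>K"
    proof
      fix f assume "f \<in> \<Union>K"
      then obtain S where "S \<in> K" "f \<in> S" by blast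
      moreover from this obtain a where "a > 0" "\<forall>g\<in>E. N (g - f) < a \<longrightarrow> g \<in> S"
        using K by blast
      ultimately show "\<exists>\<epsilon>>0. \<forall>g\<in>E. N (g - f) < \<epsilon> \<longrightarrow> g \<in> \<Union>K"
        by (intro exI[of _ a]) blast
    qed
  qed
  then show ?thesis
    by (simp add: quasi_norm_topology_def topology_inverse')
qed

lemma topspace_quasi_norm_topology [simp]: "topspace (quasi_norm_topology E N) = E"
proof -
  have "openin (quasi_norm_topology E N) E"
    unfolding openin_quasi_norm_topology by (auto intro: exI[of _ 1])
  moreover have "topspace (quasi_norm_topology E N) \<subseteq> E"
    using openin_topspace[of "quasi_norm_topology E N"]
    unfolding openin_quasi_norm_topology by (rule conjunct1)
  ultimately show ?thesis
    using openin_subset by (intro equalityI)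
qed

text \<open>
  Only meant for linear maps: those that send bounded sets to relatively compact ones.
\<close>

definition compact_map ::
  "'a set \<Rightarrow> ('a \<Rightarrow> ennreal) \<Rightarrow> 'b::minus set \<Rightarrow> ('b \<Rightarrow> ennreal) \<Rightarrow> ('a \<Rightarrow> 'b) \<Rightarrow> bool" where
  "compact_map E N\<^sub>E F N\<^sub>F T \<longleftrightarrow> T ` E \<subseteq> F \<and>
     (\<forall>B \<subseteq> E. (\<exists>C<\<infinity>. \<forall>f\<in>B. N\<^sub>E f \<le> C) \<longrightarrow>
        compactin (quasi_norm_topology F N\<^sub>F) (quasi_norm_topology F N\<^sub>F closure_of (T ` B)))"

end

theory Submission
  imports Defs "HOL-Probability.Probability" "HOL-Complex_Analysis.Complex_Analysis" "HOL-Real_Asymp.Real_Asymp"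
begin

text \<open>
  The Hermite coefficients of the shifted Gaussians are explicit, and up to a factor of constant modulus
  $V_{\phi_0} f(x,\xi)$ is $F(z) e^{-|z|^2/2}$ with $z = (x - i\xi)/\sqrt 2$ and $F$ the entire function
  with Taylor coefficients $c(\alpha)/\alpha!^{1/2}$. Subharmonicity of $|F|^p$ gives
  $|V_{\phi_0}f|\,\omega \lesssim \|f\|_{M_{(\omega)}}$ pointwise. Hence a bounded sequence in the first
  space has bounded Taylor coefficients, and a subsequence converges locally uniformly to some $f$;
  outside a large ball the $\omega_2$-norm of the difference is a small multiple of its bounded
  $\omega_1$-norm, so the convergence holds in the second space. Conversely, if $\omega_2/\omega_1 \ge \epsilon$
  at points $X_n \to \infty$, the Gaussians centred at $X_n$ and divided by $\omega_1(X_n)$ are bounded in the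
  first space; their transforms tend to $0$ pointwise, but have $\omega_2$-weighted sup norm bounded below,
  so that no subsequence converges in the second space.
\<close>

section \<open>Orlicz quasi-norms\<close>

text \<open>The obstacle is that nothing relates \<Phi> and \<Psi> beyond their being quasi-Young:
  there is no convexity, no doubling condition, no semicontinuity (a value may jump to infinity) and
  no common order. Two one-variable facts replace this structure: \<Phi>(a t) \<le> a^r \<Phi>(t)
  for a \<le> 1, which gives a quasi-triangle inequality, and (1 + t)^p \<le> C (1 + \<Phi>(t)) for
  all small p, which puts both Orlicz spaces locally inside a common L^p with p \<le> 1. Hence the
  sub-mean value property is needed for powers below 1. Finiteness of \<Phi> at some t > 0 excludes
  the zero space, whose injection is compact whatever the weights are; it enters through the finite
  norm of a Gaussian. Gaussians serve as test functions and also, in place of an indicator, as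
  majorants on a ball. The weights are only measurable and locally bounded, so they are exchanged
  for comparable ones with Lipschitz logarithm; this changes neither the topology, nor the bounded
  sets, nor the limit condition.\<close>

lemma young_function_scale:
  assumes "young_function \<Phi>" "0 \<le> a" "a \<le> 1" "0 \<le> s"
  shows "\<Phi> (a * s) \<le> ennreal a * \<Phi> s"
proof -
  have "\<Phi> (a * s + (1 - a) * 0) \<le> ennreal a * \<Phi> s + ennreal (1 - a) * \<Phi> 0"
    using assms unfolding young_function_def by (metis atLeastAtMost_iff order_refl)
  then show ?thesis using assms unfolding young_function_def by simp
qed

lemma young_function_mono:
  assumes "young_function \<Phi>" "0 \<le> s" "s \<le> t"
  shows "\<Phi> s \<le> \<Phi> t"
proof (cases "t = 0")
  case False
  then have "t > 0" using assms by simp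
  have "\<Phi> (s / t * t) \<le> ennreal (s / t) * \<Phi> t"
    by (rule young_function_scale) (use assms \<open>t > 0\<close> in auto)
  also have "\<dots> \<le> 1 * \<Phi> t"
    by (intro mult_right_mono) (use assms \<open>t > 0\<close> in \<open>auto simp: ennreal_le_1\<close>)
  finally show ?thesis using \<open>t > 0\<close> by simp
qed (use assms in auto)

text \<open>Beyond a point T with \<Phi>(T) \<ge> 1, convexity and \<Phi>(0) = 0 force \<Phi>(t)
  \<ge> t / T; the summand 1 covers the arguments below T, where \<Phi> may vanish.\<close>

lemma young_function_growth:
  assumes "young_function \<Phi>"
  obtains T where "T > 0" "\<And>t. 0 \<le> t \<Longrightarrow> ennreal t \<le> ennreal T * (1 + \<Phi> t)"
proof -
  have "(\<Phi> \<longlongrightarrow> \<infinity>) at_top" using assms by (simp add: young_function_def)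
  then have "\<forall>\<^sub>F t in at_top. 1 < \<Phi> t"
    by (rule order_tendstoD(1)) simp
  then obtain T0 where T0: "\<And>t. t \<ge> T0 \<Longrightarrow> 1 < \<Phi> t" by (auto simp: eventually_at_top_linorder)
  define T where "T = max 1 T0"
  have T: "T > 0" "1 \<le> \<Phi> T" using T0[of T] by (auto simp: T_def)
  have "ennreal t \<le> ennreal T * (1 + \<Phi> t)" if "0 \<le> t" for t
  proof (cases "t \<le> T")
    case True
    have "ennreal t \<le> ennreal T * 1" using True by (simp add: ennreal_leI)
    also have "\<dots> \<le> ennreal T * (1 + \<Phi> t)" by (intro mult_left_mono) auto
    finally show ?thesis .
  next
    case False
    then have "t > 0" using T by simp
    have "1 \<le> \<Phi> (T / t * t)" using T \<open>t > 0\<close> by simp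
    also have "\<dots> \<le> ennreal (T / t) * \<Phi> t"
      by (rule young_function_scale) (use assms False \<open>t > 0\<close> T in auto)
    finally have "ennreal t * 1 \<le> ennreal t * (ennreal (T / t) * \<Phi> t)"
      by (intro mult_left_mono) auto
    also have "\<dots> = ennreal T * \<Phi> t"
      using \<open>t > 0\<close> T by (simp add: mult.assoc[symmetric] ennreal_mult'[symmetric])
    also have "\<dots> \<le> ennreal T * (1 + \<Phi> t)" by (intro mult_left_mono) auto
    finally show ?thesis by simp
  qed
  with T(1) show ?thesis by (rule that)
qed

lemma extend_infinity_ennreal [simp]: "0 \<le> t \<Longrightarrow> extend_infinity \<Phi> (ennreal t) = \<Phi> t"
  by (simp add: extend_infinity_def)

lemma extend_infinity_top [simp]: "extend_infinity \<Phi> top = top"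
  by (simp add: extend_infinity_def)

lemma quasi_young_zero: "quasi_young \<Phi> \<Longrightarrow> \<Phi> 0 = 0"
  by (auto simp: quasi_young_def quasi_young_of_order_def young_function_def)

lemma extend_infinity_zero [simp]: "quasi_young \<Phi> \<Longrightarrow> extend_infinity \<Phi> 0 = 0"
  using extend_infinity_ennreal[of 0 \<Phi>] by (simp add: quasi_young_zero)

lemma mono_extend_infinity:
  assumes "quasi_young \<Phi>"
  shows "mono (extend_infinity \<Phi>)"
proof (rule monoI)
  fix s t :: ennreal assume "s \<le> t"
  obtain r \<Phi>0 where r: "0 < r" "young_function \<Phi>0" "\<And>t. t \<ge> 0 \<Longrightarrow> \<Phi> t = \<Phi>0 (t powr r)"
    using assms by (auto simp: quasi_young_def quasi_young_of_order_def)
  show "extend_infinity \<Phi> s \<le> extend_infinity \<Phi> t"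
  proof (cases t)
    case (real t')
    with \<open>s \<le> t\<close> obtain s' where s': "s = ennreal s'" "0 \<le> s'" "s' \<le> t'"
      by (cases s) (auto simp: top_unique)
    have "\<Phi>0 (s' powr r) \<le> \<Phi>0 (t' powr r)"
      by (rule young_function_mono[OF r(2)]) (use s' r(1) in \<open>auto intro: powr_mono2\<close>)
    then show ?thesis using s' real r by simp
  qed simp
qed

text \<open>With \<Phi>(t) = \<Phi>0(t^r) the factor a becomes a^r in the argument of the convex
  \<Phi>0, and \<Phi>0(0) = 0 lets convexity pull it out. This replaces convexity of \<Phi> in the
  quasi-triangle inequality and in the norm of a Gaussian.\<close>

lemma extend_infinity_scale:
  assumes "quasi_young \<Phi>"
  obtains r where "0 < r" "r \<le> 1" "\<And>a t. 0 \<le> a \<Longrightarrow> a \<le> 1 \<Longrightarrow> extend_infinity \<Phi> (ennreal a * t) \<le> ennreal (a powr r) * extend_infinity \<Phi> t"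
proof -
  obtain r \<Phi>0 where r: "0 < r" "r \<le> 1" "young_function \<Phi>0" "\<And>t. t \<ge> 0 \<Longrightarrow> \<Phi> t = \<Phi>0 (t powr r)"
    using assms by (auto simp: quasi_young_def quasi_young_of_order_def)
  have "extend_infinity \<Phi> (ennreal a * t) \<le> ennreal (a powr r) * extend_infinity \<Phi> t"
    if "0 \<le> a" "a \<le> 1" for a t
  proof (cases t)
    case (real t')
    have "\<Phi>0 (a powr r * t' powr r) \<le> ennreal (a powr r) * \<Phi>0 (t' powr r)"
      by (rule young_function_scale[OF r(3)])
        (use that r in \<open>auto intro: powr_le1\<close>)
    then show ?thesis using real that r
      by (simp add: ennreal_mult'[symmetric] powr_mult)
  next
    case top
    \<comment> \<open>For a = 0 both sides vanish, as 0 times infinity is 0; otherwise the right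
      side is infinite.\<close>
    then show ?thesis using that r assms by (cases "a = 0") (auto simp: ennreal_mult_top)
  qed
  with r show ?thesis by (intro that) auto
qed

text \<open>Linear growth of the Young function is growth of order t^r of \<Phi>. The base 1 + t is
  at least 1, so its powers increase in p and one constant C serves all p \<le> r; this permits a
  common exponent for two functions of different orders.\<close>

lemma extend_infinity_growth:
  assumes "quasi_young \<Phi>"
  obtains r C where "0 < r" "r \<le> 1" "C > 0"
    "\<And>p t. 0 < p \<Longrightarrow> p \<le> r \<Longrightarrow> 0 \<le> t \<Longrightarrow> ennreal ((1 + t) powr p) \<le> ennreal C * (1 + extend_infinity \<Phi> (ennreal t))"
proof -
  obtain r \<Phi>0 where r: "0 < r" "r \<le> 1" "young_function \<Phi>0" "\<And>t. t \<ge> 0 \<Longrightarrow> \<Phi> t = \<Phi>0 (t powr r)"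
    using assms by (auto simp: quasi_young_def quasi_young_of_order_def)
  obtain T where T: "T > 0" "\<And>t. 0 \<le> t \<Longrightarrow> ennreal t \<le> ennreal T * (1 + \<Phi>0 t)"
    using young_function_growth[OF r(3)] by blast
  have "ennreal ((1 + t) powr p) \<le> ennreal (2 * (1 + T)) * (1 + extend_infinity \<Phi> (ennreal t))"
    if "0 < p" "p \<le> r" "0 \<le> t" for p t
  proof -
    have "(1 + t) powr p \<le> (1 + t) powr r" using that by (intro powr_mono) auto
    also have "\<dots> \<le> 2 * (1 + t powr r)"
    proof (cases "t \<le> 1")
      case True
      have "(1 + t) powr r \<le> 2 powr r" using True that r by (intro powr_mono2) auto
      also have "\<dots> \<le> 2 powr 1" using r by (intro powr_mono) auto
      finally show ?thesis by (smt (verit) powr_ge_zero powr_one)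
    next
      case False
      have "(1 + t) powr r \<le> (2 * t) powr r" using False that r by (intro powr_mono2) auto
      also have "\<dots> = 2 powr r * t powr r" using that by (simp add: powr_mult)
      also have "\<dots> \<le> 2 powr 1 * t powr r" using r by (intro mult_right_mono powr_mono) auto
      finally show ?thesis by simp
    qed
    finally have "ennreal ((1 + t) powr p) \<le> ennreal (2 * (1 + t powr r))" by (rule ennreal_leI)
    also have "\<dots> = ennreal 2 * (1 + ennreal (t powr r))"
      by (subst ennreal_mult) (auto simp: ennreal_plus)
    also have "\<dots> \<le> ennreal 2 * (1 + ennreal T * (1 + \<Phi>0 (t powr r)))"
      by (intro mult_left_mono add_left_mono T) auto
    also have "\<dots> \<le> ennreal 2 * ((1 + \<Phi>0 (t powr r)) + ennreal T * (1 + \<Phi>0 (t powr r)))"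
      by (intro mult_left_mono add_right_mono) auto
    also have "\<dots> = ennreal 2 * (ennreal (1 + T) * (1 + \<Phi>0 (t powr r)))"
      using T(1) by (simp add: ennreal_plus distrib_right)
    also have "\<dots> = ennreal (2 * (1 + T)) * (1 + \<Phi>0 (t powr r))"
      using T(1) by (subst ennreal_mult) (auto simp: mult.assoc[symmetric] distrib_left)
    finally show ?thesis using that r by simp
  qed
  moreover have "2 * (1 + T) > 0" using T by simp
  ultimately show ?thesis using r by (intro that) auto
qed

text \<open>A sublevel set of a monotone function is an initial segment, open or closed at its
  supremum. Monotonicity has to suffice because \<Phi> may jump to infinity.\<close>

lemma borel_measurable_mono_ennreal:
  fixes f :: "ennreal \<Rightarrow> ennreal"
  assumes "mono f"
  shows "f \<in> borel_measurable borel"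
proof (rule borel_measurableI_less)
  fix y
  define D where "D = {x. f x < y}"
  have down: "x \<in> D" if "x < z" "z \<in> D" for x z
    using that monoD[OF assms, of x z] unfolding D_def by (metis le_less_trans less_imp_le mem_Collect_eq)
  have "D = {..<Sup D} \<or> D = {..Sup D}"
  proof (cases "Sup D \<in> D")
    case True
    have "D = {..Sup D}"
    proof (intro equalityI subsetI)
      fix x assume "x \<in> {..Sup D}"
      then show "x \<in> D" using down[of x "Sup D"] True by (cases "x = Sup D") auto
    qed (simp add: Sup_upper)
    then show ?thesis ..
  next
    case False
    have "D = {..<Sup D}"
    proof (intro equalityI subsetI)
      fix x assume "x \<in> {..<Sup D}"
      then obtain z where "z \<in> D" "x < z" by (auto simp: less_Sup_iff)
      then show "x \<in> D" using down by blast
    next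
      fix x assume "x \<in> D"
      then show "x \<in> {..<Sup D}" using False Sup_upper[of x D] by (auto simp: less_le)
    qed
    then show ?thesis ..
  qed
  moreover have "{..<Sup D} \<in> sets borel" "{..Sup D} \<in> sets borel" by auto
  ultimately have "D \<in> sets borel" by metis
  then show "{x \<in> space borel. f x < y} \<in> sets borel" by (simp add: D_def)
qed

lemma measurable_extend_infinity:
  "quasi_young \<Phi> \<Longrightarrow> extend_infinity \<Phi> \<in> borel_measurable borel"
  by (intro borel_measurable_mono_ennreal mono_extend_infinity)

section \<open>Estimates for the Luxemburg quasi-norm\<close>

lemma divide_ennreal_eq_times: "0 < l \<Longrightarrow> t / ennreal l = ennreal (1 / l) * t"
  by (simp add: divide_ennreal_def inverse_ennreal mult.commute inverse_eq_divide)

lemma extend_infinity_divide_mono: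
  assumes "quasi_young \<Phi>" "s \<le> t" "0 < l" "l \<le> m"
  shows "extend_infinity \<Phi> (s / ennreal m) \<le> extend_infinity \<Phi> (t / ennreal l)"
  using assms by (intro monoD[OF mono_extend_infinity[OF assms(1)]])
    (auto simp: divide_ennreal_eq_times frac_le intro!: mult_mono ennreal_leI)

text \<open>The nonnegative integral is the same for \<open>lebesgue\<close> and
  \<open>lborel\<close>, whether or not the integrand is measurable, so the modulars below are taken
  with \<open>lborel\<close>.\<close>

lemma orlicz_norm_le:
  assumes "0 < l" "(\<integral>\<^sup>+x. extend_infinity \<Phi> (f x / ennreal l) \<partial>lborel) \<le> 1"
  shows "orlicz_norm \<Phi> f \<le> ennreal l"
  unfolding orlicz_norm_def using assms by (intro Inf_lower) (auto simp: nn_integral_completion)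

lemma orlicz_norm_less:
  assumes "quasi_young \<Phi>" "orlicz_norm \<Phi> f < a"
  obtains l where "0 < l" "ennreal l < a" "(\<integral>\<^sup>+x. extend_infinity \<Phi> (f x / ennreal l) \<partial>lborel) \<le> 1"
  using assms(2) unfolding orlicz_norm_def by (auto simp: Inf_less_iff nn_integral_completion)

text \<open>The strict inequality matters: at the norm itself the modular may exceed 1, since \<Phi>
  can jump, for example from 0 to infinity.\<close>

lemma orlicz_norm_less_modular:
  assumes "quasi_young \<Phi>" "orlicz_norm \<Phi> f < ennreal m" 
  shows "(\<integral>\<^sup>+x. extend_infinity \<Phi> (f x / ennreal m) \<partial>lborel) \<le> 1"
proof -
  obtain l where l: "0 < l" "ennreal l < ennreal m" "(\<integral>\<^sup>+x. extend_infinity \<Phi> (f x / ennreal l) \<partial>lborel) \<le> 1"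
    using orlicz_norm_less[OF assms] by blast
  then have "(\<integral>\<^sup>+x. extend_infinity \<Phi> (f x / ennreal m) \<partial>lborel) \<le> (\<integral>\<^sup>+x. extend_infinity \<Phi> (f x / ennreal l) \<partial>lborel)"
    by (intro nn_integral_mono extend_infinity_divide_mono assms) (auto simp: ennreal_less_iff)
  with l(3) show ?thesis by order
qed

lemma orlicz_norm_mono:
  assumes "quasi_young \<Phi>" "\<And>x. f x \<le> g x"
  shows "orlicz_norm \<Phi> f \<le> orlicz_norm \<Phi> g"
proof (rule ccontr)
  assume "\<not> ?thesis"
  then obtain l where l: "0 < l" "ennreal l < orlicz_norm \<Phi> f" "(\<integral>\<^sup>+x. extend_infinity \<Phi> (g x / ennreal l) \<partial>lborel) \<le> 1"
    using orlicz_norm_less[OF assms(1), of g "orlicz_norm \<Phi> f"] by (auto simp: not_le)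
  have "(\<integral>\<^sup>+x. extend_infinity \<Phi> (f x / ennreal l) \<partial>lborel) \<le> (\<integral>\<^sup>+x. extend_infinity \<Phi> (g x / ennreal l) \<partial>lborel)"
    by (intro nn_integral_mono extend_infinity_divide_mono assms l) auto
  then have "orlicz_norm \<Phi> f \<le> ennreal l" using l by (intro orlicz_norm_le) auto
  with l show False by simp
qed

text \<open>Reduces a bound by a norm M to bounds by the real levels l above M, at which the modular
  is known to be at most 1. For infinite M, c > 0 makes the right side infinite.\<close>

lemma ennreal_le_cmult_dense:
  assumes "0 < c" "\<And>l. 0 < l \<Longrightarrow> M < ennreal l \<Longrightarrow> x \<le> ennreal c * ennreal l"
  shows "x \<le> ennreal c * M"
proof (cases M)
  case (real m)
  have "x \<le> ennreal (c * m) + ennreal e" if "e > 0" for e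
  proof -
    have "x \<le> ennreal c * ennreal (m + e / c)"
      using assms(1) that real by (intro assms(2)) (auto simp: ennreal_less_iff add_nonneg_pos)
    also have "\<dots> = ennreal (c * m + e)"
      using assms(1) by (subst ennreal_mult'[symmetric]) (simp_all add: distrib_left)
    also have "\<dots> = ennreal (c * m) + ennreal e"
      using assms(1) that real by (intro ennreal_plus) auto
    finally show ?thesis .
  qed
  note eps = this
  have "x \<le> ennreal (c * m)" by (rule ennreal_le_epsilon) (rule eps)
  then show ?thesis using real assms(1) by (simp add: ennreal_mult')
qed (use assms(1) in \<open>simp add: ennreal_mult_top\<close>)

lemma orlicz_norm_cmult_le:
  assumes "quasi_young \<Phi>" "0 < c"
  shows "orlicz_norm \<Phi> (\<lambda>x. ennreal c * f x) \<le> ennreal c * orlicz_norm \<Phi> f"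
proof (rule ennreal_le_cmult_dense[OF assms(2)])
  fix l :: real assume l: "0 < l" "orlicz_norm \<Phi> f < ennreal l"
  have "ennreal c * f x / ennreal (c * l) = f x / ennreal l" for x
    using l assms(2) by (simp add: divide_ennreal_eq_times mult.assoc[symmetric] ennreal_mult'[symmetric])
  then have "orlicz_norm \<Phi> (\<lambda>x. ennreal c * f x) \<le> ennreal (c * l)"
    using orlicz_norm_less_modular[OF assms(1) l(2)] l assms(2) by (intro orlicz_norm_le) auto
  then show "orlicz_norm \<Phi> (\<lambda>x. ennreal c * f x) \<le> ennreal c * ennreal l"
    using assms(2) by (simp add: ennreal_mult')
qed

text \<open>
  A maximum instead of a sum avoids convexity: all that is needed is $\Phi(t/\kappa) \le \Phi(t)/2$.
\<close>

lemma orlicz_norm_max_le: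
  assumes "quasi_young \<Phi>"
  obtains \<kappa> where "\<kappa> \<ge> 1" "\<And>f g. f \<in> borel_measurable borel \<Longrightarrow> g \<in> borel_measurable borel \<Longrightarrow>
    orlicz_norm \<Phi> (\<lambda>x. max (f x) (g x)) \<le> ennreal \<kappa> * max (orlicz_norm \<Phi> f) (orlicz_norm \<Phi> g)"
proof -
  obtain r where r: "0 < r" "r \<le> 1" 
    "\<And>a t. 0 \<le> a \<Longrightarrow> a \<le> 1 \<Longrightarrow> extend_infinity \<Phi> (ennreal a * t) \<le> ennreal (a powr r) * extend_infinity \<Phi> t"
    using extend_infinity_scale[OF assms] by blast
  \<comment> \<open>Solves (1 / \<kappa>)^r = 1/2, so that each of the two modulars contributes at
    most 1/2.\<close>
  define \<kappa> where "\<kappa> = (2::real) powr (1 / r)"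
  have \<kappa>: "\<kappa> \<ge> 1" using r by (simp add: \<kappa>_def ge_one_powr_ge_zero)
  have \<kappa>r: "(1 / \<kappa>) powr r = 1 / 2"
    using r by (simp add: \<kappa>_def powr_divide powr_powr)
  note [measurable] = measurable_extend_infinity[OF assms]
  have "orlicz_norm \<Phi> (\<lambda>x. max (f x) (g x)) \<le> ennreal \<kappa> * max (orlicz_norm \<Phi> f) (orlicz_norm \<Phi> g)"
    if [measurable]: "f \<in> borel_measurable borel" "g \<in> borel_measurable borel" for f g :: "'a \<Rightarrow> ennreal"
  proof (rule ennreal_le_cmult_dense)
    fix l :: real assume l: "0 < l" "max (orlicz_norm \<Phi> f) (orlicz_norm \<Phi> g) < ennreal l"
    let ?F = "\<lambda>x. extend_infinity \<Phi> (f x / ennreal l)" and ?G = "\<lambda>x. extend_infinity \<Phi> (g x / ennreal l)"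
    have pt: "extend_infinity \<Phi> (max (f x) (g x) / ennreal (\<kappa> * l)) \<le> ennreal (1/2) * (?F x + ?G x)" for x
    proof -
      have "max (f x) (g x) / ennreal (\<kappa> * l) = ennreal (1 / \<kappa>) * (max (f x) (g x) / ennreal l)"
        using \<kappa> l by (simp add: divide_ennreal_eq_times mult.assoc[symmetric] ennreal_mult'[symmetric])
      then have "extend_infinity \<Phi> (max (f x) (g x) / ennreal (\<kappa> * l)) \<le> ennreal (1/2) * extend_infinity \<Phi> (max (f x) (g x) / ennreal l)"
        using r(3)[of "1 / \<kappa>"] \<kappa> \<kappa>r by simp
      also have "\<dots> \<le> ennreal (1/2) * (?F x + ?G x)"
        by (intro mult_left_mono) (auto simp: max_def)
      finally show ?thesis .
    qed
    have "(\<integral>\<^sup>+x. extend_infinity \<Phi> (max (f x) (g x) / ennreal (\<kappa> * l)) \<partial>lborel) \<le> (\<integral>\<^sup>+x. ennreal (1/2) * (?F x + ?G x) \<partial>lborel)"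
      by (intro nn_integral_mono pt)
    also have "\<dots> = ennreal (1/2) * ((\<integral>\<^sup>+x. ?F x \<partial>lborel) + (\<integral>\<^sup>+x. ?G x \<partial>lborel))"
      by (subst nn_integral_cmult, measurable, subst nn_integral_add) auto
    also have "\<dots> \<le> ennreal (1/2) * (1 + 1)"
      using l by (intro mult_left_mono add_mono orlicz_norm_less_modular assms) auto
    also have "\<dots> = ennreal (1/2) * ennreal 2" by simp
    also have "\<dots> = 1" by (subst ennreal_mult'[symmetric]) auto
    finally have "orlicz_norm \<Phi> (\<lambda>x. max (f x) (g x)) \<le> ennreal (\<kappa> * l)"
      using \<kappa> l by (intro orlicz_norm_le) auto
    then show "orlicz_norm \<Phi> (\<lambda>x. max (f x) (g x)) \<le> ennreal \<kappa> * ennreal l"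
      using \<kappa> by (simp add: ennreal_mult')
  qed (use \<kappa> in auto)
  with \<kappa> show ?thesis by (intro that) auto
qed

text \<open>The modular is measurable in \<xi> by Tonelli and decreases as the level grows. A norm
  below a is therefore witnessed by a rational level, and the sublevel set is a countable
  union.\<close>

lemma borel_measurable_orlicz_norm_section:
  fixes u :: "'a::euclidean_space \<times> 'b::euclidean_space \<Rightarrow> ennreal"
  assumes "quasi_young \<Phi>" and [measurable]: "u \<in> borel_measurable borel"
  shows "(\<lambda>\<xi>. orlicz_norm \<Phi> (\<lambda>x. u (x, \<xi>))) \<in> borel_measurable borel"
proof (rule borel_measurableI_less)
  fix a
  note [measurable] = measurable_extend_infinity[OF assms(1)]
  define J where "J l \<xi> = (\<integral>\<^sup>+x. extend_infinity \<Phi> (u (x, \<xi>) / ennreal l) \<partial>lborel)" for l \<xi>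
  have [measurable]: "J l \<in> borel_measurable borel" for l
  proof -
    have swap: "(\<lambda>z::'b \<times> 'a. u (snd z, fst z)) \<in> borel_measurable borel"
      by (rule measurable_compose[OF borel_measurable_continuous_onI assms(2)]) (intro continuous_intros)
    have "(\<lambda>z::'b \<times> 'a. extend_infinity \<Phi> (u (snd z, fst z) / ennreal l)) \<in> borel_measurable borel"
      by (rule measurable_compose[OF _ measurable_extend_infinity[OF assms(1)]])
        (intro borel_measurable_divide_ennreal swap measurable_const UNIV_I, simp)
    then have "(\<lambda>(\<xi>::'b, x::'a). extend_infinity \<Phi> (u (x, \<xi>) / ennreal l)) \<in> borel_measurable (lborel \<Otimes>\<^sub>M lborel)"
      by (simp add: lborel_prod split_beta)
    from lborel.borel_measurable_nn_integral[OF this] show ?thesis by (simp add: J_def[abs_def])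
  qed
  have S: "{\<xi> \<in> space borel. J l \<xi> \<le> 1} \<in> sets borel" for l by measurable
  have "{\<xi> \<in> space borel. orlicz_norm \<Phi> (\<lambda>x. u (x, \<xi>)) < a} =
    (\<Union>q\<in>{q::rat. 0 < q \<and> ennreal (of_rat q) < a}. {\<xi> \<in> space borel. J (of_rat q) \<xi> \<le> 1})"
  proof (intro equalityI subsetI)
    fix \<xi> assume "\<xi> \<in> {\<xi> \<in> space borel. orlicz_norm \<Phi> (\<lambda>x. u (x, \<xi>)) < a}"
    then obtain l where l: "0 < l" "ennreal l < a" "J l \<xi> \<le> 1"
      using orlicz_norm_less[OF assms(1)] unfolding J_def by blast
    \<comment> \<open>A real end point above l is needed to place a rational below it;
      \<open>a\<close> itself may be infinite.\<close>
    obtain b where b: "l < b" "ennreal b \<le> a"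
    proof (cases a)
      case (real a')
      then show ?thesis using l by (intro that[of a']) (auto simp: ennreal_less_iff)
    next
      case top
      then show ?thesis by (intro that[of "l + 1"]) auto
    qed
    obtain q where q: "l < of_rat q" "of_rat q < b" using of_rat_dense[OF b(1)] by blast
    have "0 < q" using l(1) q(1) by (metis less_trans zero_less_of_rat_iff)
    moreover have "ennreal (of_rat q) < a"
      using q b l(1) by (metis ennreal_lessI less_le_trans less_trans)
    moreover have "J (of_rat q) \<xi> \<le> J l \<xi>" unfolding J_def
      by (intro nn_integral_mono extend_infinity_divide_mono assms) (use l q in auto)
    ultimately show "\<xi> \<in> (\<Union>q\<in>{q::rat. 0 < q \<and> ennreal (of_rat q) < a}. {\<xi> \<in> space borel. J (of_rat q) \<xi> \<le> 1})"
      using l(3) by (auto intro!: exI[of _ q] intro: order_trans)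
  next
    fix \<xi> assume "\<xi> \<in> (\<Union>q\<in>{q::rat. 0 < q \<and> ennreal (of_rat q) < a}. {\<xi> \<in> space borel. J (of_rat q) \<xi> \<le> 1})"
    then obtain q where q: "0 < q" "ennreal (of_rat q) < a" "J (of_rat q) \<xi> \<le> 1" by auto
    then have "orlicz_norm \<Phi> (\<lambda>x. u (x, \<xi>)) \<le> ennreal (of_rat q)"
      by (intro orlicz_norm_le) (auto simp: J_def)
    with q(2) show "\<xi> \<in> {\<xi> \<in> space borel. orlicz_norm \<Phi> (\<lambda>x. u (x, \<xi>)) < a}"
      by (auto intro: le_less_trans)
  qed
  also have "\<dots> \<in> sets borel"
    by (rule sets.countable_UN'') (auto intro!: S simp: countableI_type)
  finally show "{\<xi> \<in> space borel. orlicz_norm \<Phi> (\<lambda>x. u (x, \<xi>)) < a} \<in> sets borel" .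
qed

section \<open>The Fatou property\<close>

lemma frequently_less_of_Liminf_less:
  fixes a :: "'a \<Rightarrow> 'b::complete_linorder"
  assumes "Liminf F a < l"
  shows "\<exists>\<^sub>F n in F. a n < l"
proof (rule ccontr)
  assume "\<not> ?thesis"
  then have "\<forall>\<^sub>F n in F. l \<le> a n" by (simp add: frequently_def not_less)
  then have "l \<le> Liminf F a" by (rule Liminf_bounded)
  with assms show False by simp
qed

text \<open>\<Phi> need not be lower semicontinuous, so the level is raised from l to m: for finite
  h > 0, f n eventually exceeds h l / m, and monotonicity does the rest. For infinite h the growth
  of \<Phi> makes the right side infinite.\<close>

lemma extend_infinity_Liminf:
  assumes "quasi_young \<Phi>" "0 < l" "l < m" "h \<le> Liminf F f" "F \<noteq> bot"
  shows "extend_infinity \<Phi> (h / ennreal m) \<le> Liminf F (\<lambda>n. extend_infinity \<Phi> (f n / ennreal l))"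
proof (cases h)
  case (real h')
  show ?thesis
  proof (cases "h' = 0")
    case False
    with real have h': "0 < h'" by simp
    have "ennreal (h' * l / m) < h" using assms h' real by (auto simp: ennreal_less_iff field_simps)
    then have "\<forall>\<^sub>F n in F. ennreal (h' * l / m) < f n"
      using assms(4) less_LiminfD by (metis less_le_trans)
    then have "\<forall>\<^sub>F n in F. extend_infinity \<Phi> (h / ennreal m) \<le> extend_infinity \<Phi> (f n / ennreal l)"
    proof eventually_elim
      case (elim n)
      have "h / ennreal m = ennreal (h' * l / m) / ennreal l"
        using assms h' real by (simp add: divide_ennreal)
      also have "\<dots> \<le> f n / ennreal l"
        by (rule divide_right_mono_ennreal) (use elim in simp)
      finally show ?case by (rule monoD[OF mono_extend_infinity[OF assms(1)]])
    qed
    then show ?thesis by (rule Liminf_bounded)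
  qed (use real assms in simp)
next
  case top
  have "ennreal M \<le> Liminf F (\<lambda>n. extend_infinity \<Phi> (f n / ennreal l))" if "M > 0" for M
  proof -
    obtain r C where r: "0 < r" "C > 0"
      "\<And>p t. 0 < p \<Longrightarrow> p \<le> r \<Longrightarrow> 0 \<le> t \<Longrightarrow> ennreal ((1 + t) powr p) \<le> ennreal C * (1 + extend_infinity \<Phi> (ennreal t))"
      using extend_infinity_growth[OF assms(1)] by metis
    \<comment> \<open>Solves t^r = C (M + 1), so that (1 + t)^r \<le> C (1 + \<Phi>(t)) yields
      \<Phi>(t) \<ge> M.\<close>
    define t where "t = (C * (M + 1)) powr (1 / r)"
    have "0 < t" "t powr r = C * (M + 1)" using r that by (auto simp: t_def powr_powr)
    then have "ennreal C * ennreal (1 + M) \<le> ennreal ((1 + t) powr r)"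
      using r that powr_mono2[of r t "1 + t"] \<open>0 < t\<close>
      by (subst ennreal_mult'[symmetric]) (auto intro!: ennreal_leI simp flip: \<open>t powr r = C * (M + 1)\<close> simp: add.commute)
    also have "\<dots> \<le> ennreal C * (1 + extend_infinity \<Phi> (ennreal t))"
      using r \<open>0 < t\<close> by (intro r) auto
    finally have "ennreal (1 + M) \<le> 1 + extend_infinity \<Phi> (ennreal t)"
      using r by (simp add: ennreal_mult_le_mult_iff)
    then have M: "ennreal M \<le> extend_infinity \<Phi> (ennreal t)"
      using that by (simp add: ennreal_plus)
    have "\<forall>\<^sub>F n in F. ennreal (t * l) < f n"
      using assms(4) top by (intro less_LiminfD) (auto simp: top_unique)
    then have "\<forall>\<^sub>F n in F. ennreal M \<le> extend_infinity \<Phi> (f n / ennreal l)"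
    proof eventually_elim
      case (elim n)
      have "ennreal t = ennreal (t * l) / ennreal l"
        using assms \<open>0 < t\<close> by (simp add: divide_ennreal)
      also have "\<dots> \<le> f n / ennreal l"
        by (rule divide_right_mono_ennreal) (use elim in simp)
      finally show ?case using M monoD[OF mono_extend_infinity[OF assms(1)]] order_trans by blast
    qed
    then show ?thesis by (rule Liminf_bounded)
  qed
  note ge = this
  have "Liminf F (\<lambda>n. extend_infinity \<Phi> (f n / ennreal l)) = top" (is "?L = top")
  proof (cases ?L)
    case (real y)
    with ge[of "y + 1"] show ?thesis by simp
  qed simp
  then show ?thesis by simp
qed

text \<open>Fatou's lemma for the modulars. Two levels l < m are placed between the lower limit and
  the norm of h: infinitely many f n have modular at most 1 at level l, and the gap up to m pays for
  the missing semicontinuity.\<close>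

lemma orlicz_norm_liminf:
  assumes "quasi_young \<Phi>" and [measurable]: "\<And>n. f n \<in> borel_measurable borel"
    and "\<And>x. h x \<le> liminf (\<lambda>n. f n x)"
  shows "orlicz_norm \<Phi> h \<le> liminf (\<lambda>n. orlicz_norm \<Phi> (f n))"
proof (rule ccontr)
  assume "\<not> ?thesis"
  then obtain m where m: "liminf (\<lambda>n. orlicz_norm \<Phi> (f n)) < ennreal m" "ennreal m < orlicz_norm \<Phi> h"
    by (metis dense ennreal_cases not_le top.extremum_strict less_top)
  then obtain l where l: "liminf (\<lambda>n. orlicz_norm \<Phi> (f n)) < ennreal l" "ennreal l < ennreal m"
    by (metis dense ennreal_cases top.extremum_strict less_top ennreal_neq_top not_less_iff_gr_or_eq)
  have "l < m" using l(2) by (meson ennreal_leI not_le)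
  moreover have "0 < l" using l(1) by (metis ennreal_neg not_le not_less_zero)
  ultimately have lm: "0 < l" "l < m" by auto
  note [measurable] = measurable_extend_infinity[OF assms(1)]
  have "(\<integral>\<^sup>+x. extend_infinity \<Phi> (h x / ennreal m) \<partial>lborel) \<le>
      (\<integral>\<^sup>+x. liminf (\<lambda>n. extend_infinity \<Phi> (f n x / ennreal l)) \<partial>lborel)"
    by (intro nn_integral_mono extend_infinity_Liminf assms lm) auto
  also have "\<dots> \<le> liminf (\<lambda>n. \<integral>\<^sup>+x. extend_infinity \<Phi> (f n x / ennreal l) \<partial>lborel)"
    by (intro nn_integral_liminf) measurable
  also have "\<dots> \<le> 1"
  proof (rule ccontr)
    assume "\<not> ?thesis"
    then have "\<forall>\<^sub>F n in sequentially. 1 < (\<integral>\<^sup>+x. extend_infinity \<Phi> (f n x / ennreal l) \<partial>lborel)"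
      by (intro less_LiminfD) auto
    moreover have "\<exists>\<^sub>F n in sequentially. orlicz_norm \<Phi> (f n) < ennreal l"
      by (rule frequently_less_of_Liminf_less[OF l(1)])
    then have "\<exists>\<^sub>F n in sequentially. \<not> 1 < (\<integral>\<^sup>+x. extend_infinity \<Phi> (f n x / ennreal l) \<partial>lborel)"
      by (rule frequently_elim1) (use orlicz_norm_less_modular[OF assms(1)] in \<open>auto simp: not_less\<close>)
    ultimately show False by (simp add: frequently_def)
  qed
  finally have "orlicz_norm \<Phi> h \<le> ennreal m" using lm by (intro orlicz_norm_le) auto
  with m show False by simp
qed

text \<open>For 0 \<le> h \<le> 1 the scaling inequality gives \<Phi>(a t h) \<le> (a h)^r
  \<Phi>(t), so finiteness of \<Phi> at one t > 0 controls the modular by the integral of h^r. K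
  depends on I but not on h, which later gives uniformity over translates.\<close>

lemma orlicz_norm_bounded:
  fixes \<Phi> :: "real \<Rightarrow> ennreal"
  assumes "quasi_young \<Phi>" "t > 0" "\<Phi> t < \<infinity>"
  obtains r where "0 < r" "r \<le> 1"
    "\<And>I. \<exists>K. \<forall>h::'a::euclidean_space \<Rightarrow> real. h \<in> borel_measurable borel \<longrightarrow> (\<forall>x. 0 \<le> h x \<and> h x \<le> 1) \<longrightarrow>
      (\<integral>\<^sup>+x. ennreal (h x powr r) \<partial>lborel) \<le> ennreal I \<longrightarrow> orlicz_norm \<Phi> (\<lambda>x. ennreal (h x)) \<le> ennreal K"
proof -
  obtain r where r: "0 < r" "r \<le> 1" 
    "\<And>a t. 0 \<le> a \<Longrightarrow> a \<le> 1 \<Longrightarrow> extend_infinity \<Phi> (ennreal a * t) \<le> ennreal (a powr r) * extend_infinity \<Phi> t"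
    using extend_infinity_scale[OF assms(1)] by blast
  have "\<exists>K. \<forall>h::'a \<Rightarrow> real. h \<in> borel_measurable borel \<longrightarrow> (\<forall>x. 0 \<le> h x \<and> h x \<le> 1) \<longrightarrow>
      (\<integral>\<^sup>+x. ennreal (h x powr r) \<partial>lborel) \<le> ennreal I \<longrightarrow> orlicz_norm \<Phi> (\<lambda>x. ennreal (h x)) \<le> ennreal K" for I
  proof -
    obtain b where b: "\<Phi> t = ennreal b" "0 \<le> b" using assms(3) by (cases "\<Phi> t") auto
    \<comment> \<open>Small enough for a^r \<Phi>(t) I \<le> 1. The matching level is 1 / (a t),
      since dividing h by it gives (a h) t.\<close>
    define a where "a = min 1 ((1 / (1 + b * max I 0)) powr (1 / r))"
    have pos: "0 < 1 + b * max I 0" using b by (simp add: add_pos_nonneg)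
    then have a: "0 < a" "a \<le> 1" by (auto simp: a_def)
    have "a powr r \<le> ((1 / (1 + b * max I 0)) powr (1 / r)) powr r"
      using r a by (intro powr_mono2) (auto simp: a_def)
    also have "\<dots> = 1 / (1 + b * max I 0)"
      using r pos by (simp add: powr_powr)
    finally have "a powr r * b * max I 0 \<le> 1 / (1 + b * max I 0) * (b * max I 0)"
      using b by (metis (no_types, opaque_lifting) max.cobounded2 mult.assoc mult_nonneg_nonneg mult_right_mono)
    also have "\<dots> \<le> 1" using pos by (simp add: divide_simps)
    finally have ab: "a powr r * b * max I 0 \<le> 1" .
    define l where "l = 1 / (a * t)"
    have l: "l > 0" using a assms by (simp add: l_def)
    have "orlicz_norm \<Phi> (\<lambda>x. ennreal (h x)) \<le> ennreal l"
      if [measurable]: "h \<in> borel_measurable borel" and h: "\<forall>x. 0 \<le> h x \<and> h x \<le> 1"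
        and I: "(\<integral>\<^sup>+x. ennreal (h x powr r) \<partial>lborel) \<le> ennreal I" for h :: "'a \<Rightarrow> real"
    proof (rule orlicz_norm_le[OF l])
      have pt: "extend_infinity \<Phi> (ennreal (h x) / ennreal l) \<le> ennreal (a powr r * b) * ennreal (h x powr r)" for x
      proof -
        have "ennreal (h x) / ennreal l = ennreal (a * h x) * ennreal t"
          using h[rule_format, of x] l a assms(2) by (simp add: divide_ennreal l_def ennreal_mult'[symmetric] mult_ac)
        also have "extend_infinity \<Phi> \<dots> \<le> ennreal ((a * h x) powr r) * extend_infinity \<Phi> (ennreal t)"
          using h[rule_format, of x] a by (intro r) (auto intro: mult_le_one)
        also have "\<dots> = ennreal (a powr r * b) * ennreal (h x powr r)"
          using h[rule_format, of x] a b assms(2) by (simp add: ennreal_mult'[symmetric] powr_mult mult_ac)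
        finally show ?thesis .
      qed
      have "(\<integral>\<^sup>+x. extend_infinity \<Phi> (ennreal (h x) / ennreal l) \<partial>lborel) \<le> (\<integral>\<^sup>+x. ennreal (a powr r * b) * ennreal (h x powr r) \<partial>lborel)"
        by (intro nn_integral_mono pt)
      also have "\<dots> = ennreal (a powr r * b) * (\<integral>\<^sup>+x. ennreal (h x powr r) \<partial>lborel)"
        by (rule nn_integral_cmult) measurable
      also have "\<dots> \<le> ennreal (a powr r * b) * ennreal (max I 0)"
        using I by (intro mult_left_mono) (auto intro: order_trans ennreal_leI)
      also have "\<dots> = ennreal (a powr r * b * max I 0)" using b by (subst ennreal_mult) auto
      also have "\<dots> \<le> 1" by (simp only: ennreal_le_1 ab)
      finally show "(\<integral>\<^sup>+x. extend_infinity \<Phi> (ennreal (h x) / ennreal l) \<partial>lborel) \<le> 1" .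
    qed
    then show ?thesis by blast
  qed
  with r show ?thesis by (intro that) auto
qed

text \<open>From f \<le> l (1 + f / l) and the growth bound, f^p is controlled by the modular
  integrand at level l; the constant 1 in that bound integrates to the measure of A.\<close>

lemma orlicz_norm_nn_integral_powr:
  assumes "quasi_young \<Phi>"
  obtains r C where "0 < r" "r \<le> 1" "C > 0"
    "\<And>p t. 0 < p \<Longrightarrow> p \<le> r \<Longrightarrow> 0 \<le> t \<Longrightarrow> ennreal ((1 + t) powr p) \<le> ennreal C * (1 + extend_infinity \<Phi> (ennreal t))"
    "\<And>p (f :: 'a::euclidean_space \<Rightarrow> real) A l. 0 < p \<Longrightarrow> p \<le> r \<Longrightarrow> f \<in> borel_measurable borel \<Longrightarrow> (\<And>x. 0 \<le> f x) \<Longrightarrow> A \<in> sets borel \<Longrightarrow>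
      orlicz_norm \<Phi> (\<lambda>x. ennreal (f x)) < ennreal l \<Longrightarrow>
      (\<integral>\<^sup>+x\<in>A. ennreal (f x powr p) \<partial>lborel) \<le> ennreal (C * l powr p) * (emeasure lborel A + 1)"
proof -
  obtain r C where r: "0 < r" "r \<le> 1" "C > 0"
      "\<And>p t. 0 < p \<Longrightarrow> p \<le> r \<Longrightarrow> 0 \<le> t \<Longrightarrow> ennreal ((1 + t) powr p) \<le> ennreal C * (1 + extend_infinity \<Phi> (ennreal t))"
    using extend_infinity_growth[OF assms] by metis
  note [measurable] = measurable_extend_infinity[OF assms]
  have "(\<integral>\<^sup>+x\<in>A. ennreal (f x powr p) \<partial>lborel) \<le> ennreal (C * l powr p) * (emeasure lborel A + 1)"
    if "0 < p" "p \<le> r" and [measurable]: "f \<in> borel_measurable borel" "A \<in> sets borel" and f: "\<And>x. 0 \<le> f x"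
      and l: "orlicz_norm \<Phi> (\<lambda>x. ennreal (f x)) < ennreal l" for p A l and f :: "'a \<Rightarrow> real"
  proof -
    have "0 < l" using l by (metis ennreal_neg not_le not_less_zero)
    let ?F = "\<lambda>x. extend_infinity \<Phi> (ennreal (f x) / ennreal l)"
    have pt: "ennreal (f x powr p) * indicator A x \<le> ennreal (C * l powr p) * (indicator A x + ?F x)" for x
    proof (cases "x \<in> A")
      case True
      have "ennreal (f x powr p) \<le> ennreal (l powr p * (1 + f x / l) powr p)"
        using f[of x] \<open>0 < l\<close> that by (subst powr_mult[symmetric]) (auto intro!: ennreal_leI powr_mono2 simp: field_simps)
      also have "\<dots> = ennreal (l powr p) * ennreal ((1 + f x / l) powr p)"
        by (simp add: ennreal_mult')
      also have "\<dots> \<le> ennreal (l powr p) * (ennreal C * (1 + extend_infinity \<Phi> (ennreal (f x / l))))"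
        using f[of x] \<open>0 < l\<close> that by (intro mult_left_mono r) auto
      also have "\<dots> = ennreal (C * l powr p) * (1 + ?F x)"
        using r f[of x] \<open>0 < l\<close> by (simp add: divide_ennreal ennreal_mult' mult_ac)
      finally show ?thesis using True by simp
    qed auto
    have "(\<integral>\<^sup>+x\<in>A. ennreal (f x powr p) \<partial>lborel) \<le> (\<integral>\<^sup>+x. ennreal (C * l powr p) * (indicator A x + ?F x) \<partial>lborel)"
      by (intro nn_integral_mono pt)
    also have "\<dots> = ennreal (C * l powr p) * (emeasure lborel A + (\<integral>\<^sup>+x. ?F x \<partial>lborel))"
      by (subst nn_integral_cmult, measurable, subst nn_integral_add) auto
    also have "\<dots> \<le> ennreal (C * l powr p) * (emeasure lborel A + 1)"
      by (intro mult_left_mono add_left_mono orlicz_norm_less_modular assms l) auto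
    finally show ?thesis .
  qed
  with r show ?thesis by (intro that[of r C]) auto
qed

section \<open>Mixed Orlicz quasi-norms\<close>

text \<open>The weight is absorbed into u, and u takes values in \<open>ennreal\<close>, so that
  maxima and Gaussian majorants are handled like transforms.\<close>

definition mixed_norm :: "(real \<Rightarrow> ennreal) \<Rightarrow> (real \<Rightarrow> ennreal) \<Rightarrow> ('a::euclidean_space \<times> 'a \<Rightarrow> ennreal) \<Rightarrow> ennreal" where
  "mixed_norm \<Phi> \<Psi> u = orlicz_norm \<Psi> (\<lambda>\<xi>. orlicz_norm \<Phi> (\<lambda>x. u (x, \<xi>)))"

lemma mixed_norm_mono:
  assumes "quasi_young \<Phi>" "quasi_young \<Psi>" "\<And>X. u X \<le> v X"
  shows "mixed_norm \<Phi> \<Psi> u \<le> mixed_norm \<Phi> \<Psi> v"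
  unfolding mixed_norm_def by (intro orlicz_norm_mono assms)

lemma mixed_norm_cmult_le:
  assumes "quasi_young \<Phi>" "quasi_young \<Psi>" "0 < c"
  shows "mixed_norm \<Phi> \<Psi> (\<lambda>X. ennreal c * u X) \<le> ennreal c * mixed_norm \<Phi> \<Psi> u"
proof -
  have "mixed_norm \<Phi> \<Psi> (\<lambda>X. ennreal c * u X) \<le> orlicz_norm \<Psi> (\<lambda>\<xi>. ennreal c * orlicz_norm \<Phi> (\<lambda>x. u (x, \<xi>)))"
    unfolding mixed_norm_def by (intro orlicz_norm_mono orlicz_norm_cmult_le assms)
  also have "\<dots> \<le> ennreal c * mixed_norm \<Phi> \<Psi> u"
    unfolding mixed_norm_def by (intro orlicz_norm_cmult_le assms)
  finally show ?thesis .
qed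

lemma mixed_norm_le_cmult:
  assumes "quasi_young \<Phi>" "quasi_young \<Psi>" "0 < c" "\<And>X. u X \<le> ennreal c * v X"
  shows "mixed_norm \<Phi> \<Psi> u \<le> ennreal c * mixed_norm \<Phi> \<Psi> v"
  by (rule order_trans[OF mixed_norm_mono[OF assms(1,2,4)] mixed_norm_cmult_le[OF assms(1-3)]])

lemma measurable_sections:
  fixes u :: "'a::euclidean_space \<times> 'b::euclidean_space \<Rightarrow> 'c::{second_countable_topology, t2_space}"
  assumes [measurable]: "u \<in> borel_measurable borel"
  shows "(\<lambda>x. u (x, \<xi>)) \<in> borel_measurable borel"
proof -
  have [measurable]: "u \<in> borel_measurable (borel \<Otimes>\<^sub>M borel)" by (simp add: borel_prod)
  show ?thesis by measurable
qed

lemma mixed_norm_max_le: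
  assumes \<Phi>: "quasi_young \<Phi>" and \<Psi>: "quasi_young \<Psi>"
  obtains \<kappa> where "\<kappa> \<ge> 1" "\<And>u v :: 'a::euclidean_space \<times> 'a \<Rightarrow> ennreal.
    u \<in> borel_measurable borel \<Longrightarrow> v \<in> borel_measurable borel \<Longrightarrow>
    mixed_norm \<Phi> \<Psi> (\<lambda>X. max (u X) (v X)) \<le> ennreal \<kappa> * max (mixed_norm \<Phi> \<Psi> u) (mixed_norm \<Phi> \<Psi> v)"
proof -
  obtain \<kappa>1 where 1: "\<kappa>1 \<ge> 1" "\<And>f g :: 'a \<Rightarrow> ennreal. f \<in> borel_measurable borel \<Longrightarrow> g \<in> borel_measurable borel \<Longrightarrow>
    orlicz_norm \<Phi> (\<lambda>x. max (f x) (g x)) \<le> ennreal \<kappa>1 * max (orlicz_norm \<Phi> f) (orlicz_norm \<Phi> g)"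
    using orlicz_norm_max_le[OF \<Phi>] by blast
  obtain \<kappa>2 where 2: "\<kappa>2 \<ge> 1" "\<And>f g :: 'a \<Rightarrow> ennreal. f \<in> borel_measurable borel \<Longrightarrow> g \<in> borel_measurable borel \<Longrightarrow>
    orlicz_norm \<Psi> (\<lambda>x. max (f x) (g x)) \<le> ennreal \<kappa>2 * max (orlicz_norm \<Psi> f) (orlicz_norm \<Psi> g)"
    using orlicz_norm_max_le[OF \<Psi>] by blast
  have "mixed_norm \<Phi> \<Psi> (\<lambda>X. max (u X) (v X)) \<le> ennreal (\<kappa>1 * \<kappa>2) * max (mixed_norm \<Phi> \<Psi> u) (mixed_norm \<Phi> \<Psi> v)"
    if u: "u \<in> borel_measurable borel" and v: "v \<in> borel_measurable borel" for u v :: "'a \<times> 'a \<Rightarrow> ennreal"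
  proof -
    have "mixed_norm \<Phi> \<Psi> (\<lambda>X. max (u X) (v X)) \<le>
      orlicz_norm \<Psi> (\<lambda>\<xi>. ennreal \<kappa>1 * max (orlicz_norm \<Phi> (\<lambda>x. u (x, \<xi>))) (orlicz_norm \<Phi> (\<lambda>x. v (x, \<xi>))))"
      unfolding mixed_norm_def by (intro orlicz_norm_mono \<Psi> 1 measurable_sections u v)
    also have "\<dots> \<le> ennreal \<kappa>1 * orlicz_norm \<Psi> (\<lambda>\<xi>. max (orlicz_norm \<Phi> (\<lambda>x. u (x, \<xi>))) (orlicz_norm \<Phi> (\<lambda>x. v (x, \<xi>))))"
      using 1 by (intro orlicz_norm_cmult_le \<Psi>) auto
    also have "\<dots> \<le> ennreal \<kappa>1 * (ennreal \<kappa>2 * max (mixed_norm \<Phi> \<Psi> u) (mixed_norm \<Phi> \<Psi> v))"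
      unfolding mixed_norm_def
      by (intro mult_left_mono 2 borel_measurable_orlicz_norm_section \<Phi> u v) auto
    finally show ?thesis using 1 2 by (simp add: ennreal_mult' mult.assoc)
  qed
  moreover have "1 * 1 \<le> \<kappa>1 * \<kappa>2" using 1 2 by (intro mult_mono) auto
  ultimately show ?thesis by (intro that[of "\<kappa>1 * \<kappa>2"]) auto
qed

lemma mixed_norm_liminf:
  assumes \<Phi>: "quasi_young \<Phi>" and \<Psi>: "quasi_young \<Psi>" and f: "\<And>n. f n \<in> borel_measurable borel"
    and "\<And>X. h X \<le> liminf (\<lambda>n. f n X)"
  shows "mixed_norm \<Phi> \<Psi> h \<le> liminf (\<lambda>n. mixed_norm \<Phi> \<Psi> (f n))"
  unfolding mixed_norm_def
  by (intro orlicz_norm_liminf borel_measurable_orlicz_norm_section measurable_sections assms)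

text \<open>Both functions embed locally into L^p for the smaller of their two exponents. A product
  of balls, rather than a ball of the product space, lets the two norms be treated one variable at a
  time.\<close>

lemma mixed_norm_nn_integral_powr:
  assumes \<Phi>: "quasi_young \<Phi>" and \<Psi>: "quasi_young \<Psi>"
  obtains p C where "0 < p" "p \<le> 1" "C > 0"
    "\<And>u x0 \<xi>0 L. u \<in> borel_measurable borel \<Longrightarrow> (\<And>X. 0 \<le> u X) \<Longrightarrow>
      mixed_norm \<Phi> \<Psi> (\<lambda>X. ennreal (u X)) < ennreal L \<Longrightarrow>
      (\<integral>\<^sup>+X\<in>cball x0 1 \<times> cball (\<xi>0 :: 'a::euclidean_space) 1. ennreal (u X powr p) \<partial>lborel) \<le> ennreal (C * L powr p)"
proof -
  obtain r C where r: "0 < r" "r \<le> 1" "C > 0"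
    "\<And>p t. 0 < p \<Longrightarrow> p \<le> r \<Longrightarrow> 0 \<le> t \<Longrightarrow> ennreal ((1 + t) powr p) \<le> ennreal C * (1 + extend_infinity \<Phi> (ennreal t))"
    "\<And>p f A l. 0 < p \<Longrightarrow> p \<le> r \<Longrightarrow> f \<in> borel_measurable borel \<Longrightarrow> (\<And>x::'a. 0 \<le> f x) \<Longrightarrow> A \<in> sets borel \<Longrightarrow>
      orlicz_norm \<Phi> (\<lambda>x. ennreal (f x)) < ennreal l \<Longrightarrow>
      (\<integral>\<^sup>+x\<in>A. ennreal (f x powr p) \<partial>lborel) \<le> ennreal (C * l powr p) * (emeasure lborel A + 1)"
    using orlicz_norm_nn_integral_powr[OF \<Phi>, where 'a='a] by blast
  obtain s D where s: "0 < s" "s \<le> 1" "D > 0"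
    "\<And>p t. 0 < p \<Longrightarrow> p \<le> s \<Longrightarrow> 0 \<le> t \<Longrightarrow> ennreal ((1 + t) powr p) \<le> ennreal D * (1 + extend_infinity \<Psi> (ennreal t))"
    using extend_infinity_growth[OF \<Psi>] by blast
  define p where "p = min r s"
  have p: "0 < p" "p \<le> 1" "p \<le> r" "p \<le> s" using r s by (auto simp: p_def)
  define V where "V = measure lborel (cball (0::'a) 1)"
  have V: "emeasure lborel (cball x 1) = ennreal V" for x :: 'a
  proof -
    have "emeasure lborel (cball x 1) = emeasure lborel (cball (0::'a) 1)"
      by (simp add: emeasure_cball)
    also have "\<dots> = ennreal V"
      unfolding V_def by (intro emeasure_eq_ennreal_measure) (use emeasure_lborel_cball_finite in \<open>auto simp: less_top\<close>)
    finally show ?thesis .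
  qed
  have "V \<ge> 0" by (simp add: V_def)
  note [measurable] = measurable_extend_infinity[OF \<Psi>]
  have "(\<integral>\<^sup>+X\<in>cball x0 1 \<times> cball \<xi>0 1. ennreal (u X powr p) \<partial>lborel) \<le> ennreal (C * (V + 1) * D * (V + 1) * L powr p)"
    if u[measurable]: "u \<in> borel_measurable borel" and u0: "\<And>X. 0 \<le> u X"
      and L: "mixed_norm \<Phi> \<Psi> (\<lambda>X. ennreal (u X)) < ennreal L" for u L and x0 \<xi>0 :: 'a
  proof -
    have "0 < L" using L by (metis ennreal_neg not_le not_less_zero)
    define G where "G \<xi> = orlicz_norm \<Phi> (\<lambda>x. ennreal (u (x, \<xi>)))" for \<xi>
    have G[measurable]: "G \<in> borel_measurable borel"
      unfolding G_def by (rule borel_measurable_orlicz_norm_section[OF \<Phi>]) measurable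
    \<comment> \<open>The level used for the inner norm g is g + L: it lies strictly above g, and (g
      + L)^p = L^p (1 + g / L)^p is what the growth of \<Psi> bounds through \<Psi>(g / L).\<close>
    have inner: "(\<integral>\<^sup>+x\<in>cball x0 1. ennreal (u (x, \<xi>) powr p) \<partial>lborel)
       \<le> ennreal (C * (V + 1) * D * L powr p) * (1 + extend_infinity \<Psi> (G \<xi> / ennreal L))" for \<xi>
    proof (cases "G \<xi>")
      case (real g)
      have "(\<integral>\<^sup>+x\<in>cball x0 1. ennreal (u (x, \<xi>) powr p) \<partial>lborel) \<le> ennreal (C * (g + L) powr p) * (ennreal V + 1)"
        using r(5)[of p "\<lambda>x. u (x, \<xi>)" "cball x0 1" "g + L"] p u0 \<open>0 < L\<close> measurable_sections[OF u, of \<xi>] real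
        by (simp add: V G_def[symmetric] ennreal_less_iff)
      also have "\<dots> = ennreal (C * (V + 1)) * ennreal ((g + L) powr p)"
        using \<open>V \<ge> 0\<close> r by (simp add: ennreal_mult' mult_ac)
      also have "(g + L) powr p = L powr p * (1 + g / L) powr p"
        proof -
        have "g + L = L * (1 + g / L)" using \<open>0 < L\<close> by (simp add: distrib_left)
        then show ?thesis using \<open>0 < L\<close> real by (simp add: powr_mult)
      qed
      also have "ennreal (C * (V + 1)) * ennreal (L powr p * (1 + g / L) powr p) =
          ennreal (C * (V + 1) * L powr p) * ennreal ((1 + g / L) powr p)"
        using r \<open>V \<ge> 0\<close> by (simp add: ennreal_mult'[symmetric] mult_ac)
      also have "\<dots> \<le> ennreal (C * (V + 1) * L powr p) * (ennreal D * (1 + extend_infinity \<Psi> (ennreal (g / L))))"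
        using \<open>0 < L\<close> real p by (intro mult_left_mono s) auto
      also have "\<dots> = ennreal (C * (V + 1) * L powr p * D) * (1 + extend_infinity \<Psi> (G \<xi> / ennreal L))"
        using r s \<open>V \<ge> 0\<close> \<open>0 < L\<close> real by (simp only: divide_ennreal mult.assoc[symmetric] ennreal_mult'[symmetric])
          (simp add: ennreal_mult'' mult_ac)
      finally show ?thesis by (simp add: mult_ac)
    next
      case top
      \<comment> \<open>For an infinite inner norm the right side is infinite because its constant
        is positive; in \<open>ennreal\<close> a zero constant would make it 0.\<close>
      have "C \<noteq> 0" "V + 1 \<noteq> 0" "D \<noteq> 0" "L \<noteq> 0" using r s \<open>0 < L\<close> \<open>V \<ge> 0\<close> by auto
      then have "0 < C * (V + 1) * D * L powr p" using r s \<open>V \<ge> 0\<close> by simp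
      then have "ennreal (C * (V + 1) * D * L powr p) \<noteq> 0" by (metis ennreal_eq_0_iff not_le)
      then show ?thesis by (simp add: top ennreal_mult_top ennreal_top_divide)
    qed
    have [measurable]: "cball x0 1 \<times> cball \<xi>0 1 \<in> sets borel"
      by (intro borel_closed closed_Times) auto
    have M: "(\<lambda>X. ennreal (u X powr p) * indicator (cball x0 1 \<times> cball \<xi>0 1) X) \<in> borel_measurable borel"
      by measurable
    have "(\<integral>\<^sup>+X\<in>cball x0 1 \<times> cball \<xi>0 1. ennreal (u X powr p) \<partial>lborel) =
       (\<integral>\<^sup>+X. ennreal (u X powr p) * indicator (cball x0 1 \<times> cball \<xi>0 1) X \<partial>(lborel \<Otimes>\<^sub>M lborel))"
      by (simp add: lborel_prod)
    also have "\<dots> = (\<integral>\<^sup>+\<xi>. (\<integral>\<^sup>+x. ennreal (u (x, \<xi>) powr p) * indicator (cball x0 1 \<times> cball \<xi>0 1) (x, \<xi>) \<partial>lborel) \<partial>lborel)"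
      by (intro lborel_pair.nn_integral_snd[symmetric]) (simp add: lborel_prod M)
    also have "\<dots> = (\<integral>\<^sup>+\<xi>\<in>cball \<xi>0 1. (\<integral>\<^sup>+x\<in>cball x0 1. ennreal (u (x, \<xi>) powr p) \<partial>lborel) \<partial>lborel)"
      by (intro nn_integral_cong) (auto simp: indicator_def)
    also have "\<dots> \<le> (\<integral>\<^sup>+\<xi>. ennreal (C * (V + 1) * D * L powr p) * (indicator (cball \<xi>0 1) \<xi> + extend_infinity \<Psi> (G \<xi> / ennreal L)) \<partial>lborel)"
      using inner by (intro nn_integral_mono) (auto simp: indicator_def)
    also have "\<dots> = ennreal (C * (V + 1) * D * L powr p) * (ennreal V + (\<integral>\<^sup>+\<xi>. extend_infinity \<Psi> (G \<xi> / ennreal L) \<partial>lborel))"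
    proof -
      have 1: "(\<lambda>\<xi>. extend_infinity \<Psi> (G \<xi> / ennreal L)) \<in> borel_measurable lborel"
        by measurable
      have 2: "(indicator (cball \<xi>0 1) :: 'a \<Rightarrow> ennreal) \<in> borel_measurable lborel"
        by (rule borel_measurable_indicator) simp
      show ?thesis
        by (simp only: nn_integral_cmult[OF borel_measurable_add[OF 2 1]] nn_integral_add[OF 2 1]) (simp add: V)
    qed
    also have "\<dots> \<le> ennreal (C * (V + 1) * D * L powr p) * (ennreal V + 1)"
      using L unfolding mixed_norm_def G_def
      by (intro mult_left_mono add_left_mono orlicz_norm_less_modular \<Psi>) auto
    also have "\<dots> = ennreal (C * (V + 1) * D * L powr p * (V + 1))"
      using \<open>V \<ge> 0\<close> r s by (subst ennreal_mult) auto
    finally show ?thesis by (simp add: mult_ac)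
  qed
  moreover have "0 < C * (V + 1) * D * (V + 1)" using r s \<open>V \<ge> 0\<close> by (simp add: add_nonneg_pos)
  ultimately show ?thesis using p by (intro that[of p "C * (V + 1) * D * (V + 1)"]) auto
qed

section \<open>Moderate weights\<close>

lemma negligible_reflection:
  fixes N :: "'a::euclidean_space set"
  assumes "negligible N"
  shows "negligible ((\<lambda>x. y - x) ` N)"
proof -
  have "negligible ((+) y ` ((\<lambda>x. - x) ` N))"
    by (intro negligible_translation negligible_differentiable_image_negligible assms)
      (auto intro!: derivative_intros simp: differentiable_on_def)
  then show ?thesis by (simp add: image_image)
qed

text \<open>The comparison weight v is bounded on compact sets only off a null set N, but a bound
  for every y is wanted. Since N and y - N cannot cover the unit ball, y is the sum of two steps a
  and y - a that both avoid N, and each step costs a factor c C.\<close>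

lemma moderate_weight_locally_bounded:
  fixes \<omega> :: "'a::euclidean_space \<Rightarrow> real"
  assumes "\<omega> \<in> moderate_weights"
  obtains D where "D \<ge> 1" "\<And>x y. norm y \<le> 1 \<Longrightarrow> \<omega> (x + y) \<le> D * \<omega> x"
proof -
  obtain v c where v: "weight v" and c: "c > 0" and m: "\<And>x y. \<omega> (x + y) \<le> c * \<omega> x * v y"
    and pos: "\<And>x. \<omega> x > 0"
    using assms by (auto simp: moderate_weights_def weight_def)
  \<comment> \<open>Radius 2 because y - a must lie in the ball for |y| \<le> 1 and |a| < 1.\<close>
  obtain C0 where C0: "AE x in lebesgue. x \<in> cball 0 2 \<longrightarrow> \<bar>v x\<bar> \<le> C0"
    using v compact_cball unfolding weight_def Linfty_loc_def by blast
  define C where "C = max C0 1"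
  define N where "N = {x. \<not> (x \<in> cball 0 2 \<longrightarrow> \<bar>v x\<bar> \<le> C0)}"
  have N: "negligible N"
    using C0 by (simp add: N_def negligible_iff_null_sets AE_iff_null_sets[symmetric] eventually_ae_filter, auto simp: eventually_ae_filter null_sets_completion_iff2 completion.complete2, meson order_trans)
  have vC: "v x \<le> C" if "norm x \<le> 2" "x \<notin> N" for x using that by (auto simp: N_def C_def)
  have "\<omega> (x + y) \<le> max 1 ((c * C)\<^sup>2) * \<omega> x" if y: "norm y \<le> 1" for x y
  proof -
    have "negligible (N \<union> (\<lambda>x. y - x) ` N)" using N by (intro negligible_Un negligible_reflection)
    moreover have "\<not> negligible (ball (0::'a) 1)" by (simp add: open_not_negligible)
    ultimately obtain a where a: "norm a < 1" "a \<notin> N" "a \<notin> (\<lambda>x. y - x) ` N"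
      using negligible_subset by (metis (no_types, lifting) UnCI mem_ball_0 subsetI)
    have "y - a \<notin> N" using a(3) by (metis (no_types, lifting) add_diff_cancel_right' diff_add_cancel image_iff diff_diff_eq2 add.commute)
    moreover have "norm (y - a) \<le> 2" using norm_triangle_ineq4[of y a] y a by simp
    ultimately have vle: "v (y - a) \<le> C" "v a \<le> C" using vC a by auto
    have C: "C > 0" by (simp add: C_def)
    have vpos: "0 < v z" for z using \<open>weight v\<close> by (simp add: weight_def)
    have "\<omega> (x + y) = \<omega> ((x + a) + (y - a))" by simp
    also have "\<dots> \<le> c * \<omega> (x + a) * v (y - a)" by (rule m)
    also have "\<dots> \<le> c * (c * \<omega> x * C) * C"
      using m[of x a] vle vpos[of "y - a"] c pos[of x] pos[of "x + a"] C
      by (intro mult_mono) (auto intro!: order_trans[OF m[of x a]] mult_left_mono simp: less_imp_le intro: order_trans)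
    also have "\<dots> = (c * C)\<^sup>2 * \<omega> x" by (simp add: power2_eq_square)
    also have "\<dots> \<le> max 1 ((c * C)\<^sup>2) * \<omega> x" using pos[of x] by (intro mult_right_mono) auto
    finally show ?thesis .
  qed
  then show ?thesis by (intro that[of "max 1 ((c * C)\<^sup>2)"]) auto
qed

text \<open>The way from y to x takes at most |x - y| + 1 steps of length at most 1, each costing a
  factor D; hence the rate r = ln D and the leading factor D.\<close>

lemma moderate_weight_exp_bound:
  fixes \<omega> :: "'a::euclidean_space \<Rightarrow> real"
  assumes "\<omega> \<in> moderate_weights"
  obtains D r where "D \<ge> 1" "r \<ge> 0" "\<And>x y. \<omega> x \<le> D * exp (r * norm (x - y)) * \<omega> y"
proof -
  obtain D where D: "D \<ge> 1" "\<And>x y. norm y \<le> 1 \<Longrightarrow> \<omega> (x + y) \<le> D * \<omega> x"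
    using moderate_weight_locally_bounded[OF assms] by blast
  have pos: "\<omega> x > 0" for x using assms by (simp add: moderate_weights_def weight_def)
  have iter: "norm y \<le> real n \<Longrightarrow> \<omega> (x + y) \<le> D ^ n * \<omega> x" for n x y
  proof (induction n arbitrary: y)
    case (Suc n)
    define z where "z = (real n / real (Suc n)) *\<^sub>R y"
    have "norm z = real n / real (Suc n) * norm y" by (simp add: z_def)
    also have "\<dots> \<le> real n / real (Suc n) * real (Suc n)" using Suc.prems by (intro mult_left_mono) auto
    finally have "norm z \<le> real n" by simp
    moreover have "y - z = (1 / real (Suc n)) *\<^sub>R y"
    proof -
      have "y - z = (1 - real n / real (Suc n)) *\<^sub>R y" by (simp add: z_def scaleR_left_diff_distrib)
      then show ?thesis by (simp add: field_simps)
    qed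
    then have "norm (y - z) \<le> 1" using Suc.prems by simp
    ultimately have "\<omega> (x + z + (y - z)) \<le> D * (D ^ n * \<omega> x)"
      using D Suc.IH[of z] by (meson mult_left_mono order_trans zero_le_one)
    then show ?case by (simp add: mult.assoc)
  qed simp
  have "\<omega> x \<le> D * exp (ln D * norm (x - y)) * \<omega> y" for x y
  proof -
    define n where "n = nat \<lceil>norm (x - y)\<rceil>"
    have "\<omega> (y + (x - y)) \<le> D ^ n * \<omega> y" by (rule iter) (simp add: n_def real_nat_ceiling_ge)
    also have "D ^ n \<le> D powr (norm (x - y) + 1)"
      using D(1) ceiling_correct[of "norm (x - y)"] by (subst powr_realpow[symmetric]) (auto simp: n_def intro!: powr_mono)
    also have "\<dots> = D * exp (ln D * norm (x - y))"
      using D(1) by (simp only: powr_add) (simp add: powr_def mult.commute)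
    finally show ?thesis using pos[of y] by simp
  qed
  then show ?thesis using D by (intro that[of D "ln D"]) auto
qed

text \<open>Stands in for a moderate weight: continuity gives Borel measurability, and the
  exponential bound, with leading constant 1, controls the variation of w over unit balls and
  against a Gaussian.\<close>

definition regular_weight :: "('a::real_normed_vector \<Rightarrow> real) \<Rightarrow> bool" where
  "regular_weight w \<longleftrightarrow> continuous_on UNIV w \<and> (\<forall>x. 0 < w x) \<and> (\<exists>r\<ge>0. \<forall>x y. w x \<le> exp (r * norm (x - y)) * w y)"

lemma regular_weight_pos: "regular_weight w \<Longrightarrow> 0 < w X"
  by (simp add: regular_weight_def)

text \<open>The sup-convolution with \<open>exp (- r |x|)\<close> makes the logarithm of a weight Lipschitz continuous.\<close>

lemma moderate_weight_regularization:
  fixes \<omega> :: "'a::euclidean_space \<Rightarrow> real"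
  assumes "\<omega> \<in> moderate_weights"
  shows "\<exists>w D. regular_weight w \<and> D \<ge> 1 \<and> (\<forall>x. 0 < \<omega> x \<and> \<omega> x \<le> w x \<and> w x \<le> D * \<omega> x)"
proof -
  obtain D r where D: "D \<ge> 1" "r \<ge> 0" "\<And>x y. \<omega> x \<le> D * exp (r * norm (x - y)) * \<omega> y"
    using moderate_weight_exp_bound[OF assms] by blast
  have pos: "\<omega> x > 0" for x using assms by (simp add: moderate_weights_def weight_def)
  define w where "w x = (SUP y. \<omega> y * exp (- r * norm (x - y)))" for x
  \<comment> \<open>This bound makes the supremum finite and at the same time gives w \<le> D
    \<omega>; the choice y = x in the supremum gives \<omega> \<le> w.\<close>
  have ub: "\<omega> y * exp (- r * norm (x - y)) \<le> D * \<omega> x" for x y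
    using mult_right_mono[OF D(3)[of y x], of "exp (- r * norm (x - y))"]
    by (simp add: norm_minus_commute exp_minus field_simps)
  have bdd: "bdd_above (range (\<lambda>y. \<omega> y * exp (- r * norm (x - y))))" for x
    using ub by (intro bdd_aboveI[of _ "D * \<omega> x"]) auto
  have ge: "\<omega> x \<le> w x" for x
    using cSUP_upper[OF UNIV_I bdd, of x x] by (simp add: w_def)
  have le: "w x \<le> D * \<omega> x" for x unfolding w_def by (rule cSUP_least) (use ub in auto)
  have lip: "w x \<le> exp (r * norm (x - y)) * w y" for x y
    unfolding w_def[of x]
  proof (rule cSUP_least)
    fix z
    have "\<omega> z * exp (- r * norm (x - z)) \<le> \<omega> z * exp (r * norm (x - y) - r * norm (y - z))"
    proof -
      have "norm (y - z) \<le> norm (x - y) + norm (x - z)"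
        using norm_triangle_ineq4[of "x - z" "x - y"] by (simp add: norm_minus_commute)
      from mult_left_mono[OF this D(2)] show ?thesis
        using pos[of z] by (intro mult_left_mono) (auto simp: distrib_left less_imp_le)
    qed
    also have "\<dots> = exp (r * norm (x - y)) * (\<omega> z * exp (- r * norm (y - z)))"
      by (simp add: exp_diff exp_minus field_simps)
    also have "\<dots> \<le> exp (r * norm (x - y)) * w y"
      using cSUP_upper[OF UNIV_I bdd, of z y] by (intro mult_left_mono) (auto simp: w_def)
    finally show "\<omega> z * exp (- r * norm (x - z)) \<le> exp (r * norm (x - y)) * w y" .
  qed auto
  have wpos: "0 < w x" for x using ge[of x] pos[of x] by simp
  have "isCont w x" for x
  proof -
    have "(w \<longlongrightarrow> w x) (at x)"
    proof (rule real_tendsto_sandwich)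
      show "\<forall>\<^sub>F y in at x. exp (- r * norm (x - y)) * w x \<le> w y"
        using lip[of x] by (intro always_eventually allI) (simp add: exp_minus field_simps)
      show "\<forall>\<^sub>F y in at x. w y \<le> exp (r * norm (y - x)) * w x" by (intro always_eventually allI lip)
      show "((\<lambda>y. exp (- r * norm (x - y)) * w x) \<longlongrightarrow> w x) (at x)" "((\<lambda>y. exp (r * norm (y - x)) * w x) \<longlongrightarrow> w x) (at x)"
        by (rule tendsto_eq_intros | simp)+
    qed
    then show ?thesis by (simp add: isCont_def)
  qed
  then have "continuous_on UNIV w" by (simp add: continuous_on_eq_continuous_at)
  then have "regular_weight w" using D(2) lip wpos unfolding regular_weight_def by blast
  with D(1) ge le pos show ?thesis by blast
qed

section \<open>Hermite coefficients of time-frequency shifted Gaussians\<close>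

text \<open>By the Rodrigues formula this is (-1)^n times the Hermite polynomial H_n in the
  normalization with leading coefficient 2^n.\<close>

fun gauss_poly :: "nat \<Rightarrow> real poly" where
  "gauss_poly 0 = 1"
| "gauss_poly (Suc n) = pderiv (gauss_poly n) - [:0, 2:] * gauss_poly n"

definition gauss_deriv :: "nat \<Rightarrow> real \<Rightarrow> real" where
  "gauss_deriv n y = poly (gauss_poly n) y * exp (- y\<^sup>2)"

lemma has_derivative_gauss_deriv: "(gauss_deriv n has_real_derivative gauss_deriv (Suc n) y) (at y)"
  unfolding gauss_deriv_def[abs_def]
  by (rule derivative_eq_intros refl poly_DERIV | simp)+ (simp add: algebra_simps)

lemma funpow_deriv_gaussian: "(deriv ^^ n) (\<lambda>s::real. exp (- s\<^sup>2)) = gauss_deriv n"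
proof (induction n)
  case (Suc n)
  have "deriv (gauss_deriv n) = gauss_deriv (Suc n)"
    by (rule ext) (rule DERIV_imp_deriv[OF has_derivative_gauss_deriv])
  with Suc show ?case by simp
qed (simp add: gauss_deriv_def fun_eq_iff)

lemma poly_exp_bound:
  fixes p :: "real poly"
  obtains C k where "C \<ge> 0" "k \<ge> 0" "\<And>y. \<bar>poly p y\<bar> \<le> C * exp (k * \<bar>y\<bar>)"
proof -
  have "\<exists>C k. C \<ge> 0 \<and> k \<ge> 0 \<and> (\<forall>y. \<bar>poly p y\<bar> \<le> C * exp (k * \<bar>y\<bar>))"
  proof (induction p)
    case (pCons a p)
    then obtain C k where Ck: "C \<ge> 0" "k \<ge> 0" "\<And>y. \<bar>poly p y\<bar> \<le> C * exp (k * \<bar>y\<bar>)" by blast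
    have "\<bar>poly (pCons a p) y\<bar> \<le> (\<bar>a\<bar> + C) * exp ((k + 1) * \<bar>y\<bar>)" for y
    proof -
      have "\<bar>y\<bar> \<le> exp \<bar>y\<bar>" using exp_ge_add_one_self[of "\<bar>y\<bar>"] by linarith
      then have "\<bar>y * poly p y\<bar> \<le> exp \<bar>y\<bar> * (C * exp (k * \<bar>y\<bar>))"
        using Ck by (simp only: abs_mult) (intro mult_mono, auto)
      also have "\<dots> = C * exp ((k + 1) * \<bar>y\<bar>)" by (simp add: exp_add distrib_right)
      finally have "\<bar>y * poly p y\<bar> \<le> C * exp ((k + 1) * \<bar>y\<bar>)" .
      moreover have "\<bar>a\<bar> * 1 \<le> \<bar>a\<bar> * exp ((k + 1) * \<bar>y\<bar>)" using Ck by (intro mult_left_mono) auto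
      ultimately show ?thesis
        using abs_triangle_ineq[of a "y * poly p y"] by (simp add: distrib_right)
    qed
    moreover have "\<bar>a\<bar> + C \<ge> 0" "k + 1 \<ge> 0" using Ck by auto
    ultimately show ?case by blast
  next
    case 0
    show ?case by (rule exI[of _ 0], simp, rule exI[of _ 0]) simp
  qed
  then show ?thesis using that by blast
qed

text \<open>Polynomial and exponential factors grow at most like exp (m |y|), and m |y| \<le> m^2 /
  2 + y^2 / 2. The bound gives integrability and also makes the boundary terms vanish in the
  integration by parts.\<close>

lemma gauss_deriv_exp_bound:
  fixes w :: complex
  obtains C where "\<And>y. cmod (exp (of_real y * w) * of_real (gauss_deriv n y)) \<le> C * exp (- y\<^sup>2 / 2)"
proof -
  obtain C k where Ck: "C \<ge> 0" "k \<ge> 0" "\<And>y. \<bar>poly (gauss_poly n) y\<bar> \<le> C * exp (k * \<bar>y\<bar>)"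
    using poly_exp_bound by blast
  define m where "m = k + \<bar>Re w\<bar>"
  have "cmod (exp (of_real y * w) * of_real (gauss_deriv n y)) \<le> (C * exp (m\<^sup>2 / 2)) * exp (- y\<^sup>2 / 2)" for y
  proof -
    have "y * Re w \<le> \<bar>y\<bar> * \<bar>Re w\<bar>" by (metis abs_ge_self abs_mult)
    then have "cmod (exp (of_real y * w)) \<le> exp (\<bar>y\<bar> * \<bar>Re w\<bar>)" by (simp add: norm_exp_eq_Re)
    then have "cmod (exp (of_real y * w) * of_real (gauss_deriv n y)) \<le> exp (\<bar>y\<bar> * \<bar>Re w\<bar>) * (C * exp (k * \<bar>y\<bar>) * exp (- y\<^sup>2))"
      unfolding norm_mult gauss_deriv_def norm_of_real abs_mult abs_exp_cancel
      using Ck by (intro mult_mono mult_right_mono) auto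
    also have "\<dots> = C * exp (m * \<bar>y\<bar> - y\<^sup>2)"
      by (simp add: m_def distrib_right exp_add exp_diff exp_minus field_simps)
    also have "\<dots> \<le> C * exp (m\<^sup>2 / 2 - y\<^sup>2 / 2)"
    proof -
      have "0 \<le> (m - \<bar>y\<bar>)\<^sup>2" by simp
      also have "\<dots> = m\<^sup>2 - 2 * (m * \<bar>y\<bar>) + y\<^sup>2" by (simp add: power2_eq_square algebra_simps)
      finally have "m * \<bar>y\<bar> - y\<^sup>2 \<le> m\<^sup>2 / 2 - y\<^sup>2 / 2" by simp
      then show ?thesis using Ck by (intro mult_left_mono) auto
    qed
    also have "\<dots> = (C * exp (m\<^sup>2 / 2)) * exp (- y\<^sup>2 / 2)" proof -
      have "m\<^sup>2 / 2 - y\<^sup>2 / 2 = m\<^sup>2 / 2 + - y\<^sup>2 / 2" by simp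
      then show ?thesis by (simp only: exp_add mult.assoc)
    qed
    finally show ?thesis .
  qed
  then show ?thesis by (rule that)
qed

lemma integrable_half_gaussian: "integrable lborel (\<lambda>y::real. exp (- y\<^sup>2 / 2))"
proof -
  have "integrable lborel (\<lambda>y::real. sqrt (2 * pi) * std_normal_density y)"
    by (intro integrable_mult_right) auto
  then show ?thesis by (simp add: std_normal_density_def)
qed

lemma continuous_gauss_deriv: "continuous_on UNIV (gauss_deriv n)"
  unfolding gauss_deriv_def[abs_def] by (intro continuous_intros)

lemma integrable_gauss_deriv_exp: "integrable lborel (\<lambda>y. exp (of_real y * w) * of_real (gauss_deriv n y) :: complex)"
proof -
  obtain C where C: "\<And>y. cmod (exp (of_real y * w) * of_real (gauss_deriv n y)) \<le> C * exp (- y\<^sup>2 / 2)"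
    using gauss_deriv_exp_bound[of w n] by blast
  have "integrable lborel (\<lambda>y::real. C * exp (- y\<^sup>2 / 2))"
    by (intro integrable_mult_right integrable_half_gaussian)
  moreover have "(\<lambda>y. exp (of_real y * w) * of_real (gauss_deriv n y) :: complex) \<in> borel_measurable lborel"
    by (simp, intro borel_measurable_continuous_onI continuous_intros continuous_on_subset[OF continuous_gauss_deriv]) auto
  ultimately show ?thesis
    by (rule Bochner_Integration.integrable_bound) (use C in \<open>auto intro!: AE_I2 order_trans[OF C]\<close>)
qed

text \<open>Integration by parts on the line: exp (y w) \<open>gauss_deriv n y\<close> is a
  primitive of the sum of the two integrands and vanishes at both ends.\<close>

lemma gauss_deriv_exp_integral_Suc:
  "(LINT y|lborel. exp (of_real y * w) * of_real (gauss_deriv (Suc n) y)) = - w * (LINT y|lborel. exp (of_real y * w) * of_real (gauss_deriv n y) :: complex)"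
proof -
  let ?F = "\<lambda>y. exp (of_real y * w) * of_real (gauss_deriv n y) :: complex"
  let ?f = "\<lambda>y. w * (exp (of_real y * w) * of_real (gauss_deriv n y)) + exp (of_real y * w) * of_real (gauss_deriv (Suc n) y) :: complex"
  obtain C where C: "\<And>y. cmod (?F y) \<le> C * exp (- y\<^sup>2 / 2)"
    using gauss_deriv_exp_bound[of w n] by blast
  have int: "integrable lborel ?f"
    by (intro Bochner_Integration.integrable_add integrable_mult_right integrable_gauss_deriv_exp)
  have lim: "(?F \<longlongrightarrow> 0) at_top" "(?F \<longlongrightarrow> 0) at_bot"
    by (rule Lim_null_comparison[OF always_eventually[OF allI[OF C]]]; real_asymp)+
  have "(LBINT y=-\<infinity>..\<infinity>. ?f y) = 0 - 0"
  proof (rule interval_integral_FTC_integrable)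
    fix y :: real
    have "((\<lambda>y. exp (of_real y * w)) has_vector_derivative w * exp (of_real y * w)) (at y)"
      by (rule has_vector_derivative_real_field[of "\<lambda>z. exp (z * w)", simplified]) (auto intro!: derivative_eq_intros)
    moreover have "((\<lambda>y. of_real (gauss_deriv n y) :: complex) has_vector_derivative of_real (gauss_deriv (Suc n) y)) (at y)"
      using has_derivative_gauss_deriv[of n y] has_vector_derivative_of_real by (simp add: has_real_derivative_iff_has_vector_derivative)
    ultimately show "(?F has_vector_derivative ?f y) (at y)"
      by (rule has_vector_derivative_mult[THEN has_vector_derivative_eq_rhs]) (simp add: algebra_simps)
    have "continuous_on UNIV ?f"
      by (intro continuous_intros continuous_on_subset[OF continuous_gauss_deriv]) auto
    then show "isCont ?f y" by (simp add: continuous_on_eq_continuous_at)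
  next
    show "set_integrable lborel (einterval (-\<infinity>) \<infinity>) ?f" using int by (simp add: set_integrable_def einterval_def)
    show "((?F \<circ> real_of_ereal) \<longlongrightarrow> 0) (at_right (-\<infinity>))" "((?F \<circ> real_of_ereal) \<longlongrightarrow> 0) (at_left \<infinity>)"
      using lim by (simp_all add: ereal_tendsto_simps)
  qed simp
  then have "(LINT y|lborel. ?f y) = 0"
    by (simp add: interval_lebesgue_integral_def einterval_def set_lebesgue_integral_def)
  then show ?thesis
    by (simp add: Bochner_Integration.integral_add integrable_gauss_deriv_exp add_eq_0_iff)
qed

text \<open>For w = a + i b this is the characteristic function of the standard normal law at b /
  sqrt 2 after the real substitution u = - a / sqrt 2 + sqrt 2 y, so no contour has to be
  shifted.\<close>

lemma gaussian_exp_integral: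
  "(LINT y|lborel. exp (of_real y * w) * of_real (exp (- y\<^sup>2))) = of_real (sqrt pi) * exp (w\<^sup>2 / 4)" for w :: complex
proof -
  define a b where "a = Re w" and "b = Im w"
  have w: "w = of_real a + \<i> * of_real b" by (simp add: a_def b_def complex_eq_iff)
  have "of_real (exp (- ((b / sqrt 2)\<^sup>2) / 2)) = char std_normal_distribution (b / sqrt 2)"
    by (simp add: char_std_normal_distribution)
  also have "\<dots> = (LINT u|lborel. std_normal_density u *\<^sub>R iexp (b / sqrt 2 * u))"
    unfolding char_def by (subst integral_density) (auto simp: normal_density_nonneg)
  also have "\<dots> = \<bar>sqrt 2\<bar> *\<^sub>R (LINT y|lborel. std_normal_density (- a / sqrt 2 + sqrt 2 * y) *\<^sub>R iexp (b / sqrt 2 * (- a / sqrt 2 + sqrt 2 * y)))"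
    by (rule lborel_integral_real_affine) simp
  also have "\<dots> = of_real (sqrt 2) * (LINT y|lborel. of_real (1 / sqrt (2 * pi)) * exp (- (w\<^sup>2 + of_real (b\<^sup>2)) / 4) * (exp (of_real y * w) * of_real (exp (- y\<^sup>2))))"
  proof -
    have "std_normal_density (- a / sqrt 2 + sqrt 2 * y) *\<^sub>R iexp (b / sqrt 2 * (- a / sqrt 2 + sqrt 2 * y)) =
      of_real (1 / sqrt (2 * pi)) * exp (- (w\<^sup>2 + of_real (b\<^sup>2)) / 4) * (exp (of_real y * w) * of_real (exp (- y\<^sup>2)))" for y
    proof -
      have e1: "- ((- a / sqrt 2 + sqrt 2 * y)\<^sup>2) / 2 = - (a\<^sup>2) / 4 + a * y - y\<^sup>2"
        by (simp add: power2_eq_square field_simps)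
      have e2: "b / sqrt 2 * (- a / sqrt 2 + sqrt 2 * y) = - (a * b) / 2 + b * y"
        by (simp add: field_simps)
      have "of_real (- (a\<^sup>2) / 4 + a * y - y\<^sup>2) + \<i> * of_real (- (a * b) / 2 + b * y) =
          - (w\<^sup>2 + of_real (b\<^sup>2)) / 4 + (of_real y * w + of_real (- y\<^sup>2))"
        unfolding w by (simp add: complex_eq_iff power2_eq_square algebra_simps)
      then have "exp (of_real (- (a\<^sup>2) / 4 + a * y - y\<^sup>2)) * exp (\<i> * of_real (- (a * b) / 2 + b * y)) =
          exp (- (w\<^sup>2 + of_real (b\<^sup>2)) / 4) * (exp (of_real y * w) * exp (of_real (- y\<^sup>2)))"
        by (simp only: exp_add[symmetric])
      then show ?thesis
        unfolding std_normal_density_def e1 e2 scaleR_conv_of_real of_real_mult exp_of_real[symmetric]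
        by (simp add: mult.assoc)
    qed
    then show ?thesis by (simp add: scaleR_conv_of_real)
  qed
  also have "\<dots> = of_real (sqrt 2) * (of_real (1 / sqrt (2 * pi)) * exp (- (w\<^sup>2 + of_real (b\<^sup>2)) / 4) * (LINT y|lborel. exp (of_real y * w) * of_real (exp (- y\<^sup>2))))"
    by (subst integral_mult_right_zero) simp
  also have "of_real (exp (- ((b / sqrt 2)\<^sup>2) / 2)) = exp (- of_real (b\<^sup>2) / 4 :: complex)"
    by (simp add: power_divide exp_of_real[symmetric])
  finally have eq: "exp (- of_real (b\<^sup>2) / 4 :: complex) = of_real (sqrt 2) * (of_real (1 / sqrt (2 * pi)) * exp (- (w\<^sup>2 + of_real (b\<^sup>2)) / 4) * (LINT y|lborel. exp (of_real y * w) * of_real (exp (- y\<^sup>2))))" .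
  have "sqrt pi * (sqrt 2 * (1 / sqrt (2 * pi))) = 1" by (simp add: real_sqrt_mult)
  then have s: "of_real (sqrt pi) * (of_real (sqrt 2) * of_real (1 / sqrt (2 * pi))) = (1::complex)"
    by (metis of_real_1 of_real_mult)
  have "of_real (sqrt pi) * exp (w\<^sup>2 / 4) = of_real (sqrt pi) * exp ((w\<^sup>2 + of_real (b\<^sup>2)) / 4) * exp (- of_real (b\<^sup>2) / 4)"
    by (simp add: mult.assoc exp_add[symmetric] add_divide_distrib)
  also have "\<dots> = (of_real (sqrt pi) * (of_real (sqrt 2) * of_real (1 / sqrt (2 * pi)))) * (exp ((w\<^sup>2 + of_real (b\<^sup>2)) / 4) * exp (- (w\<^sup>2 + of_real (b\<^sup>2)) / 4)) * (LINT y|lborel. exp (of_real y * w) * of_real (exp (- y\<^sup>2)))"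
    unfolding eq by (simp only: mult_ac)
  also have "\<dots> = (LINT y|lborel. exp (of_real y * w) * of_real (exp (- y\<^sup>2)))"
  proof -
    have "exp (A / 4) * exp (- A / 4) = 1" for A :: complex by (simp add: exp_add[symmetric])
    note ee = this
    show ?thesis by (simp only: s ee mult_1)
  qed
  finally show ?thesis by simp
qed

lemma gauss_deriv_exp_integral:
  "(LINT y|lborel. exp (of_real y * w) * of_real (gauss_deriv n y)) = (- w) ^ n * of_real (sqrt pi) * exp (w\<^sup>2 / 4)" for w :: complex
proof (induction n)
  case 0
  then show ?case using gaussian_exp_integral[of w] by (simp add: gauss_deriv_def)
next
  case (Suc n)
  then show ?case by (simp only: gauss_deriv_exp_integral_Suc power_Suc) (simp add: mult.assoc)
qed

text \<open>The factor exp (y^2 / 2) of the Hermite function cancels the quadratic term of the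
  window: i y \<xi> - (y - x)^2 / 2 + y^2 / 2 = - x^2 / 2 + y w. What remains is the integral of exp
  (y w) against the n-th derivative of exp (- y^2).\<close>

lemma hermite_window_1d:
  fixes x \<xi> :: real and n :: nat
  defines "w \<equiv> of_real x + \<i> * of_real \<xi>"
  defines "f \<equiv> \<lambda>y. exp (\<i> * of_real (y * \<xi>)) * of_real (pi powr (- 1 / 4) * exp (- (y - x)\<^sup>2 / 2)) * of_real (hermite_fun_1d n y)"
  shows "integrable lborel f"
    and "(LINT y|lborel. f y) = exp (- of_real (x\<^sup>2) / 2 + w\<^sup>2 / 4) * ((w / of_real (sqrt 2)) ^ n / of_real (sqrt (fact n)))"
proof -
  define c where "c = pi powr (- 1 / 4) * ((-1) ^ n / sqrt (2 ^ n * fact n * sqrt pi)) * exp (- x\<^sup>2 / 2)"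
  have f: "f = (\<lambda>y. of_real c * (exp (of_real y * w) * of_real (gauss_deriv n y)))"
  proof
    fix y
    have "\<i> * of_real (y * \<xi>) + of_real (- (y - x)\<^sup>2 / 2) + of_real (y\<^sup>2 / 2) = of_real (- x\<^sup>2 / 2) + of_real y * w"
      by (simp add: w_def complex_eq_iff power2_eq_square field_simps)
    then have e: "exp (\<i> * of_real (y * \<xi>)) * exp (of_real (- (y - x)\<^sup>2 / 2)) * exp (of_real (y\<^sup>2 / 2)) = exp (of_real (- x\<^sup>2 / 2)) * exp (of_real y * w)"
      by (simp only: exp_add[symmetric])
    have "f y = of_real (pi powr (- 1 / 4) * ((-1) ^ n / sqrt (2 ^ n * fact n * sqrt pi))) *
        (exp (\<i> * of_real (y * \<xi>)) * exp (of_real (- (y - x)\<^sup>2 / 2)) * exp (of_real (y\<^sup>2 / 2))) * of_real (gauss_deriv n y)"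
      unfolding f_def hermite_fun_1d_def funpow_deriv_gaussian of_real_mult exp_of_real by (simp only: mult_ac)
    also have "\<dots> = of_real c * (exp (of_real y * w) * of_real (gauss_deriv n y))"
      by (simp only: e) (simp only: c_def of_real_mult exp_of_real mult_ac)
    finally show "f y = of_real c * (exp (of_real y * w) * of_real (gauss_deriv n y))" .
  qed
  show "integrable lborel f" unfolding f by (intro integrable_mult_right integrable_gauss_deriv_exp)
  have "(LINT y|lborel. f y) = of_real c * ((- w) ^ n * of_real (sqrt pi) * exp (w\<^sup>2 / 4))"
    unfolding f gauss_deriv_exp_integral[symmetric] by (rule integral_mult_right_zero)
  also have "\<dots> = exp (- of_real (x\<^sup>2) / 2 + w\<^sup>2 / 4) * ((w / of_real (sqrt 2)) ^ n / of_real (sqrt (fact n)))"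
  proof -
    have q: "pi powr (- 1 / 4) * sqrt pi = sqrt (sqrt pi)"
      by (simp add: powr_half_sqrt[symmetric] powr_powr powr_add[symmetric])
    have s: "sqrt (2 ^ n * fact n * sqrt pi) = sqrt 2 ^ n * sqrt (fact n) * sqrt (sqrt pi)"
      by (simp add: real_sqrt_mult real_sqrt_power)
    have "c * sqrt pi = (-1) ^ n / (sqrt 2 ^ n * sqrt (fact n)) * exp (- x\<^sup>2 / 2)"
    proof -
      have "c * sqrt pi = (pi powr (- 1 / 4) * sqrt pi) * ((-1) ^ n / sqrt (2 ^ n * fact n * sqrt pi)) * exp (- x\<^sup>2 / 2)"
        by (simp add: c_def)
      then show ?thesis unfolding q s by simp
    qed
    then have "of_real c * of_real (sqrt pi) = (of_real ((-1) ^ n / (sqrt 2 ^ n * sqrt (fact n)) * exp (- x\<^sup>2 / 2)) :: complex)"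
      by (metis of_real_mult)
    note cs = this
    have "of_real c * ((- w) ^ n * of_real (sqrt pi) * exp (w\<^sup>2 / 4)) = of_real c * of_real (sqrt pi) * (- w) ^ n * exp (w\<^sup>2 / 4)"
      by (simp only: mult_ac)
    also have "\<dots> = of_real ((-1) ^ n / (sqrt 2 ^ n * sqrt (fact n)) * exp (- x\<^sup>2 / 2)) * (- w) ^ n * exp (w\<^sup>2 / 4)"
      by (simp only: cs)
    also have "\<dots> = exp (of_real (- x\<^sup>2 / 2)) * exp (w\<^sup>2 / 4) * (((-1) * (- w)) ^ n / (of_real (sqrt 2) ^ n * of_real (sqrt (fact n))))"
      unfolding power_mult_distrib by (simp only: of_real_mult exp_of_real[symmetric]) simp
    also have "\<dots> = exp (- of_real (x\<^sup>2) / 2 + w\<^sup>2 / 4) * ((w / of_real (sqrt 2)) ^ n / of_real (sqrt (fact n)))"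
    proof -
      have ex: "exp (of_real (- x\<^sup>2 / 2)) = exp (- of_real (x\<^sup>2) / 2 :: complex)" by simp
      show ?thesis unfolding ex exp_add by (simp add: power_divide)
    qed
    finally show ?thesis .
  qed
  finally show "(LINT y|lborel. f y) = exp (- of_real (x\<^sup>2) / 2 + w\<^sup>2 / 4) * ((w / of_real (sqrt 2)) ^ n / of_real (sqrt (fact n)))" .
qed

text \<open>Lebesgue measure is available as a product over \<open>Basis\<close>, so each coordinate
  i is transported to the basis vector \<open>axis i 1\<close> before the product rule is
  applied.\<close>

lemma integral_lborel_vec_prod:
  fixes g :: "'d::finite \<Rightarrow> real \<Rightarrow> complex"
  assumes g: "\<And>i. integrable lborel (g i)"
  shows "(LINT x|lborel. (\<Prod>i\<in>UNIV. g i (x $ i))) = (\<Prod>i\<in>UNIV. LINT t|lborel. g i t)"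
proof -
  interpret product_sigma_finite "\<lambda>_::real ^ 'd. lborel :: real measure" by standard
  have [measurable]: "g i \<in> borel_measurable borel" for i using borel_measurable_integrable[OF g] by simp
  have ax: "inj (\<lambda>i. axis i 1 :: real ^ 'd)" by (auto simp: inj_on_def axis_eq_axis)
  have B: "(Basis :: (real ^ 'd) set) = range (\<lambda>i. axis i 1)" by (auto simp: Basis_vec_def)
  define h where "h b = g (the_inv (\<lambda>i. axis i 1 :: real ^ 'd) b)" for b
  have h: "h (axis i 1) = g i" for i unfolding h_def the_inv_f_f[OF ax, of i] ..
  have coord: "(\<Sum>b\<in>Basis. f b *\<^sub>R b) $ i = f (axis i 1)" for f and i :: 'd
  proof -
    have "(\<Sum>b\<in>(Basis :: (real ^ 'd) set). f b *\<^sub>R b) $ i = (\<Sum>b\<in>Basis. f b *\<^sub>R b) \<bullet> axis i 1"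
      by (simp add: inner_axis)
    also have "\<dots> = f (axis i 1)" by (subst inner_sum_left_Basis) (auto simp: B)
    finally show ?thesis .
  qed
  have "(LINT x|lborel. (\<Prod>i\<in>UNIV. g i (x $ i))) =
      (LINT f|(\<Pi>\<^sub>M b\<in>Basis. lborel). (\<Prod>i\<in>UNIV. g i ((\<Sum>b\<in>Basis. f b *\<^sub>R b :: real ^ 'd) $ i)))"
    by (subst lborel_eq, subst integral_distr) auto
  also have "\<dots> = (LINT f|(\<Pi>\<^sub>M b\<in>Basis. lborel). (\<Prod>b\<in>(Basis :: (real ^ 'd) set). h b (f b)))"
    unfolding coord by (simp add: B prod.reindex[OF ax] h)
  also have "\<dots> = (\<Prod>b\<in>(Basis :: (real ^ 'd) set). LINT t|lborel. h b t)"
    by (rule product_integral_prod) (auto simp: B h g)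
  also have "\<dots> = (\<Prod>i\<in>UNIV. LINT t|lborel. g i t)"
    by (simp add: B prod.reindex[OF ax] h)
  finally show ?thesis .
qed

lemma hermite_coeffs_window:
  fixes x \<xi> :: "real ^ 'd::finite"
  defines "w \<equiv> \<lambda>i. of_real (x $ i) + \<i> * of_real (\<xi> $ i) :: complex"
  shows "hermite_coeffs (\<lambda>y. exp (\<i> * of_real (y \<bullet> \<xi>)) * of_real (gauss_window (y - x))) \<alpha> =
    exp (\<Sum>i\<in>UNIV. - of_real ((x $ i)\<^sup>2) / 2 + (w i)\<^sup>2 / 4) * (\<Prod>i\<in>UNIV. (w i / of_real (sqrt 2)) ^ \<alpha> i / of_real (sqrt (fact (\<alpha> i))))"
proof -
  define f where "f i y = exp (\<i> * of_real (y * \<xi> $ i)) * of_real (pi powr (- 1 / 4) * exp (- (y - x $ i)\<^sup>2 / 2)) * of_real (hermite_fun_1d (\<alpha> i) y)" for i y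
  have f: "exp (\<i> * of_real (y \<bullet> \<xi>)) * of_real (gauss_window (y - x)) * of_real (hermite_fun \<alpha> y) = (\<Prod>i\<in>UNIV. f i (y $ i))" for y
  proof -
    have "exp (\<i> * of_real (y \<bullet> \<xi>)) = (\<Prod>i\<in>UNIV. exp (\<i> * of_real (y $ i * \<xi> $ i)))"
      by (simp add: inner_vec_def sum_distrib_left exp_sum)
    moreover have "gauss_window (y - x) = (\<Prod>i\<in>UNIV. pi powr (- 1 / 4) * exp (- (y $ i - x $ i)\<^sup>2 / 2))"
    proof -
      have "(norm (y - x))\<^sup>2 = (\<Sum>i\<in>UNIV. (y $ i - x $ i)\<^sup>2)"
        by (simp only: power2_norm_eq_inner inner_vec_def) (simp add: power2_eq_square)
      then have "exp (- (norm (y - x))\<^sup>2 / 2) = (\<Prod>i\<in>UNIV. exp (- (y $ i - x $ i)\<^sup>2 / 2))"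
        by (simp add: exp_sum[symmetric] sum_negf sum_divide_distrib)
      moreover have "pi powr (- real CARD('d) / 4) = (\<Prod>i\<in>(UNIV::'d set). pi powr (- 1 / 4))"
        by (simp add: powr_power mult.commute)
      ultimately show ?thesis unfolding gauss_window_def prod.distrib by simp
    qed
    ultimately show ?thesis by (simp add: hermite_fun_def f_def prod.distrib)
  qed
  have "hermite_coeffs (\<lambda>y. exp (\<i> * of_real (y \<bullet> \<xi>)) * of_real (gauss_window (y - x))) \<alpha> = (LINT y|lborel. (\<Prod>i\<in>UNIV. f i (y $ i)))"
    by (simp add: hermite_coeffs_def f)
  also have "\<dots> = (\<Prod>i\<in>UNIV. LINT t|lborel. f i t)"
    by (rule integral_lborel_vec_prod) (unfold f_def, rule hermite_window_1d)
  also have "\<dots> = (\<Prod>i\<in>UNIV. exp (- of_real ((x $ i)\<^sup>2) / 2 + (w i)\<^sup>2 / 4) * ((w i / of_real (sqrt 2)) ^ \<alpha> i / of_real (sqrt (fact (\<alpha> i)))))"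
    unfolding f_def w_def hermite_window_1d(2) ..
  also have "\<dots> = exp (\<Sum>i\<in>UNIV. - of_real ((x $ i)\<^sup>2) / 2 + (w i)\<^sup>2 / 4) * (\<Prod>i\<in>UNIV. (w i / of_real (sqrt 2)) ^ \<alpha> i / of_real (sqrt (fact (\<alpha> i))))"
    by (simp only: prod.distrib exp_sum[OF finite_class.finite_UNIV])
  finally show ?thesis .
qed

section \<open>Entire functions of several variables\<close>

definition monomial :: "('d::finite \<Rightarrow> complex) \<Rightarrow> ('d \<Rightarrow> nat) \<Rightarrow> complex" where
  "monomial z \<alpha> = (\<Prod>i\<in>UNIV. z i ^ \<alpha> i)"

text \<open>Equivalent to convergence of the power series on all of C^d, but stated as coefficient
  decay, which for \<open>fock_coeffs\<close> is membership in \<open>Hflat_dual\<close>.\<close>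

definition entire_coeffs :: "(('d::finite \<Rightarrow> nat) \<Rightarrow> complex) \<Rightarrow> bool" where
  "entire_coeffs b \<longleftrightarrow> (\<forall>r>0. \<exists>C. \<forall>\<alpha>. cmod (b \<alpha>) \<le> C * r ^ (\<Sum>i\<in>UNIV. \<alpha> i))"

definition entire_fun :: "(('d::finite \<Rightarrow> nat) \<Rightarrow> complex) \<Rightarrow> ('d \<Rightarrow> complex) \<Rightarrow> complex" where
  "entire_fun b z = (\<Sum>\<^sub>\<infinity>\<alpha>. b \<alpha> * monomial z \<alpha>)"

text \<open>A finite set of multi-indices lies in a cube, over which the sum factors into
  one-dimensional geometric sums, each at most 1 / (1 - t).\<close>

lemma summable_geometric_multi:
  assumes "0 \<le> t" "t < (1::real)"
  shows "(\<lambda>\<alpha>::'d::finite \<Rightarrow> nat. t ^ (\<Sum>i\<in>UNIV. \<alpha> i)) summable_on UNIV"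
proof (rule nonneg_bdd_above_summable_on)
  show "bdd_above (sum (\<lambda>\<alpha>::'d \<Rightarrow> nat. t ^ (\<Sum>i\<in>UNIV. \<alpha> i)) ` {F. F \<subseteq> UNIV \<and> finite F})"
  proof (rule bdd_aboveI2)
    fix F :: "('d \<Rightarrow> nat) set" assume "F \<in> {F. F \<subseteq> UNIV \<and> finite F}"
    then have F: "finite F" by simp
    define M where "M = Max (insert 0 ((\<lambda>(\<alpha>, i). \<alpha> i) ` (F \<times> UNIV)))"
    have M: "\<alpha> i \<le> M" if "\<alpha> \<in> F" for \<alpha> i
      unfolding M_def using F that by (intro Max_ge) (auto intro!: image_eqI[of _ _ "(\<alpha>, i)"])
    have "(\<Sum>\<alpha>\<in>F. t ^ (\<Sum>i\<in>UNIV. \<alpha> i)) \<le> (\<Sum>\<alpha>\<in>PiE (UNIV::'d set) (\<lambda>_. {..M}). t ^ (\<Sum>i\<in>UNIV. \<alpha> i))"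
      
    proof (rule sum_mono2)
      show "finite (PiE (UNIV::'d set) (\<lambda>_. {..M}))" by (rule finite_PiE) auto
      show "F \<subseteq> PiE UNIV (\<lambda>_. {..M})" using M by (auto simp: PiE_def extensional_def)
    qed (use assms(1) in auto)
    also have "\<dots> = (\<Prod>i\<in>(UNIV::'d set). \<Sum>n\<le>M. t ^ n)"
      by (subst prod_sum_PiE) (auto simp: power_sum)
    also have "\<dots> \<le> (\<Prod>i\<in>(UNIV::'d set). 1 / (1 - t))"
    proof (rule prod_mono)
      fix i :: 'd
      have "(\<Sum>n\<le>M. t ^ n) \<le> suminf (\<lambda>n. t ^ n)"
        using assms by (intro sum_le_suminf summable_geometric) auto
      also have "\<dots> = 1 / (1 - t)" using assms by (intro suminf_geometric) auto
      finally show "0 \<le> (\<Sum>n\<le>M. t ^ n) \<and> (\<Sum>n\<le>M. t ^ n) \<le> 1 / (1 - t)"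
        using assms by (auto intro: sum_nonneg)
    qed
    finally show "(\<Sum>\<alpha>\<in>F. t ^ (\<Sum>i\<in>UNIV. \<alpha> i)) \<le> (\<Prod>i\<in>(UNIV::'d set). 1 / (1 - t))" .
  qed
qed (use assms in auto)

lemma norm_monomial_le:
  assumes "\<And>i. cmod (z i) \<le> R"
  shows "cmod (monomial z \<alpha>) \<le> R ^ (\<Sum>i\<in>UNIV. \<alpha> i)"
  unfolding monomial_def prod_norm[symmetric] power_sum
  by (intro prod_mono) (auto simp: norm_power intro!: power_mono assms)

lemma entire_coeffs_summable:
  fixes b :: "('d::finite \<Rightarrow> nat) \<Rightarrow> complex"
  assumes "entire_coeffs b" "0 \<le> R"
  shows "(\<lambda>\<alpha>. cmod (b \<alpha>) * R ^ (\<Sum>i\<in>UNIV. \<alpha> i)) summable_on UNIV"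
proof -
  \<comment> \<open>Chosen so that r R < 1, also when R = 0; the coefficient bound at rate r then
    leaves a geometric series.\<close>
  define r where "r = 1 / (2 * (R + 1))"
  have r: "r > 0" "0 \<le> r * R" "r * R < 1" using assms(2) by (auto simp: r_def field_simps)
  obtain C where C: "\<And>\<alpha>. cmod (b \<alpha>) \<le> C * r ^ (\<Sum>i\<in>UNIV. \<alpha> i)"
    using assms(1) r(1) by (auto simp: entire_coeffs_def)
  show ?thesis
  proof (rule summable_on_comparison_test)
    show "(\<lambda>\<alpha>::'d \<Rightarrow> nat. C * (r * R) ^ (\<Sum>i\<in>UNIV. \<alpha> i)) summable_on UNIV"
      by (rule summable_on_cmult_right) (rule summable_geometric_multi[OF r(2,3)])
    show "cmod (b \<alpha>) * R ^ (\<Sum>i\<in>UNIV. \<alpha> i) \<le> C * (r * R) ^ (\<Sum>i\<in>UNIV. \<alpha> i)" for \<alpha>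
      using mult_right_mono[OF C[of \<alpha>], of "R ^ (\<Sum>i\<in>UNIV. \<alpha> i)"] assms(2)
      by (simp add: power_mult_distrib mult.assoc)
  qed (use assms in auto)
qed

lemma norm_entire_term_le:
  assumes "\<And>i. cmod (z i) \<le> R"
  shows "cmod (b \<alpha> * monomial z \<alpha>) \<le> cmod (b \<alpha>) * R ^ (\<Sum>i\<in>UNIV. \<alpha> i)"
  using norm_monomial_le[of z R \<alpha>] assms by (simp add: norm_mult mult_left_mono)

lemma ex_polyradius_bound: "\<exists>R\<ge>0. \<forall>i. cmod (z i) \<le> R" for z :: "'d::finite \<Rightarrow> complex"
  by (intro exI[of _ "\<Sum>i\<in>UNIV. cmod (z i)"]) (auto intro: sum_nonneg member_le_sum)

lemma entire_fun_abs_summable: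
  assumes "entire_coeffs b"
  shows "(\<lambda>\<alpha>. cmod (b \<alpha> * monomial z \<alpha>)) summable_on UNIV"
proof -
  obtain R where R: "R \<ge> 0" "\<And>i. cmod (z i) \<le> R" using ex_polyradius_bound by blast
  show ?thesis
    by (rule summable_on_comparison_test[OF entire_coeffs_summable[OF assms R(1)]])
      (auto intro: norm_entire_term_le R)
qed

lemma entire_fun_summable:
  assumes "entire_coeffs b"
  shows "(\<lambda>\<alpha>. b \<alpha> * monomial z \<alpha>) summable_on UNIV"
  by (rule abs_summable_summable[OF entire_fun_abs_summable[OF assms]])

lemma entire_fun_uniform_limit:
  assumes "entire_coeffs b" "0 \<le> R"
  shows "uniform_limit {z. \<forall>i. cmod (z i) \<le> R} (\<lambda>F z. \<Sum>\<alpha>\<in>F. b \<alpha> * monomial z \<alpha>) (entire_fun b) (finite_subsets_at_top UNIV)"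
  using Weierstrass_m_test_general[OF _ entire_coeffs_summable[OF assms],
      of "{z. \<forall>i. cmod (z i) \<le> R}" "\<lambda>\<alpha> z. b \<alpha> * monomial z \<alpha>"]
  unfolding entire_fun_def[abs_def] by (auto intro: norm_entire_term_le)

text \<open>Stated along a parametrization by a space whose closed balls are compact: the
  coordinates of z are bounded on each ball, so the series converges uniformly there by the bound on
  a polydisc.\<close>

lemma continuous_on_entire_fun:
  fixes z :: "'x::{heine_borel,real_normed_vector} \<Rightarrow> 'd::finite \<Rightarrow> complex"
  assumes b: "entire_coeffs b" and z: "\<And>i. continuous_on UNIV (\<lambda>x. z x i)"
  shows "continuous_on UNIV (\<lambda>x. entire_fun b (z x))"
proof -
  have "continuous_on (ball 0 r) (\<lambda>x. entire_fun b (z x))" for r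
  proof -
    have "compact (cball (0::'x) r)" by simp
    then have "bounded ((\<lambda>x. z x i) ` cball 0 r)" for i
      by (intro compact_imp_bounded compact_continuous_image continuous_on_subset[OF z]) auto
    then have "\<exists>B>0. \<forall>x\<in>cball 0 r. cmod (z x i) \<le> B" for i
      by (auto simp: bounded_pos)
    then obtain B where B: "\<And>i. B i > 0 \<and> (\<forall>x\<in>cball 0 r. cmod (z x i) \<le> B i)" by metis
    define R where "R = (\<Sum>i\<in>UNIV. B i)"
    have R: "R \<ge> 0" unfolding R_def by (intro sum_nonneg) (use B less_imp_le in blast)
    have zR: "cmod (z x i) \<le> R" if "x \<in> ball 0 r" for x i
    proof -
      have "cmod (z x i) \<le> B i" using B that by (meson ball_subset_cball subsetD)
      also have "\<dots> \<le> R" unfolding R_def by (rule member_le_sum) (use B less_imp_le in auto)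
      finally show ?thesis .
    qed
    have "uniform_limit (ball 0 r) (\<lambda>F x. \<Sum>\<alpha>\<in>F. b \<alpha> * monomial (z x) \<alpha>) (\<lambda>x. entire_fun b (z x)) (finite_subsets_at_top UNIV)"
      using uniform_limit_compose'[OF entire_fun_uniform_limit[OF b R], of z "ball 0 r"] zR by (simp add: Pi_iff)
    then show ?thesis
      by (rule uniform_limit_theorem[rotated])
        (auto simp: monomial_def intro!: always_eventually continuous_intros continuous_on_subset[OF z])
  qed
  then have "isCont (\<lambda>x. entire_fun b (z x)) x" for x
    by (rule continuous_on_interior[of "ball 0 (norm x + 1)"]) auto
  then show ?thesis by (simp add: continuous_at_imp_continuous_on)
qed

text \<open>Restricting to complex lines is what lets one-variable complex analysis supply the
  sub-mean value property.\<close>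

lemma holomorphic_entire_fun_line:
  assumes b: "entire_coeffs b"
  shows "(\<lambda>\<zeta>. entire_fun b (\<lambda>i. p i + \<zeta> * q i)) holomorphic_on UNIV"
proof -
  have "(\<lambda>\<zeta>. entire_fun b (\<lambda>i. p i + \<zeta> * q i)) holomorphic_on ball 0 r" if "r > 0" for r
  proof -
    obtain P where P: "P \<ge> 0" "\<And>i. cmod (p i) \<le> P" using ex_polyradius_bound[of p] by blast
    obtain Q where Q: "Q \<ge> 0" "\<And>i. cmod (q i) \<le> Q" using ex_polyradius_bound[of q] by blast
    have "cmod (p i + \<zeta> * q i) \<le> P + r * Q" if "\<zeta> \<in> cball 0 r" for \<zeta> i
      using that \<open>r > 0\<close> P Q by (intro norm_triangle_mono) (auto simp: norm_mult intro: mult_mono)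
    then have "uniform_limit (cball 0 r) (\<lambda>F \<zeta>. \<Sum>\<alpha>\<in>F. b \<alpha> * monomial (\<lambda>i. p i + \<zeta> * q i) \<alpha>)
        (\<lambda>\<zeta>. entire_fun b (\<lambda>i. p i + \<zeta> * q i)) (finite_subsets_at_top UNIV)"
      using uniform_limit_compose'[OF entire_fun_uniform_limit[OF b, of "P + r * Q"], of "\<lambda>\<zeta> i. p i + \<zeta> * q i" "cball 0 r"] P Q that
      by (simp add: Pi_iff)
    then show ?thesis
      by (rule holomorphic_uniform_limit[rotated])
        (auto simp: monomial_def intro!: always_eventually continuous_intros holomorphic_intros)
  qed
  then have "(\<lambda>\<zeta>. entire_fun b (\<lambda>i. p i + \<zeta> * q i)) field_differentiable at \<zeta>" for \<zeta>
    by (rule holomorphic_on_imp_differentiable_at[of _ "ball 0 (norm \<zeta> + 1)"]) (auto intro: add_nonneg_pos)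
  then show ?thesis by (simp add: holomorphic_on_def field_differentiable_at_within)
qed

lemma infsum_tail_less:
  fixes f :: "'a \<Rightarrow> real"
  assumes f: "f summable_on UNIV" and nn: "\<And>x. 0 \<le> f x" and e: "e > 0"
  obtains S where "finite S" "\<And>T. finite T \<Longrightarrow> S \<subseteq> T \<Longrightarrow> infsum f (- T) < e"
proof -
  have "(sum f \<longlongrightarrow> infsum f UNIV) (finite_subsets_at_top UNIV)"
    using has_sum_infsum[OF f] by (simp add: has_sum_def)
  then have "\<forall>\<^sub>F T in finite_subsets_at_top UNIV. dist (sum f T) (infsum f UNIV) < e"
    using e by (rule tendstoD)
  then obtain S where S: "finite S" "\<And>T. finite T \<Longrightarrow> S \<subseteq> T \<Longrightarrow> dist (sum f T) (infsum f UNIV) < e"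
    by (auto simp: eventually_finite_subsets_at_top)
  have "infsum f (- T) < e" if T: "finite T" "S \<subseteq> T" for T
  proof -
    have "infsum f (UNIV - T) = infsum f UNIV - infsum f T"
      using T f by (intro infsum_Diff) auto
    then show ?thesis using S(2)[OF T] T by (simp add: Compl_eq_Diff_UNIV dist_real_def)
  qed
  with S(1) show ?thesis by (rule that)
qed

lemma infsum_split_finite:
  fixes f :: "'a \<Rightarrow> real"
  assumes f: "f summable_on UNIV" and T: "finite T"
  shows "infsum f UNIV = sum f T + infsum f (- T)"
proof -
  have "infsum f (UNIV - T) = infsum f UNIV - infsum f T"
    using T f by (intro infsum_Diff) auto
  then show ?thesis using T by (simp add: Compl_eq_Diff_UNIV)
qed

text \<open>As m and n are distinct and below N, they are incongruent modulo N; so the ratio of the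
  geometric sum is an N-th root of unity other than 1.\<close>

lemma root_of_unity_sum:
  fixes m n :: nat
  assumes "m < N" "n < N" "m \<noteq> n"
  defines "\<zeta> \<equiv> exp (2 * of_real pi * \<i> / of_nat N)"
  shows "(\<Sum>k<N. (\<zeta> ^ m * cnj \<zeta> ^ n) ^ k) = 0"
proof -
  have N: "N > 0" using assms by simp
  have zz: "\<zeta> * cnj \<zeta> = 1"
    by (simp add: \<zeta>_def complex_norm_square[symmetric] norm_exp_eq_Re)
  have pw: "\<zeta> ^ j = exp (2 * of_real pi * \<i> * of_nat j / of_nat N)" for j
    by (simp add: \<zeta>_def exp_of_nat_mult[symmetric] field_simps)
  have zN: "\<zeta> ^ N = 1" using N by (simp add: pw exp_eq_1) 
  have "\<zeta> ^ m \<noteq> \<zeta> ^ n"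
    unfolding pw using complex_root_unity_eq[of N m n] assms(1-3) N by simp
  moreover have "(\<zeta> ^ m * cnj \<zeta> ^ n) * \<zeta> ^ n = \<zeta> ^ m"
    using zz by (simp add: mult.assoc power_mult_distrib[symmetric] mult.commute)
  ultimately have "\<zeta> ^ m * cnj \<zeta> ^ n \<noteq> 1" by (metis mult_1)
  moreover have "(\<zeta> ^ m * cnj \<zeta> ^ n) ^ N = 1"
  proof -
    have "(\<zeta> ^ m) ^ N = (\<zeta> ^ N) ^ m" "(cnj \<zeta> ^ n) ^ N = (cnj \<zeta> ^ N) ^ n"
      by (simp_all only: power_mult[symmetric] mult.commute)
    moreover have "cnj \<zeta> ^ N = 1" using zN by (simp flip: complex_cnj_power)
    ultimately show ?thesis using zN by (simp add: power_mult_distrib)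
  qed
  ultimately show ?thesis by (simp add: sum_gp_strict)
qed

lemma has_sum_finite_sum:
  fixes f :: "'k \<Rightarrow> 'x \<Rightarrow> 'a::topological_comm_monoid_add"
  assumes "finite Z" "\<And>k. (f k has_sum s k) A"
  shows "((\<lambda>x. \<Sum>k\<in>Z. f k x) has_sum (\<Sum>k\<in>Z. s k)) A"
  using assms(1) by induction (auto intro: has_sum_add assms(2))

text \<open>
  The coefficient is extracted by averaging over the $N$-th roots of unity in each variable, which
  is exact up to the coefficients with some index congruent but not equal modulo $N$; these
  form a tail of the series as $N \to \infty$.
\<close>

lemma cauchy_estimate:
  fixes b :: "('d::finite \<Rightarrow> nat) \<Rightarrow> complex"
  assumes b: "entire_coeffs b" and \<rho>: "\<rho> > 0"
    and M: "\<And>z. (\<And>i. cmod (z i) = \<rho>) \<Longrightarrow> cmod (entire_fun b z) \<le> M"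
  shows "cmod (b \<alpha>) * \<rho> ^ (\<Sum>i\<in>UNIV. \<alpha> i) \<le> M"
proof (rule field_le_epsilon)
  fix e :: real assume e: "e > 0"
  define a where "a \<beta> = b \<beta> * of_real (\<rho> ^ (\<Sum>i\<in>UNIV. \<beta> i))" for \<beta>
  have na: "cmod (a \<beta>) = cmod (b \<beta>) * \<rho> ^ (\<Sum>i\<in>UNIV. \<beta> i)" for \<beta>
    using \<rho> by (simp add: a_def norm_mult norm_power)
  have sa: "(\<lambda>\<beta>. cmod (a \<beta>)) summable_on UNIV"
    unfolding na using entire_coeffs_summable[OF b, of \<rho>] \<rho> by simp
  obtain S where S: "finite S" "\<And>T. finite T \<Longrightarrow> S \<subseteq> T \<Longrightarrow> infsum (\<lambda>\<beta>. cmod (a \<beta>)) (- T) < e"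
    using infsum_tail_less[OF sa _ e] by auto
  define T where "T = insert \<alpha> S"
  have T: "finite T" "infsum (\<lambda>\<beta>. cmod (a \<beta>)) (- T) < e" "\<alpha> \<in> T" using S by (auto simp: T_def)
  \<comment> \<open>N exceeds every entry of every index in T, so distinct members of T stay
    incongruent modulo N in some coordinate.\<close>
  define N where "N = Suc (Max ((\<lambda>(\<beta>, i). \<beta> i) ` (T \<times> UNIV)))"
  have TN: "\<beta> i < N" if "\<beta> \<in> T" for \<beta> i
    unfolding N_def less_Suc_eq_le using T that by (intro Max_ge) (auto intro!: image_eqI[of _ _ "(\<beta>, i)"])
  have N: "N > 0" by (simp add: N_def)
  define \<zeta> where "\<zeta> = exp (2 * of_real pi * \<i> / of_nat N)"
  have nz: "cmod \<zeta> = 1" by (simp add: \<zeta>_def norm_exp_eq_Re)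
  \<comment> \<open>The weight with which the N^d-fold average sees the coefficient at \<beta>: N^d
    at \<alpha>, 0 at the other members of T, and at most N^d in modulus on the tail.\<close>
  define D where "D \<beta> = (\<Prod>i\<in>UNIV. \<Sum>k<N. (\<zeta> ^ \<beta> i * cnj \<zeta> ^ \<alpha> i) ^ k)" for \<beta>
  have D0: "D \<beta> = 0" if bT: "\<beta> \<in> T" and ba: "\<beta> \<noteq> \<alpha>" for \<beta>
  proof -
    obtain i where "\<beta> i \<noteq> \<alpha> i" using ba by auto
    then have "(\<Sum>k<N. (\<zeta> ^ \<beta> i * cnj \<zeta> ^ \<alpha> i) ^ k) = 0"
      unfolding \<zeta>_def using TN bT T(3) by (intro root_of_unity_sum) auto
    then show ?thesis unfolding D_def by (intro prod_zero) auto
  qed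
  have "\<zeta> * cnj \<zeta> = 1" using nz by (simp add: complex_norm_square[symmetric])
  then have D\<alpha>: "D \<alpha> = of_nat N ^ CARD('d)"
    by (simp add: D_def power_mult_distrib[symmetric])
  have Dle: "cmod (D \<beta>) \<le> real N ^ CARD('d)" for \<beta>
  proof -
    have "cmod (D \<beta>) \<le> (\<Prod>i\<in>(UNIV::'d set). real N)"
      unfolding D_def prod_norm[symmetric]
    proof (intro prod_mono conjI norm_ge_zero)
      fix i
      have "cmod (\<Sum>k<N. (\<zeta> ^ \<beta> i * cnj \<zeta> ^ \<alpha> i) ^ k) \<le> (\<Sum>k<N. cmod ((\<zeta> ^ \<beta> i * cnj \<zeta> ^ \<alpha> i) ^ k))"
        by (rule norm_sum)
      also have "\<dots> = real N" using nz by (simp add: norm_mult norm_power)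
      finally show "cmod (\<Sum>k<N. (\<zeta> ^ \<beta> i * cnj \<zeta> ^ \<alpha> i) ^ k) \<le> real N" .
    qed
    then show ?thesis by simp
  qed
  define Z where "Z = PiE (UNIV::'d set) (\<lambda>_. {..<N})"
  have Z: "finite Z" "card Z = N ^ CARD('d)" unfolding Z_def by (auto intro: finite_PiE simp: card_PiE)
  define A where "A = (\<Sum>k\<in>Z. entire_fun b (\<lambda>i. of_real \<rho> * \<zeta> ^ k i) * (\<Prod>i\<in>UNIV. (cnj \<zeta> ^ \<alpha> i) ^ k i))"
  have "cmod A \<le> (\<Sum>k\<in>Z. M)"
    unfolding A_def
  proof (rule order_trans[OF norm_sum sum_mono])
    fix k assume "k \<in> Z"
    have "cmod (entire_fun b (\<lambda>i. of_real \<rho> * \<zeta> ^ k i)) \<le> M"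
      by (rule M) (use nz \<rho> in \<open>simp add: norm_mult norm_power\<close>)
    moreover have "cmod (\<Prod>i\<in>UNIV. (cnj \<zeta> ^ \<alpha> i) ^ k i) = 1"
      using nz by (simp add: prod_norm[symmetric] norm_power)
    ultimately show "cmod (entire_fun b (\<lambda>i. of_real \<rho> * \<zeta> ^ k i) * (\<Prod>i\<in>UNIV. (cnj \<zeta> ^ \<alpha> i) ^ k i)) \<le> M"
      by (simp add: norm_mult)
  qed
  then have AM: "cmod A \<le> real N ^ CARD('d) * M" using Z by simp
  have "((\<lambda>\<beta>. b \<beta> * monomial (\<lambda>i. of_real \<rho> * \<zeta> ^ k i) \<beta> * (\<Prod>i\<in>UNIV. (cnj \<zeta> ^ \<alpha> i) ^ k i)) has_sum
     entire_fun b (\<lambda>i. of_real \<rho> * \<zeta> ^ k i) * (\<Prod>i\<in>UNIV. (cnj \<zeta> ^ \<alpha> i) ^ k i)) UNIV" for k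
    unfolding entire_fun_def by (intro has_sum_cmult_left has_sum_infsum entire_fun_summable b)
  then have "((\<lambda>\<beta>. \<Sum>k\<in>Z. b \<beta> * monomial (\<lambda>i. of_real \<rho> * \<zeta> ^ k i) \<beta> * (\<Prod>i\<in>UNIV. (cnj \<zeta> ^ \<alpha> i) ^ k i)) has_sum A) UNIV"
    unfolding A_def by (intro has_sum_finite_sum Z)
  moreover have "(\<Sum>k\<in>Z. b \<beta> * monomial (\<lambda>i. of_real \<rho> * \<zeta> ^ k i) \<beta> * (\<Prod>i\<in>UNIV. (cnj \<zeta> ^ \<alpha> i) ^ k i)) = a \<beta> * D \<beta>" for \<beta>
  proof -
    have "b \<beta> * monomial (\<lambda>i. of_real \<rho> * \<zeta> ^ k i) \<beta> * (\<Prod>i\<in>UNIV. (cnj \<zeta> ^ \<alpha> i) ^ k i) =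
        a \<beta> * (\<Prod>i\<in>UNIV. (\<zeta> ^ \<beta> i * cnj \<zeta> ^ \<alpha> i) ^ k i)" for k
      by (simp add: monomial_def a_def power_mult_distrib prod.distrib power_sum power_mult[symmetric] mult.commute[of "k _"])
    then show ?thesis
      unfolding D_def Z_def by (simp add: prod_sum_PiE sum_distrib_left)
  qed
  ultimately have hs: "((\<lambda>\<beta>. a \<beta> * D \<beta>) has_sum A) UNIV" by simp
  have "((\<lambda>\<beta>. a \<beta> * D \<beta>) has_sum (\<Sum>\<beta>\<in>T. a \<beta> * D \<beta>)) T" using T(1) by (rule has_sum_finite)
  from has_sum_Diff[OF hs this] have hs2: "((\<lambda>\<beta>. a \<beta> * D \<beta>) has_sum (A - (\<Sum>\<beta>\<in>T. a \<beta> * D \<beta>))) (- T)"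
    by (simp add: Compl_eq_Diff_UNIV)
  have "(\<Sum>\<beta>\<in>T. a \<beta> * D \<beta>) = a \<alpha> * of_nat N ^ CARD('d)"
    using T D0 D\<alpha> by (subst sum.remove[of _ \<alpha>]) (auto intro!: sum.neutral)
  with hs2 have hs3: "((\<lambda>\<beta>. a \<beta> * D \<beta>) has_sum (A - a \<alpha> * of_nat N ^ CARD('d))) (- T)" by simp
  have sT: "(\<lambda>\<beta>. cmod (a \<beta>)) summable_on (- T)" using sa by (rule summable_on_subset_banach) auto
  have "cmod (A - a \<alpha> * of_nat N ^ CARD('d)) \<le> infsum (\<lambda>\<beta>. cmod (a \<beta>) * real N ^ CARD('d)) (- T)"
    by (rule norm_infsum_le[OF hs3 has_sum_infsum[OF summable_on_cmult_left[OF sT]]])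
      (simp add: norm_mult mult_left_mono Dle sT)
  also have "\<dots> = infsum (\<lambda>\<beta>. cmod (a \<beta>)) (- T) * real N ^ CARD('d)"
    by (rule infsum_cmult_left) (use sT in simp)
  also have "\<dots> \<le> e * real N ^ CARD('d)" using T(2) by (intro mult_right_mono) auto
  finally have "cmod (a \<alpha> * of_nat N ^ CARD('d)) - cmod A \<le> e * real N ^ CARD('d)"
    by (smt (verit) norm_triangle_ineq2 norm_minus_commute)
  then have "cmod (a \<alpha>) * real N ^ CARD('d) \<le> (M + e) * real N ^ CARD('d)"
    using AM by (simp add: norm_mult norm_power algebra_simps)
  then have "cmod (a \<alpha>) \<le> M + e" using N by simp
  then show "cmod (b \<alpha>) * \<rho> ^ (\<Sum>i\<in>UNIV. \<alpha> i) \<le> M + e" by (simp add: na)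
qed

section \<open>Differences and locally uniform limits of entire functions\<close>

lemma entire_coeffs_diff:
  assumes "entire_coeffs b" "entire_coeffs c"
  shows "entire_coeffs (\<lambda>\<alpha>. b \<alpha> - c \<alpha>)"
  unfolding entire_coeffs_def
proof (intro allI impI)
  fix r :: real assume "r > 0"
  then obtain B C where "\<And>\<alpha>. cmod (b \<alpha>) \<le> B * r ^ (\<Sum>i\<in>UNIV. \<alpha> i)" "\<And>\<alpha>. cmod (c \<alpha>) \<le> C * r ^ (\<Sum>i\<in>UNIV. \<alpha> i)"
    using assms unfolding entire_coeffs_def by metis
  then have "cmod (b \<alpha> - c \<alpha>) \<le> (B + C) * r ^ (\<Sum>i\<in>UNIV. \<alpha> i)" for \<alpha>
    using norm_triangle_ineq4[of "b \<alpha>" "c \<alpha>"] by (smt (verit) distrib_right)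
  then show "\<exists>C. \<forall>\<alpha>. cmod (b \<alpha> - c \<alpha>) \<le> C * r ^ (\<Sum>i\<in>UNIV. \<alpha> i)" by blast
qed

lemma entire_fun_diff:
  assumes "entire_coeffs b" "entire_coeffs c"
  shows "entire_fun (\<lambda>\<alpha>. b \<alpha> - c \<alpha>) z = entire_fun b z - entire_fun c z"
  unfolding entire_fun_def left_diff_distrib
proof (rule infsumI)
  have "((\<lambda>\<alpha>. b \<alpha> * monomial z \<alpha> + - (c \<alpha> * monomial z \<alpha>)) has_sum
      (\<Sum>\<^sub>\<infinity>\<alpha>. b \<alpha> * monomial z \<alpha>) + - (\<Sum>\<^sub>\<infinity>\<alpha>. c \<alpha> * monomial z \<alpha>)) UNIV"
    by (rule has_sum_add, simp add: entire_fun_summable assms)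
      (unfold has_sum_uminus minus_minus, simp add: entire_fun_summable assms)
  then show "((\<lambda>\<alpha>. b \<alpha> * monomial z \<alpha> - c \<alpha> * monomial z \<alpha>) has_sum
      (\<Sum>\<^sub>\<infinity>\<alpha>. b \<alpha> * monomial z \<alpha>) - (\<Sum>\<^sub>\<infinity>\<alpha>. c \<alpha> * monomial z \<alpha>)) UNIV"
    by simp
qed

text \<open>Montel's theorem on the level of Taylor coefficients. The Cauchy estimates bound the
  coefficients for every radius, a diagonal subsequence makes each one converge, and the bounds at a
  doubled radius make the tails uniformly small.\<close>

lemma entire_fun_convergent_subsequence:
  fixes b :: "nat \<Rightarrow> ('d::finite \<Rightarrow> nat) \<Rightarrow> complex"
  assumes b: "\<And>n. entire_coeffs (b n)"
    and bound: "\<And>R. R > 0 \<Longrightarrow> \<exists>M. \<forall>n z. (\<forall>i. cmod (z i) = R) \<longrightarrow> cmod (entire_fun (b n) z) \<le> M"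
  obtains k c where "strict_mono k" "entire_coeffs c"
    "\<And>R e. e > 0 \<Longrightarrow> \<forall>\<^sub>F n in sequentially. \<forall>z. (\<forall>i. cmod (z i) \<le> R) \<longrightarrow> cmod (entire_fun (b (k n)) z - entire_fun c z) < e"
proof -
  have coeff: "\<exists>M. \<forall>n \<alpha>. cmod (b n \<alpha>) * R ^ (\<Sum>i\<in>UNIV. \<alpha> i) \<le> M" if "R > 0" for R
    using bound[OF that] cauchy_estimate[OF b that] by metis
  obtain M1 where M1: "\<And>n \<alpha>. cmod (b n \<alpha>) \<le> M1" using coeff[of 1] by auto
  \<comment> \<open>There are countably many multi-indices, so one diagonal subsequence serves all
    coefficients.\<close>
  obtain k where k: "strict_mono k" "\<And>\<alpha>. \<alpha> \<in> UNIV \<Longrightarrow> \<exists>l. (\<lambda>n. b (k n) \<alpha>) \<longlonglongrightarrow> l"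
    by (rule function_convergent_subsequence[of UNIV b M1]) (use M1 in auto)
  then obtain c where c: "\<And>\<alpha>. (\<lambda>n. b (k n) \<alpha>) \<longlonglongrightarrow> c \<alpha>" by (metis UNIV_I)
  have cM: "cmod (c \<alpha>) * R ^ (\<Sum>i\<in>UNIV. \<alpha> i) \<le> M"
    if "\<And>n \<alpha>. cmod (b n \<alpha>) * R ^ (\<Sum>i\<in>UNIV. \<alpha> i) \<le> M" for R M \<alpha>
  proof (rule LIMSEQ_le_const2)
    show "(\<lambda>n. cmod (b (k n) \<alpha>) * R ^ (\<Sum>i\<in>UNIV. \<alpha> i)) \<longlonglongrightarrow> cmod (c \<alpha>) * R ^ (\<Sum>i\<in>UNIV. \<alpha> i)"
      by (intro tendsto_intros c)
  qed (use that in auto)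
  have ec: "entire_coeffs c"
    unfolding entire_coeffs_def
  proof (intro allI impI)
    fix r :: real assume "r > 0"
    then obtain M where M: "\<And>n \<alpha>. cmod (b n \<alpha>) * (1 / r) ^ (\<Sum>i\<in>UNIV. \<alpha> i) \<le> M" using coeff[of "1 / r"] by auto
    have "cmod (c \<alpha>) \<le> M * r ^ (\<Sum>i\<in>UNIV. \<alpha> i)" for \<alpha>
      using cM[OF M, of \<alpha>] \<open>r > 0\<close> by (simp add: power_divide field_simps)
    then show "\<exists>C. \<forall>\<alpha>. cmod (c \<alpha>) \<le> C * r ^ (\<Sum>i\<in>UNIV. \<alpha> i)" by blast
  qed
  have "\<forall>\<^sub>F n in sequentially. \<forall>z. (\<forall>i. cmod (z i) \<le> R) \<longrightarrow> cmod (entire_fun (b (k n)) z - entire_fun c z) < e"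
    if e: "e > 0" for R e
  proof -
    define P where "P = max R 1"
    have P: "P > 0" "R \<le> P" by (auto simp: P_def)
    \<comment> \<open>The bound at radius 2 P leaves the factor (1/2)^|\<alpha>| at radius P, hence
      the summable majorant g, independent of n.\<close>
    obtain M where M: "\<And>n \<alpha>. cmod (b n \<alpha>) * (2 * P) ^ (\<Sum>i\<in>UNIV. \<alpha> i) \<le> M" using coeff[of "2 * P"] P by auto
    have "M \<ge> 0" using M[of 0 undefined] P by (meson mult_nonneg_nonneg norm_ge_zero order_trans zero_le_power mult_pos_pos less_imp_le zero_less_numeral)
    define g where "g \<alpha> = 2 * M * (1/2) ^ (\<Sum>i\<in>UNIV. \<alpha> i)" for \<alpha> :: "'d \<Rightarrow> nat"
    have g: "g summable_on UNIV" unfolding g_def by (intro summable_on_cmult_right summable_geometric_multi) auto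
    have half: "cmod x * P ^ m \<le> M * (1/2) ^ m" if "cmod x * (2 * P) ^ m \<le> M" for x m
      using that by (simp add: power_mult_distrib power_divide field_simps)
    have dom: "cmod (b n \<alpha> - c \<alpha>) * P ^ (\<Sum>i\<in>UNIV. \<alpha> i) \<le> g \<alpha>" for n \<alpha>
    proof -
      have "cmod (b n \<alpha> - c \<alpha>) * P ^ (\<Sum>i\<in>UNIV. \<alpha> i) \<le> (cmod (b n \<alpha>) + cmod (c \<alpha>)) * P ^ (\<Sum>i\<in>UNIV. \<alpha> i)"
        using P by (intro mult_right_mono norm_triangle_ineq4) auto
      also have "\<dots> \<le> g \<alpha>" using half[OF M[of n \<alpha>]] half[OF cM[OF M, of \<alpha>]] by (simp add: g_def distrib_right)
      finally show ?thesis .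
    qed
    obtain S where S: "finite S" "\<And>T. finite T \<Longrightarrow> S \<subseteq> T \<Longrightarrow> infsum g (- T) < e / 2"
      using infsum_tail_less[OF g, of "e / 2"] e \<open>M \<ge> 0\<close> by (auto simp: g_def)
    have "(\<lambda>n. \<Sum>\<alpha>\<in>S. cmod (b (k n) \<alpha> - c \<alpha>) * P ^ (\<Sum>i\<in>UNIV. \<alpha> i)) \<longlonglongrightarrow> (\<Sum>\<alpha>\<in>S. cmod (c \<alpha> - c \<alpha>) * P ^ (\<Sum>i\<in>UNIV. \<alpha> i))"
      by (intro tendsto_intros c)
    then have "\<forall>\<^sub>F n in sequentially. (\<Sum>\<alpha>\<in>S. cmod (b (k n) \<alpha> - c \<alpha>) * P ^ (\<Sum>i\<in>UNIV. \<alpha> i)) < e / 2"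
      by (rule order_tendstoD(2)) (use e in simp)
    then show ?thesis
    proof eventually_elim
      case (elim n)
      let ?h = "\<lambda>\<alpha>. cmod (b (k n) \<alpha> - c \<alpha>) * P ^ (\<Sum>i\<in>UNIV. \<alpha> i)"
      have ed: "entire_coeffs (\<lambda>\<alpha>. b (k n) \<alpha> - c \<alpha>)" by (intro entire_coeffs_diff b ec)
      have h: "?h summable_on UNIV" using entire_coeffs_summable[OF ed, of P] P by simp
      have "infsum ?h UNIV = sum ?h S + infsum ?h (- S)" by (rule infsum_split_finite[OF h S(1)])
      also have "infsum ?h (- S) \<le> infsum g (- S)"
        by (intro infsum_mono summable_on_subset_banach[OF h] summable_on_subset_banach[OF g] dom) auto
      also have "infsum g (- S) < e / 2" by (rule S(2)) (use S(1) in auto)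
      finally have he: "infsum ?h UNIV < e" using elim by simp
      show ?case
      proof (intro allI impI)
        fix z :: "'d \<Rightarrow> complex" assume z: "\<forall>i. cmod (z i) \<le> R"
        have zP: "cmod (z i) \<le> P" for i using z P(2) order_trans by blast
        have "cmod (entire_fun (b (k n)) z - entire_fun c z) = cmod (entire_fun (\<lambda>\<alpha>. b (k n) \<alpha> - c \<alpha>) z)"
          by (simp add: entire_fun_diff b ec)
        also have "\<dots> \<le> infsum ?h UNIV"
          unfolding entire_fun_def
          by (rule norm_infsum_le[OF has_sum_infsum[OF entire_fun_summable[OF ed]] has_sum_infsum[OF h]])
            (rule norm_entire_term_le[OF zP])
        finally show "cmod (entire_fun (b (k n)) z - entire_fun c z) < e" using he by simp
      qed
    qed
  qed
  with k(1) ec show ?thesis by (rule that)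
qed

section \<open>Sub-mean value properties\<close>

text \<open>
  The case $p < 1$ reduces to $p = 1$: at a maximum point $z$ of $(1 - |x - z_0|)^{n/p} u(x)$ the
  function $u$ is on a ball around $z$ at most a constant times $u(z)$, so that a power $1 - p$ of
  $u$ can be taken out of the mean over this ball.
\<close>

lemma submean_powr:
  fixes p :: real
  assumes p: "0 < p" "p \<le> 1"
  obtains C where "C > 0"
    "\<And>u z0. continuous_on UNIV u \<Longrightarrow> (\<And>x. 0 \<le> u x) \<Longrightarrow>
      (\<And>z d. 0 < d \<Longrightarrow> emeasure lborel (ball z d) * ennreal (u z) \<le> (\<integral>\<^sup>+x\<in>ball z d. ennreal (u x) \<partial>lborel)) \<Longrightarrow>
      ennreal (u (z0 :: 'a::euclidean_space) powr p) \<le> ennreal C * (\<integral>\<^sup>+x\<in>ball z0 1. ennreal (u x powr p) \<partial>lborel)"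
proof -
  define n where "n = DIM('a)"
  \<comment> \<open>The exponent is fixed by k p = n, which makes the powers of d cancel in the
    final comparison.\<close>
  define k where "k = real n / p"
  define V where "V = unit_ball_vol (real n)"
  have V: "V > 0" by (simp add: V_def)
  have k: "k > 0" "k * p = real n" using p by (auto simp: k_def n_def)
  have "ennreal (u z0 powr p) \<le> ennreal (2 powr k / V) * (\<integral>\<^sup>+x\<in>ball z0 1. ennreal (u x powr p) \<partial>lborel)"
    if cont: "continuous_on UNIV u" and nn: "\<And>x. 0 \<le> u x"
      and mean: "\<And>z d. 0 < d \<Longrightarrow> emeasure lborel (ball z d) * ennreal (u z) \<le> (\<integral>\<^sup>+x\<in>ball z d. ennreal (u x) \<partial>lborel)"
    for u and z0 :: 'a
  proof -
    define g where "g x = (1 - dist z0 x) powr k * u x" for x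
    have contg: "continuous_on (cball z0 1) g"
      unfolding g_def
      by (intro continuous_intros continuous_on_powr' continuous_on_subset[OF cont]) (use k in auto)
    obtain z where z: "z \<in> cball z0 1" "\<And>x. x \<in> cball z0 1 \<Longrightarrow> g x \<le> g z"
      using continuous_attains_sup[OF compact_cball _ contg] by auto
    define A where "A = g z"
    have "u z0 = g z0" by (simp add: g_def)
    then have uA: "u z0 \<le> A" using z(2)[of z0] by (simp add: A_def)
    show ?thesis
    proof (cases "A \<le> 0")
      case True
      then have "u z0 = 0" using uA nn[of z0] by simp
      then show ?thesis by simp
    next
      case False
      then have A: "A > 0" by simp
      then have "dist z0 z \<noteq> 1" by (auto simp: A_def g_def)
      then have dz: "dist z0 z < 1" using z(1) by simp
      \<comment> \<open>Half the distance from z to the unit sphere about z0, so that 1 - |w - z0|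
        \<ge> d throughout the ball about z. With maximality at z this bounds u there by A
        d^(-k).\<close>
      define d where "d = (1 - dist z0 z) / 2"
      have d: "d > 0" "1 - dist z0 z = 2 * d" using dz by (auto simp: d_def)
      have near: "dist z0 w \<le> 1 - d" if "w \<in> ball z d" for w
        using that dist_triangle[of z0 w z] d by simp
      have uw: "u w \<le> A * d powr (- k)" if w: "w \<in> ball z d" for w
      proof -
        have "d powr k * u w \<le> (1 - dist z0 w) powr k * u w"
          using near[OF w] d k nn[of w] by (intro mult_right_mono powr_mono2) auto
        also have "\<dots> \<le> A" using z(2)[of w] near[OF w] d by (simp add: g_def A_def)
        finally show ?thesis using d by (simp add: powr_minus field_simps)
      qed
      let ?B = "(A * d powr (- k)) powr (1 - p)"
      let ?I = "\<integral>\<^sup>+x\<in>ball z0 1. ennreal (u x powr p) \<partial>lborel"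
      have uwp: "u w \<le> ?B * u w powr p" if w: "w \<in> ball z d" for w
      proof (cases "u w = 0")
        case False
        then have "u w > 0" using nn[of w] by simp
        then have "u w = u w powr (1 - p) * u w powr p" by (simp add: powr_add[symmetric])
        also have "\<dots> \<le> ?B * u w powr p"
          using uw[OF w] p nn[of w] by (intro mult_right_mono powr_mono2) auto
        finally show ?thesis .
      qed simp
      have [measurable]: "u \<in> borel_measurable borel" by (rule borel_measurable_continuous_onI[OF cont])
      have [measurable]: "ball z0 1 \<in> sets borel" by simp
      have "emeasure lborel (ball z d) * ennreal (u z) \<le> (\<integral>\<^sup>+x\<in>ball z d. ennreal (u x) \<partial>lborel)"
        by (rule mean[OF d(1)])
      also have "\<dots> \<le> (\<integral>\<^sup>+x. ennreal ?B * (ennreal (u x powr p) * indicator (ball z0 1) x) \<partial>lborel)"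
      proof (rule nn_integral_mono)
        fix x
        show "ennreal (u x) * indicator (ball z d) x \<le> ennreal ?B * (ennreal (u x powr p) * indicator (ball z0 1) x)"
        proof (cases "x \<in> ball z d")
          case True
          then have "x \<in> ball z0 1" using near[OF True] d by simp
          then show ?thesis using True uwp[OF True] by (simp add: ennreal_mult'[symmetric] ennreal_leI)
        qed simp
      qed
      also have "\<dots> = ennreal ?B * ?I" by (rule nn_integral_cmult) measurable
      finally have main: "ennreal (V * d ^ n * u z) \<le> ennreal ?B * ?I"
        using d V by (simp add: emeasure_ball V_def n_def ennreal_mult')
      have Az: "A = (2 * d) powr k * u z" using d by (simp add: A_def g_def)
      have expo: "d powr real n * d powr (- k) = d powr (- k * (1 - p))"
        using k by (simp add: powr_add[symmetric] algebra_simps)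
      have uz: "u z = A * 2 powr (- k) * d powr (- k)"
        using Az d by (simp add: powr_mult powr_minus field_simps)
      \<comment> \<open>Because n - k = - k (1 - p), the left side contains the same factor
        \<open>?B\<close> as the integral estimate. Cancelling it leaves a bound for A^p without
        d.\<close>
      have eq: "V * d ^ n * u z = ?B * (V * 2 powr (- k) * A powr p)"
      proof -
        have "V * d ^ n * u z = V * 2 powr (- k) * A * (d powr real n * d powr (- k))"
          using d by (simp add: uz powr_realpow)
        also have "A = A powr (1 - p) * A powr p" using A by (simp add: powr_add[symmetric])
        finally show ?thesis using A d unfolding expo by (simp add: powr_mult powr_powr mult_ac)
      qed
      have "ennreal ?B * ennreal (V * 2 powr (- k) * A powr p) = ennreal (V * d ^ n * u z)"
        unfolding eq by (rule ennreal_mult'[symmetric]) simp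
      with main have "ennreal ?B * ennreal (V * 2 powr (- k) * A powr p) \<le> ennreal ?B * ?I" by simp
      moreover have "?B > 0" using A d by simp
      ultimately have "ennreal (V * 2 powr (- k) * A powr p) \<le> ?I"
        by (simp add: ennreal_mult_le_mult_iff)
      then have "ennreal (2 powr k / V) * ennreal (V * 2 powr (- k) * A powr p) \<le> ennreal (2 powr k / V) * ?I"
        by (intro mult_left_mono) auto
      moreover have "ennreal (2 powr k / V) * ennreal (V * 2 powr (- k) * A powr p) = ennreal (A powr p)"
        using V by (simp add: ennreal_mult'[symmetric] powr_minus)
      moreover have "ennreal (u z0 powr p) \<le> ennreal (A powr p)"
        using uA nn p by (intro ennreal_leI powr_mono2) auto
      ultimately show ?thesis by order
    qed
  qed
  moreover have "2 powr k / V > 0" using V by simp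
  ultimately show ?thesis by (intro that[of "2 powr k / V"]) auto
qed

text \<open>Multiplication of x + i \<xi> by exp (i t). The coordinate
  \<open>phase_to_complex\<close> involves x - i \<xi>, so there it becomes multiplication by exp (-
  i t).\<close>

definition phase_rotation :: "real \<Rightarrow> 'a::real_vector \<times> 'a \<Rightarrow> 'a \<times> 'a" where
  "phase_rotation t X = (cos t *\<^sub>R fst X - sin t *\<^sub>R snd X, sin t *\<^sub>R fst X + cos t *\<^sub>R snd X)"

lemma phase_rotation_add: "phase_rotation s (phase_rotation t X) = phase_rotation (s + t) X"
  by (simp add: phase_rotation_def cos_add sin_add algebra_simps)

lemma norm_phase_rotation: "norm (phase_rotation t (X :: 'a::euclidean_space \<times> 'a)) = norm X"
proof -
  have sq: "(norm (a *\<^sub>R x - b *\<^sub>R y))\<^sup>2 + (norm (b *\<^sub>R x + a *\<^sub>R y))\<^sup>2 = (a\<^sup>2 + b\<^sup>2) * ((norm x)\<^sup>2 + (norm y)\<^sup>2)"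
    for a b and x y :: 'a
    by (simp only: power2_norm_eq_inner inner_diff_left inner_diff_right inner_add_left inner_add_right
        inner_scaleR_left inner_scaleR_right) (simp add: inner_commute[of y x] algebra_simps power2_eq_square)
  show ?thesis
    using sq[of "cos t" "fst X" "sin t" "snd X"] by (simp add: phase_rotation_def norm_Pair norm_prod_def)
qed

lemma nn_integral_lborel_translate:
  fixes f :: "'a::euclidean_space \<Rightarrow> ennreal"
  assumes [measurable]: "f \<in> borel_measurable borel"
  shows "(\<integral>\<^sup>+x. f (a + x) \<partial>lborel) = (\<integral>\<^sup>+x. f x \<partial>lborel)"
proof -
  have "(\<integral>\<^sup>+x. f x \<partial>lborel) = (\<integral>\<^sup>+x. f x \<partial>distr lborel borel ((+) a))" by (simp add: lborel_distr_plus)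
  also have "\<dots> = (\<integral>\<^sup>+x. f (a + x) \<partial>lborel)" by (rule nn_integral_distr) auto
  finally show ?thesis by simp
qed

text \<open>A shear translates every fibre by a vector constant on that fibre, so Tonelli reduces
  the claim to translation invariance.\<close>

lemma nn_integral_shear:
  fixes f :: "'a::euclidean_space \<times> 'a \<Rightarrow> ennreal"
  assumes f: "f \<in> borel_measurable borel"
  shows "(\<integral>\<^sup>+X. f (fst X + a *\<^sub>R snd X, snd X) \<partial>lborel) = (\<integral>\<^sup>+X. f X \<partial>lborel)"
    and "(\<integral>\<^sup>+X. f (fst X, snd X + a *\<^sub>R fst X) \<partial>lborel) = (\<integral>\<^sup>+X. f X \<partial>lborel)"
proof -
  have m1: "(\<lambda>X. f (fst X + a *\<^sub>R snd X, snd X)) \<in> borel_measurable borel"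
    and m2: "(\<lambda>X. f (fst X, snd X + a *\<^sub>R fst X)) \<in> borel_measurable borel"
    by (rule measurable_compose[OF borel_measurable_continuous_onI f]; intro continuous_intros)+
  have sec1: "(\<lambda>x. f (x, y)) \<in> borel_measurable borel" and sec2: "(\<lambda>x. f (y, x)) \<in> borel_measurable borel" for y
    by (rule measurable_compose[OF borel_measurable_continuous_onI f]; intro continuous_intros)+
  have fp: "f \<in> borel_measurable (lborel \<Otimes>\<^sub>M lborel)" using f by (simp add: lborel_prod)
  have "(\<integral>\<^sup>+X. f (fst X + a *\<^sub>R snd X, snd X) \<partial>lborel) = (\<integral>\<^sup>+X. f (fst X + a *\<^sub>R snd X, snd X) \<partial>(lborel \<Otimes>\<^sub>M lborel))"
    by (simp add: lborel_prod)
  also have "\<dots> = (\<integral>\<^sup>+y. \<integral>\<^sup>+x. f (a *\<^sub>R y + x, y) \<partial>lborel \<partial>lborel)"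
    using lborel_pair.nn_integral_snd[of "\<lambda>X. f (fst X + a *\<^sub>R snd X, snd X)"] m1 by (simp add: lborel_prod add.commute)
  also have "\<dots> = (\<integral>\<^sup>+y. \<integral>\<^sup>+x. f (x, y) \<partial>lborel \<partial>lborel)"
    by (intro nn_integral_cong nn_integral_lborel_translate sec1)
  also have "\<dots> = (\<integral>\<^sup>+X. f X \<partial>lborel)"
    using lborel_pair.nn_integral_snd[OF fp] by (simp add: lborel_prod)
  finally show "(\<integral>\<^sup>+X. f (fst X + a *\<^sub>R snd X, snd X) \<partial>lborel) = (\<integral>\<^sup>+X. f X \<partial>lborel)" .
  have "(\<integral>\<^sup>+X. f (fst X, snd X + a *\<^sub>R fst X) \<partial>lborel) = (\<integral>\<^sup>+X. f (fst X, snd X + a *\<^sub>R fst X) \<partial>(lborel \<Otimes>\<^sub>M lborel))"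
    by (simp add: lborel_prod)
  also have "\<dots> = (\<integral>\<^sup>+x. \<integral>\<^sup>+y. f (x, a *\<^sub>R x + y) \<partial>lborel \<partial>lborel)"
    using lborel.nn_integral_fst[of "\<lambda>X. f (fst X, snd X + a *\<^sub>R fst X)" lborel] m2 by (simp add: lborel_prod add.commute)
  also have "\<dots> = (\<integral>\<^sup>+x. \<integral>\<^sup>+y. f (x, y) \<partial>lborel \<partial>lborel)"
    by (intro nn_integral_cong nn_integral_lborel_translate sec2)
  also have "\<dots> = (\<integral>\<^sup>+X. f X \<partial>lborel)"
    using lborel.nn_integral_fst[OF fp] by (simp add: lborel_prod)
  finally show "(\<integral>\<^sup>+X. f (fst X, snd X + a *\<^sub>R fst X) \<partial>lborel) = (\<integral>\<^sup>+X. f X \<partial>lborel)" .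
qed

lemma measurable_phase_rotation [measurable]: "(phase_rotation t :: 'a::euclidean_space \<times> 'a \<Rightarrow> _) \<in> borel_measurable borel"
  unfolding phase_rotation_def by (intro borel_measurable_continuous_onI continuous_intros)

text \<open>
  A rotation by an angle of absolute value less than $\pi$ is a product of three shears.
\<close>

lemma nn_integral_phase_rotation_small:
  fixes f :: "'a::euclidean_space \<times> 'a \<Rightarrow> ennreal"
  assumes f[measurable]: "f \<in> borel_measurable borel" and "\<bar>t\<bar> < pi"
  shows "(\<integral>\<^sup>+X. f (phase_rotation t X) \<partial>lborel) = (\<integral>\<^sup>+X. f X \<partial>lborel)"
proof -
  \<comment> \<open>The outer shears have parameter - tan (t / 2), the middle one sin t. The tangent
    needs cos (t / 2) \<noteq> 0, which is where |t| < pi is used.\<close>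
  define a b where "a = - tan (t / 2)" and "b = sin t"
  have "cos (t / 2) > 0" using assms by (intro cos_gt_zero_pi) auto
  then have c: "cos (t / 2) \<noteq> 0" by simp
  have t2: "sin t = 2 * sin (t / 2) * cos (t / 2)" "cos t = 1 - 2 * (sin (t / 2))\<^sup>2" "cos t = 2 * (cos (t / 2))\<^sup>2 - 1"
    using sin_double[of "t / 2"] cos_double_sin[of "t / 2"] cos_double_cos[of "t / 2"] by auto
  have "a * b = - 2 * (sin (t / 2))\<^sup>2"
    using c unfolding a_def b_def t2(1) tan_def by (simp add: power2_eq_square)
  moreover have "a * (1 + cos t) = - sin t"
    using c unfolding a_def t2(3) t2(1) tan_def by (simp add: power2_eq_square)
  ultimately have ab: "1 + a * b = cos t" "a * (1 + cos t) = - sin t" using t2(2) by auto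
  have f1: "(\<lambda>X. f (fst X + a *\<^sub>R snd X, snd X)) \<in> borel_measurable borel"
    by (rule measurable_compose[OF borel_measurable_continuous_onI f]; intro continuous_intros)
  have f2: "(\<lambda>X. f (fst X + a *\<^sub>R (snd X + b *\<^sub>R fst X), snd X + b *\<^sub>R fst X)) \<in> borel_measurable borel"
    by (rule measurable_compose[OF borel_measurable_continuous_onI f]; intro continuous_intros)
  have "(\<integral>\<^sup>+X. f X \<partial>lborel) = (\<integral>\<^sup>+X. f (fst X + a *\<^sub>R snd X, snd X) \<partial>lborel)"
    using nn_integral_shear(1)[OF f] by simp
  also have "\<dots> = (\<integral>\<^sup>+X. f (fst X + a *\<^sub>R (snd X + b *\<^sub>R fst X), snd X + b *\<^sub>R fst X) \<partial>lborel)"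
    using nn_integral_shear(2)[OF f1, of b] by simp
  also have "\<dots> = (\<integral>\<^sup>+X. f ((fst X + a *\<^sub>R snd X) + a *\<^sub>R (snd X + b *\<^sub>R (fst X + a *\<^sub>R snd X)), snd X + b *\<^sub>R (fst X + a *\<^sub>R snd X)) \<partial>lborel)"
    using nn_integral_shear(1)[OF f2, of a] by simp
  also have "\<dots> = (\<integral>\<^sup>+X. f (phase_rotation t X) \<partial>lborel)"
  proof (intro nn_integral_cong arg_cong[where f=f])
    fix X :: "'a \<times> 'a"
    have "snd X + b *\<^sub>R (fst X + a *\<^sub>R snd X) = b *\<^sub>R fst X + (1 + a * b) *\<^sub>R snd X"
      by (simp add: algebra_simps)
    moreover have "(fst X + a *\<^sub>R snd X) + a *\<^sub>R (b *\<^sub>R fst X + (1 + a * b) *\<^sub>R snd X) =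
       (1 + a * b) *\<^sub>R fst X + (a * (1 + (1 + a * b))) *\<^sub>R snd X"
      by (simp add: algebra_simps) (metis scaleR_add_left mult_2_right)
    ultimately show "((fst X + a *\<^sub>R snd X) + a *\<^sub>R (snd X + b *\<^sub>R (fst X + a *\<^sub>R snd X)), snd X + b *\<^sub>R (fst X + a *\<^sub>R snd X)) = phase_rotation t X"
      by (simp only: ab) (simp add: phase_rotation_def b_def)
  qed
  finally show ?thesis by simp
qed

text \<open>Three successive rotations by t / 3 stay within the range of the small-angle
  case.\<close>

lemma nn_integral_phase_rotation:
  fixes f :: "'a::euclidean_space \<times> 'a \<Rightarrow> ennreal"
  assumes f[measurable]: "f \<in> borel_measurable borel" and "\<bar>t\<bar> \<le> 2 * pi"
  shows "(\<integral>\<^sup>+X. f (phase_rotation t X) \<partial>lborel) = (\<integral>\<^sup>+X. f X \<partial>lborel)"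
proof -
  have "2 * pi < 3 * pi" using pi_gt_zero by simp
  then have "\<bar>t\<bar> < 3 * pi" using assms(2) by linarith
  then have s: "\<bar>t / 3\<bar> < pi" by (simp add: abs_divide)
  have m1: "(\<lambda>X. f (phase_rotation (t / 3) X)) \<in> borel_measurable borel" and m2: "(\<lambda>X. f (phase_rotation (t / 3) (phase_rotation (t / 3) X))) \<in> borel_measurable borel"
    by measurable
  have "(\<integral>\<^sup>+X. f X \<partial>lborel) = (\<integral>\<^sup>+X. f (phase_rotation (t / 3) (phase_rotation (t / 3) (phase_rotation (t / 3) X))) \<partial>lborel)"
    using nn_integral_phase_rotation_small[OF f s] nn_integral_phase_rotation_small[OF m1 s] nn_integral_phase_rotation_small[OF m2 s] by simp
  then show ?thesis by (simp add: phase_rotation_add)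
qed

text \<open>The hypothesis bounds u at X by its mean over the orbit of each W under rotation.
  Integrating over W in the ball and exchanging the integrals, each rotation preserves both the ball
  and the measure, so the orbit mean turns into the mean over the ball.\<close>

lemma submean_ball:
  fixes u :: "'a::euclidean_space \<times> 'a \<Rightarrow> real"
  assumes cont: "continuous_on UNIV u"
    and mean: "\<And>X W. ennreal (u X) \<le> (\<integral>\<^sup>+t\<in>{0..1}. ennreal (u (X + phase_rotation (- (2 * pi * t)) W)) \<partial>lborel)"
  shows "emeasure lborel (ball X d) * ennreal (u X) \<le> (\<integral>\<^sup>+Y\<in>ball X d. ennreal (u Y) \<partial>lborel)"
proof -
  have [measurable]: "u \<in> borel_measurable borel" by (rule borel_measurable_continuous_onI[OF cont])
  let ?B = "ball (0 :: 'a \<times> 'a) d"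
  have [measurable]: "?B \<in> sets borel" "ball X d \<in> sets borel" by simp_all
  define v where "v W = ennreal (u (X + W)) * indicator ?B W" for W
  have [measurable]: "v \<in> borel_measurable borel" unfolding v_def by measurable
  have vrot: "v (phase_rotation t W) = ennreal (u (X + phase_rotation t W)) * indicator ?B W" for t W
    by (simp add: v_def indicator_def norm_phase_rotation)
  have mu: "(\<lambda>(W, t). ennreal (u (X + phase_rotation (- (2 * pi * t)) W))) \<in> borel_measurable (lborel \<Otimes>\<^sub>M lborel)"
  proof -
    have "(\<lambda>p. u (X + phase_rotation (- (2 * pi * snd p)) (fst p))) \<in> borel_measurable borel"
      unfolding phase_rotation_def
      by (rule borel_measurable_continuous_onI, rule continuous_on_compose2[OF cont]) (auto intro!: continuous_intros)
    from measurable_compose[OF this measurable_ennreal] show ?thesis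
      by (simp add: lborel_prod split_beta')
  qed
  have [measurable]: "(\<lambda>(W, t). ennreal (u (X + phase_rotation (- (2 * pi * t)) W)) * indicator ?B W * indicator {0..1} t) \<in> borel_measurable (lborel \<Otimes>\<^sub>M lborel)"
    using mu by (simp add: split_beta')
  have "emeasure lborel (ball X d) * ennreal (u X) = emeasure lborel ?B * ennreal (u X)"
  proof -
    have "emeasure lborel (ball X d) = emeasure lborel ?B"
      by (cases "d \<ge> 0") (simp_all add: emeasure_ball ball_empty)
    then show ?thesis by simp
  qed
  also have "\<dots> = (\<integral>\<^sup>+W. ennreal (u X) * indicator ?B W \<partial>lborel)"
    by (simp add: nn_integral_cmult_indicator mult.commute)
  also have "\<dots> \<le> (\<integral>\<^sup>+W. (\<integral>\<^sup>+t. ennreal (u (X + phase_rotation (- (2 * pi * t)) W)) * indicator ?B W * indicator {0..1} t \<partial>lborel) \<partial>lborel)"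
  proof (intro nn_integral_mono)
    fix W
    show "ennreal (u X) * indicator ?B W \<le> (\<integral>\<^sup>+t. ennreal (u (X + phase_rotation (- (2 * pi * t)) W)) * indicator ?B W * indicator {0..1} t \<partial>lborel)"
      using mean[of X W] by (cases "W \<in> ?B") auto
  qed
  also have "\<dots> = (\<integral>\<^sup>+t. (\<integral>\<^sup>+W. ennreal (u (X + phase_rotation (- (2 * pi * t)) W)) * indicator ?B W * indicator {0..1} t \<partial>lborel) \<partial>lborel)"
    by (rule lborel_pair.Fubini'[symmetric]) measurable
  also have "\<dots> = (\<integral>\<^sup>+t. (\<integral>\<^sup>+W. v W \<partial>lborel) * indicator {0..1} t \<partial>(lborel::real measure))"
  proof (rule nn_integral_cong)
    fix t :: real
    show "(\<integral>\<^sup>+W. ennreal (u (X + phase_rotation (- (2 * pi * t)) W)) * indicator ?B W * indicator {0..1} t \<partial>lborel) = (\<integral>\<^sup>+W. v W \<partial>lborel) * indicator {0..1} t"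
    proof (cases "t \<in> {0..1}")
      case True
      then have "(\<integral>\<^sup>+W. v (phase_rotation (- (2 * pi * t)) W) \<partial>lborel) = (\<integral>\<^sup>+W. v W \<partial>lborel)"
        by (intro nn_integral_phase_rotation) (auto simp: abs_mult)
      then show ?thesis using True by (simp add: vrot)
    qed simp
  qed
  also have "\<dots> = (\<integral>\<^sup>+W. v W \<partial>lborel)" by (subst nn_integral_cmult_indicator) auto
  also have "\<dots> = (\<integral>\<^sup>+Y\<in>ball X d. ennreal (u Y) \<partial>lborel)"
  proof -
    have "(\<integral>\<^sup>+W. v W \<partial>lborel) = (\<integral>\<^sup>+W. (\<lambda>Y. ennreal (u Y) * indicator (ball X d) Y) (X + W) \<partial>lborel)"
      by (intro nn_integral_cong) (auto simp: v_def indicator_def dist_norm)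
    also have "\<dots> = (\<integral>\<^sup>+Y\<in>ball X d. ennreal (u Y) \<partial>lborel)"
      by (rule nn_integral_lborel_translate) measurable
    finally show ?thesis .
  qed
  finally show ?thesis .
qed

text \<open>Cauchy's formula on the unit circle, parametrized by [0, 1] to match the rotation mean
  in \<open>submean_ball\<close>.\<close>

lemma holomorphic_mean_value:
  assumes "h holomorphic_on UNIV"
  shows "ennreal (cmod (h 0)) \<le> (\<integral>\<^sup>+t\<in>{0..1}. ennreal (cmod (h (exp (2 * of_real pi * \<i> * of_real t)))) \<partial>lborel)"
proof -
  have cont: "continuous_on UNIV h" using assms by (rule holomorphic_on_imp_continuous_on)
  let ?e = "\<lambda>t::real. exp (2 * of_real pi * \<i> * of_real t)"
  have "((\<lambda>u. h u / (u - 0)) has_contour_integral (2 * of_real pi * \<i> * h 0)) (circlepath 0 1)"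
    by (rule Cauchy_integral_circlepath)
      (use assms cont in \<open>auto intro: continuous_on_subset holomorphic_on_subset\<close>)
  then have "((\<lambda>t. h (?e t) / ?e t * (2 * of_real pi * \<i> * ?e t)) has_integral (2 * of_real pi * \<i> * h 0)) {0..1}"
    unfolding has_contour_integral_def
    by (rule has_integral_eq[rotated]) (simp add: vector_derivative_circlepath01, simp add: circlepath)
  then have "((\<lambda>t. inverse (2 * of_real pi * \<i>) * (h (?e t) / ?e t * (2 * of_real pi * \<i> * ?e t))) has_integral inverse (2 * of_real pi * \<i>) * (2 * of_real pi * \<i> * h 0)) {0..1}"
    by (rule has_integral_mult_right)
  then have hi: "((\<lambda>t. h (?e t)) has_integral h 0) {0..1}"
    by (simp add: field_simps)
  have gc: "continuous_on {0..1} (\<lambda>t. cmod (h (?e t)))"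
    by (intro continuous_intros continuous_on_compose2[OF cont]) auto
  then have gi: "(\<lambda>t. cmod (h (?e t))) integrable_on {0..1}" by (rule integrable_continuous_real)
  have "cmod (h 0) = cmod (integral {0..1} (\<lambda>t. h (?e t)))" using hi by (simp add: integral_unique)
  also have "\<dots> \<le> integral {0..1} (\<lambda>t. cmod (h (?e t)))"
    using hi gi by (intro integral_norm_bound_integral) (auto simp: has_integral_integrable)
  finally have "ennreal (cmod (h 0)) \<le> ennreal (integral {0..1} (\<lambda>t. cmod (h (?e t))))" by (rule ennreal_leI)
  also have "\<dots> = (\<integral>\<^sup>+t\<in>{0..1}. ennreal (cmod (h (?e t))) \<partial>lborel)"
    using nn_integral_has_integral_lebesgue'[OF _ integrable_integral[OF gi]] by simp
  finally show ?thesis .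
qed

section \<open>Compactness in quasi-normed spaces\<close>

text \<open>Only the gauges N (f - g) between points of E are axiomatized, which is all that the
  topology sees. The maximum form of the triangle inequality turns two estimates at e / K into one
  at e.\<close>

locale quasi_normed =
  fixes E :: "'a::minus set" and N :: "'a \<Rightarrow> ennreal" and K :: real
  assumes K: "K \<ge> 1"
    and zero: "\<And>f. f \<in> E \<Longrightarrow> N (f - f) = 0"
    and triangle: "\<And>f g h. f \<in> E \<Longrightarrow> g \<in> E \<Longrightarrow> h \<in> E \<Longrightarrow> N (f - h) \<le> ennreal K * max (N (f - g)) (N (g - h))"
    and commute: "\<And>f g. f \<in> E \<Longrightarrow> g \<in> E \<Longrightarrow> N (f - g) = N (g - f)"
begin

lemma close_trans:
  assumes "f \<in> E" "g \<in> E" "h \<in> E" "N (f - g) < ennreal (1 / K) * e" "N (g - h) < ennreal (1 / K) * e"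
  shows "N (f - h) < e"
proof -
  have "N (f - h) \<le> ennreal K * max (N (f - g)) (N (g - h))" by (rule triangle[OF assms(1-3)])
  also have "\<dots> < ennreal K * (ennreal (1 / K) * e)"
    using K assms by (intro ennreal_mult_strict_left_mono) auto
  also have "\<dots> = e" using K by (simp add: mult.assoc[symmetric] ennreal_mult'[symmetric])
  finally show ?thesis .
qed

lemma shrink_pos: "0 < e \<Longrightarrow> 0 < ennreal (1 / K) * e"
  using K by (simp add: ennreal_zero_less_mult_iff)

abbreviation "T \<equiv> quasi_norm_topology E N"

text \<open>A ball of a quasi-norm need not be open. The points having some ball inside it do form
  an open set: if the d-ball about g works, then so does the d / K-ball about any h within d / K of
  g.\<close>

lemma nhd_in_ball:
  assumes "f \<in> E" "0 < e"
  obtains U where "openin T U" "f \<in> U" "\<And>g. g \<in> U \<Longrightarrow> N (g - f) < e"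
proof -
  define U where "U = {g \<in> E. \<exists>d>0. \<forall>h\<in>E. N (h - g) < d \<longrightarrow> N (h - f) < e}"
  have "openin T U"
    unfolding openin_quasi_norm_topology
  proof (intro conjI ballI)
    fix g assume "g \<in> U"
    then obtain d where d: "g \<in> E" "d > 0" "\<And>h. h \<in> E \<Longrightarrow> N (h - g) < d \<Longrightarrow> N (h - f) < e"
      by (auto simp: U_def)
    have "h \<in> U" if h: "h \<in> E" "N (h - g) < ennreal (1 / K) * d" for h
    proof -
      have "N (k - f) < e" if "k \<in> E" "N (k - h) < ennreal (1 / K) * d" for k
        by (rule d(3)[OF that(1) close_trans[OF that(1) h(1) d(1) that(2) h(2)]])
      then show ?thesis using h shrink_pos[OF d(2)] by (auto simp: U_def)
    qed
    then show "\<exists>d>0. \<forall>h\<in>E. N (h - g) < d \<longrightarrow> h \<in> U" using shrink_pos[OF d(2)] by blast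
  qed (auto simp: U_def)
  moreover have "f \<in> U" using assms by (auto simp: U_def)
  moreover have "N (g - f) < e" if "g \<in> U" for g using that zero by (auto simp: U_def)
  ultimately show ?thesis by (rule that)
qed

lemma closure_approx:
  assumes "f \<in> T closure_of B" "0 < e"
  obtains g where "g \<in> B" "g \<in> E" "N (g - f) < e"
proof -
  have "f \<in> E" using assms(1) by (simp add: in_closure_of)
  obtain U where U: "openin T U" "f \<in> U" "\<And>g. g \<in> U \<Longrightarrow> N (g - f) < e"
    using nhd_in_ball[OF \<open>f \<in> E\<close> assms(2)] by blast
  then obtain g where "g \<in> B" "g \<in> U" using assms(1) by (auto simp: in_closure_of)
  moreover have "g \<in> E" using U(1) \<open>g \<in> U\<close> by (auto simp: openin_quasi_norm_topology)
  ultimately show ?thesis using U(3) by (intro that)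
qed

lemma limit_in_closure:
  assumes "\<And>n. g n \<in> B" "B \<subseteq> E" "f \<in> E" "(\<lambda>n. N (g n - f)) \<longlonglongrightarrow> 0"
  shows "f \<in> T closure_of B"
  unfolding in_closure_of
proof (intro conjI allI impI)
  fix U assume U: "f \<in> U \<and> openin T U"
  then obtain e where e: "e > 0" "\<And>g. g \<in> E \<Longrightarrow> N (g - f) < e \<Longrightarrow> g \<in> U"
    by (auto simp: openin_quasi_norm_topology)
  have "\<forall>\<^sub>F n in sequentially. N (g n - f) < e" using assms(4) e(1) by (rule order_tendstoD(2))
  then obtain n where "N (g n - f) < e" using eventually_happens'[OF sequentially_bot] by blast
  then show "\<exists>y. y \<in> B \<and> y \<in> U" using assms e(2) by blast
qed (use assms in simp)

text \<open>Compactness supplies a cluster point. If there were none, each point would have a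
  neighbourhood that the sequence eventually leaves, and finitely many of these cover C.\<close>

lemma compactin_subsequence:
  assumes C: "compactin T C" and g: "\<And>n. g n \<in> C"
  obtains f where "f \<in> C" "\<And>e. 0 < e \<Longrightarrow> \<exists>\<^sub>F n in sequentially. N (g n - f) < e"
proof (rule ccontr)
  note found = that
  assume none: "\<not> thesis"
  have CE: "C \<subseteq> E" using compactin_subset_topspace[OF C] by simp
  have "\<exists>U. openin T U \<and> f \<in> U \<and> (\<forall>\<^sub>F n in sequentially. g n \<notin> U)" if f: "f \<in> C" for f
  proof -
    have "\<not> (\<forall>e>0. \<exists>\<^sub>F n in sequentially. N (g n - f) < e)" using none found[OF f] by blast
    then obtain e where e: "0 < e" "\<not> (\<exists>\<^sub>F n in sequentially. N (g n - f) < e)" by blast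
    obtain U where U: "openin T U" "f \<in> U" "\<And>g. g \<in> U \<Longrightarrow> N (g - f) < e"
      using nhd_in_ball[of f e] f CE e(1) by blast
    have "\<forall>\<^sub>F n in sequentially. \<not> N (g n - f) < e" using e(2) by (simp add: frequently_def)
    then have "\<forall>\<^sub>F n in sequentially. g n \<notin> U" by (rule eventually_mono) (use U(3) in blast)
    with U show ?thesis by blast
  qed
  then obtain U where U: "\<And>f. f \<in> C \<Longrightarrow> openin T (U f)" "\<And>f. f \<in> C \<Longrightarrow> f \<in> U f"
    "\<And>f. f \<in> C \<Longrightarrow> \<forall>\<^sub>F n in sequentially. g n \<notin> U f" by metis
  have "\<exists>F. finite F \<and> F \<subseteq> U ` C \<and> C \<subseteq> \<Union>F"
    using C unfolding compactin_def using U(1,2) by (auto dest!: conjunct2 spec[of _ "U ` C"])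
  then obtain F where F: "finite F" "F \<subseteq> U ` C" "C \<subseteq> \<Union>F" by blast
  have "\<forall>\<^sub>F n in sequentially. \<forall>V\<in>F. g n \<notin> V"
    using F U(3) by (intro eventually_ball_finite) auto
  then obtain n where "\<forall>V\<in>F. g n \<notin> V" using eventually_happens'[OF sequentially_bot] by blast
  with g[of n] F(3) show False by blast
qed

text \<open>Without a finite net, points could be chosen one by one at gauge at least e from all
  earlier ones; two late members of a convergent subsequence would contradict this.\<close>

lemma totally_bounded:
  assumes seq: "\<And>g. (\<And>n. g n \<in> C) \<Longrightarrow> \<exists>f\<in>C. \<exists>k::nat \<Rightarrow> nat. strict_mono k \<and> (\<lambda>n. N (g (k n) - f)) \<longlonglongrightarrow> 0"
    and "C \<subseteq> E" "0 < e"
  shows "\<exists>F. finite F \<and> F \<subseteq> C \<and> (\<forall>f\<in>C. \<exists>g\<in>F. N (f - g) < e)"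
proof (rule ccontr)
  assume none: "\<not> ?thesis"
  have step: "\<exists>f\<in>C. \<forall>g\<in>F. \<not> N (f - g) < e" if "finite F" "F \<subseteq> C" for F 
  proof (rule ccontr)
    assume "\<not> ?thesis"
    then have "\<forall>f\<in>C. \<exists>g\<in>F. N (f - g) < e" by blast
    with none that show False by blast
  qed
  have "\<exists>s. \<forall>n::nat. s n \<in> C \<and> (\<forall>m<n. \<not> N (s n - s m) < e)"
  proof (rule dependent_wellorder_choice)
    fix n :: nat and s :: "nat \<Rightarrow> 'a"
    assume "\<And>m. m < n \<Longrightarrow> s m \<in> C \<and> (\<forall>l<m. \<not> N (s m - s l) < e)"
    then have "s ` {..<n} \<subseteq> C" by auto
    from step[OF _ this] show "\<exists>x. x \<in> C \<and> (\<forall>m<n. \<not> N (x - s m) < e)" by auto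
  qed auto
  then obtain s where s: "\<forall>n::nat. s n \<in> C \<and> (\<forall>m<n. \<not> N (s n - s m) < e)" ..
  obtain f k where f: "f \<in> C" "strict_mono k" "(\<lambda>n. N (s (k n) - f)) \<longlonglongrightarrow> 0" using seq[of s] s by blast
  have "\<forall>\<^sub>F n in sequentially. N (s (k n) - f) < ennreal (1 / K) * e"
    using f(3) shrink_pos[OF assms(3)] by (rule order_tendstoD(2))
  then obtain n where "\<forall>m\<ge>n. N (s (k m) - f) < ennreal (1 / K) * e" unfolding eventually_sequentially ..
  then have n: "N (s (k n) - f) < ennreal (1 / K) * e" "N (s (k (Suc n)) - f) < ennreal (1 / K) * e" by auto
  have "f \<in> E" "s (k n) \<in> E" "s (k (Suc n)) \<in> E" using f(1) s assms(2) by blast+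
  then have "N (s (k (Suc n)) - s (k n)) < e"
    using n commute[of f "s (k n)"] close_trans[of "s (k (Suc n))" f "s (k n)" e] by simp
  moreover have "k n < k (Suc n)" using f(2) by (simp add: strict_mono_def)
  ultimately show False using s by blast
qed

text \<open>The Lebesgue number argument: for some n every ball of radius 1 / (n + 1) about a point
  of C lies in one member of the cover, and a finite net of that radius selects a finite
  subcover.\<close>

lemma sequentially_compact_imp_compactin:
  assumes seq: "\<And>g. (\<And>n. g n \<in> C) \<Longrightarrow> \<exists>f\<in>C. \<exists>k::nat \<Rightarrow> nat. strict_mono k \<and> (\<lambda>n. N (g (k n) - f)) \<longlonglongrightarrow> 0"
    and CE: "C \<subseteq> E"
  shows "compactin T C"
  unfolding compactin_def
proof (intro conjI allI impI)
  fix \<U> assume \<U>: "Ball \<U> (openin T) \<and> C \<subseteq> \<Union>\<U>"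
  define P where "P n f \<longleftrightarrow> (\<exists>U\<in>\<U>. \<forall>g\<in>E. N (g - f) < ennreal (1 / Suc n) \<longrightarrow> g \<in> U)" for n f
  have "\<exists>n. \<forall>f\<in>C. P n f"
  proof (rule ccontr)
    assume "\<not> ?thesis"
    then have "\<forall>n. \<exists>f. f \<in> C \<and> \<not> P n f" by blast
    from choice[OF this] obtain s where s: "\<forall>n. s n \<in> C \<and> \<not> P n (s n)" ..
    obtain f k where f: "f \<in> C" "strict_mono k" "(\<lambda>n. N (s (k n) - f)) \<longlonglongrightarrow> 0" using seq[of s] s by blast
    obtain U where U: "U \<in> \<U>" "f \<in> U" using \<U> f(1) by blast
    have "openin T U" using \<U> U by blast
    then have "\<exists>e>0. \<forall>g\<in>E. N (g - f) < e \<longrightarrow> g \<in> U"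
      using U(2) by (simp add: openin_quasi_norm_topology)
    then obtain e where e: "e > 0" "\<And>g. g \<in> E \<Longrightarrow> N (g - f) < e \<Longrightarrow> g \<in> U" by blast
    have "(\<lambda>n. ennreal (1 / Suc n)) \<longlonglongrightarrow> ennreal 0"
      by (intro tendsto_ennrealI LIMSEQ_Suc lim_const_over_n)
    then have "(\<lambda>n. ennreal (1 / Suc (k n))) \<longlonglongrightarrow> 0"
      using LIMSEQ_subseq_LIMSEQ[OF _ f(2)] by (fastforce simp: o_def)
    then have "\<forall>\<^sub>F n in sequentially. ennreal (1 / Suc (k n)) < ennreal (1 / K) * e \<and> N (s (k n) - f) < ennreal (1 / K) * e"
      using f(3) shrink_pos[OF e(1)] by (intro eventually_conj order_tendstoD(2)) auto
    then obtain n where n: "ennreal (1 / Suc (k n)) < ennreal (1 / K) * e" "N (s (k n) - f) < ennreal (1 / K) * e"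
      using eventually_happens'[OF sequentially_bot] by blast
    obtain g where g: "g \<in> E" "N (g - s (k n)) < ennreal (1 / Suc (k n))" "g \<notin> U"
      using s U(1) unfolding P_def by blast
    have "N (g - f) < e"
      by (rule close_trans[of _ "s (k n)"]) (use g n s f(1) CE in auto)
    with e g show False by blast
  qed
  then obtain n where n: "\<forall>f\<in>C. P n f" ..
  obtain F where F: "finite F" "F \<subseteq> C" "\<And>f. f \<in> C \<Longrightarrow> \<exists>g\<in>F. N (f - g) < ennreal (1 / Suc n)"
    using totally_bounded[OF seq CE, of "ennreal (1 / Suc n)"] by auto
  have "\<forall>f\<in>F. \<exists>U. U \<in> \<U> \<and> (\<forall>g\<in>E. N (g - f) < ennreal (1 / Suc n) \<longrightarrow> g \<in> U)"
    using n F(2) unfolding P_def by blast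
  from bchoice[OF this] obtain U
    where U: "\<forall>f\<in>F. U f \<in> \<U> \<and> (\<forall>g\<in>E. N (g - f) < ennreal (1 / Suc n) \<longrightarrow> g \<in> U f)" ..
  show "\<exists>\<F>. finite \<F> \<and> \<F> \<subseteq> \<U> \<and> C \<subseteq> \<Union>\<F>"
  proof (intro exI[of _ "U ` F"] conjI)
    show "C \<subseteq> \<Union>(U ` F)"
    proof
      fix f assume "f \<in> C"
      then obtain g where "g \<in> F" "N (f - g) < ennreal (1 / Suc n)" using F(3) by blast
      then show "f \<in> \<Union>(U ` F)" using U \<open>f \<in> C\<close> CE by blast
    qed
  qed (use F U in auto)
qed (use CE in simp)

text \<open>Subsequences need only be found for sequences in B: a sequence in the closure is
  replaced by one in B at gauge below 1 / (n + 1), which has the same limits.\<close>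

lemma compactin_closure:
  assumes BE: "B \<subseteq> E"
    and seq: "\<And>g. (\<And>n. g n \<in> B) \<Longrightarrow> \<exists>f\<in>E. \<exists>k::nat \<Rightarrow> nat. strict_mono k \<and> (\<lambda>n. N (g (k n) - f)) \<longlonglongrightarrow> 0"
  shows "compactin T (T closure_of B)"
proof (rule sequentially_compact_imp_compactin)
  have CE: "T closure_of B \<subseteq> E" using closure_of_subset_topspace[of T B] by simp
  then show "T closure_of B \<subseteq> E" .
  fix g :: "nat \<Rightarrow> 'a" assume g: "\<And>n. g n \<in> T closure_of B"
  have "\<exists>b. b \<in> B \<and> N (b - g n) < ennreal (1 / Suc n)" for n
    using closure_approx[OF g, of "ennreal (1 / Suc n)" n] by (metis ennreal_less_zero_iff of_nat_0_less_iff zero_less_Suc zero_less_divide_1_iff)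
  then obtain b where b: "\<And>n. b n \<in> B" "\<And>n. N (b n - g n) < ennreal (1 / Suc n)" by metis
  obtain f k where f: "f \<in> E" "strict_mono k" "(\<lambda>n. N (b (k n) - f)) \<longlonglongrightarrow> 0" using seq[of b] b by blast
  have "f \<in> T closure_of B" by (rule limit_in_closure[OF _ BE f(1) f(3)]) (rule b)
  moreover have "(\<lambda>n. N (g (k n) - f)) \<longlonglongrightarrow> 0"
  proof (rule order_tendstoI)
    fix e :: ennreal assume "0 < e"
    have "(\<lambda>n. ennreal (1 / Suc n)) \<longlonglongrightarrow> ennreal 0"
      by (intro tendsto_ennrealI LIMSEQ_Suc lim_const_over_n)
    then have "(\<lambda>n. ennreal (1 / Suc (k n))) \<longlonglongrightarrow> 0"
      using LIMSEQ_subseq_LIMSEQ[OF _ f(2)] by (fastforce simp: o_def)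
    then have "\<forall>\<^sub>F n in sequentially. ennreal (1 / Suc (k n)) < ennreal (1 / K) * e \<and> N (b (k n) - f) < ennreal (1 / K) * e"
      using f(3) shrink_pos[OF \<open>0 < e\<close>] by (intro eventually_conj order_tendstoD(2)) auto
    then show "\<forall>\<^sub>F n in sequentially. N (g (k n) - f) < e"
    proof eventually_elim
      case (elim n)
      have "g (k n) \<in> E" "b (k n) \<in> E" using g CE b(1) BE by blast+
      moreover from this have "N (g (k n) - b (k n)) < ennreal (1 / K) * e"
        using commute[of "g (k n)" "b (k n)"] less_trans[OF b(2)[of "k n"]] elim by simp
      ultimately show ?case using elim f(1) close_trans[of "g (k n)" "b (k n)" f e] by simp
    qed
  qed simp
  ultimately show "\<exists>f\<in>T closure_of B. \<exists>k::nat \<Rightarrow> nat. strict_mono k \<and> (\<lambda>n. N (g (k n) - f)) \<longlonglongrightarrow> 0"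
    using f(2) by blast
qed

end

section \<open>The short-time Fourier transform and the Fock space\<close>

text \<open>The minus sign arises because the pairing conjugates the Hermite coefficients of the
  window.\<close>

definition phase_to_complex :: "(real ^ 'd) \<times> (real ^ 'd) \<Rightarrow> 'd \<Rightarrow> complex" where
  "phase_to_complex X i = (of_real (fst X $ i) - \<i> * of_real (snd X $ i)) / of_real (sqrt 2)"

text \<open>
  The Taylor coefficients in the Bargmann transform, in the variable \<open>phase_to_complex X\<close>.
\<close>

definition fock_coeffs :: "'d::finite hermite_series \<Rightarrow> 'd hermite_series" where
  "fock_coeffs f \<alpha> = f \<alpha> / of_real (sqrt (\<Prod>i\<in>UNIV. fact (\<alpha> i)))"

text \<open>Its modulus is (2 pi)^(- d / 2) exp (- |X|^2 / 4), and |X|^2 / 4 = |z|^2 / 2 for z =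
  \<open>phase_to_complex X\<close>.\<close>

definition stft_factor :: "(real ^ 'd::finite) \<times> (real ^ 'd) \<Rightarrow> complex" where
  "stft_factor X = of_real ((2 * pi) powr (- real CARD('d) / 2)) *
     cnj (exp (\<Sum>i\<in>UNIV. - of_real ((fst X $ i)\<^sup>2) / 2 + (of_real (fst X $ i) + \<i> * of_real (snd X $ i))\<^sup>2 / 4))"

lemma Hflat_dual_iff: "f \<in> Hflat_dual \<longleftrightarrow> entire_coeffs (fock_coeffs f)"
proof -
  have "cmod (fock_coeffs f \<alpha>) \<le> C * r ^ (\<Sum>i\<in>UNIV. \<alpha> i) \<longleftrightarrow>
      cmod (f \<alpha>) \<le> C * r ^ (\<Sum>i\<in>UNIV. \<alpha> i) * sqrt (\<Prod>i\<in>UNIV. fact (\<alpha> i))" for C r \<alpha>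
  proof -
    have "0 < sqrt (\<Prod>i\<in>UNIV. fact (\<alpha> i))" by (simp add: prod_pos)
    then show ?thesis by (simp add: fock_coeffs_def norm_divide pos_divide_le_eq)
  qed
  then show ?thesis by (simp add: Hflat_dual_def entire_coeffs_def)
qed

lemma fock_coeffs_diff: "fock_coeffs (f - g) = (\<lambda>\<alpha>. fock_coeffs f \<alpha> - fock_coeffs g \<alpha>)"
  by (simp add: fock_coeffs_def fun_eq_iff diff_divide_distrib)

lemma Hflat_dual_diff: "f \<in> Hflat_dual \<Longrightarrow> g \<in> Hflat_dual \<Longrightarrow> f - g \<in> Hflat_dual"
  by (simp add: Hflat_dual_iff fock_coeffs_diff entire_coeffs_diff)

lemma stft_eq: "stft f X = stft_factor X * entire_fun (fock_coeffs f) (phase_to_complex X)"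
proof -
  obtain x \<xi> where X: "X = (x, \<xi>)" by (cases X)
  define w where "w i = of_real (x $ i) + \<i> * of_real (\<xi> $ i)" for i
  define E where "E = exp (\<Sum>i\<in>UNIV. - of_real ((x $ i)\<^sup>2) / 2 + (w i)\<^sup>2 / 4)"
  have "f \<alpha> * cnj (hermite_coeffs (\<lambda>y. exp (\<i> * of_real (y \<bullet> \<xi>)) * of_real (gauss_window (y - x))) \<alpha>) =
      cnj E * (fock_coeffs f \<alpha> * monomial (phase_to_complex X) \<alpha>)" for \<alpha>
  proof -
    have "(\<Prod>i\<in>UNIV. complex_of_real (sqrt (fact (\<alpha> i)))) = of_real (sqrt (\<Prod>i\<in>UNIV. fact (\<alpha> i)))"
    proof -
      have "sqrt (\<Prod>i\<in>A. fact (\<alpha> i)) = (\<Prod>i\<in>A. sqrt (fact (\<alpha> i)))" for A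
        by (induction A rule: infinite_finite_induct) (auto simp: real_sqrt_mult)
      then show ?thesis by simp
    qed
    moreover have "phase_to_complex X i = cnj (w i) / of_real (sqrt 2)" for i
      by (simp add: w_def phase_to_complex_def X)
    ultimately show ?thesis
      unfolding hermite_coeffs_window w_def[symmetric] E_def[symmetric]
      by (simp add: fock_coeffs_def monomial_def prod_dividef cnj_prod)
  qed
  then have "hermite_pairing f (hermite_coeffs (\<lambda>y. exp (\<i> * of_real (y \<bullet> \<xi>)) * of_real (gauss_window (y - x)))) =
      cnj E * entire_fun (fock_coeffs f) (phase_to_complex X)"
    by (simp add: hermite_pairing_def entire_fun_def infsum_cmult_right')
  then show ?thesis by (simp add: stft_def stft_factor_def X E_def w_def)
qed

lemma norm_stft_factor:
  "cmod (stft_factor (X :: (real ^ 'd::finite) \<times> (real ^ 'd))) = (2 * pi) powr (- real CARD('d) / 2) * exp (- (norm X)\<^sup>2 / 4)"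
proof -
  have "(norm X)\<^sup>2 = (norm (fst X))\<^sup>2 + (norm (snd X))\<^sup>2" by (simp add: norm_prod_def)
  also have "(norm (fst X))\<^sup>2 = (\<Sum>i\<in>UNIV. (fst X $ i)\<^sup>2)"
    by (simp only: power2_norm_eq_inner inner_vec_def) (simp add: power2_eq_square)
  also have "(norm (snd X))\<^sup>2 = (\<Sum>i\<in>UNIV. (snd X $ i)\<^sup>2)"
    by (simp only: power2_norm_eq_inner inner_vec_def) (simp add: power2_eq_square)
  finally have n: "- (norm X)\<^sup>2 / 4 = (\<Sum>i\<in>UNIV. - ((fst X $ i)\<^sup>2) / 4 - ((snd X $ i)\<^sup>2) / 4)"
    by (simp add: sum_subtractf sum_negf sum_divide_distrib[symmetric])
  have "Re (- of_real ((fst X $ i)\<^sup>2) / 2 + (of_real (fst X $ i) + \<i> * of_real (snd X $ i))\<^sup>2 / 4) = - ((fst X $ i)\<^sup>2) / 4 - ((snd X $ i)\<^sup>2) / 4" for i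
    by (simp add: power2_eq_square field_simps)
  then show ?thesis
    by (simp only: stft_factor_def norm_mult complex_mod_cnj norm_exp_eq_Re Re_sum n norm_of_real) simp
qed

lemma norm_stft:
  "cmod (stft f (X :: (real ^ 'd::finite) \<times> (real ^ 'd))) = (2 * pi) powr (- real CARD('d) / 2) * exp (- (norm X)\<^sup>2 / 4) * cmod (entire_fun (fock_coeffs f) (phase_to_complex X))"
  by (simp add: stft_eq norm_mult norm_stft_factor)

lemma stft_diff:
  assumes "f \<in> Hflat_dual" "g \<in> Hflat_dual"
  shows "stft (f - g) X = stft f X - stft g X"
  using assms by (simp add: stft_eq Hflat_dual_iff fock_coeffs_diff entire_fun_diff right_diff_distrib)

lemma continuous_on_fock_fun:
  assumes "f \<in> Hflat_dual"
  shows "continuous_on UNIV (\<lambda>X::(real ^ 'd::finite) \<times> (real ^ 'd). entire_fun (fock_coeffs f) (phase_to_complex X))"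
  unfolding phase_to_complex_def[abs_def]
  by (rule continuous_on_entire_fun) (use assms in \<open>auto simp: Hflat_dual_iff intro!: continuous_intros\<close>)

lemma continuous_on_norm_stft:
  assumes "f \<in> Hflat_dual"
  shows "continuous_on UNIV (\<lambda>X. cmod (stft f X))"
  unfolding norm_stft by (intro continuous_intros continuous_on_fock_fun assms) auto

lemma phase_to_complex_rotation: "phase_to_complex (phase_rotation t W) i = exp (- \<i> * of_real t) * phase_to_complex W i"
  by (simp add: phase_to_complex_def phase_rotation_def exp_Euler cis_conv_exp[symmetric] complex_eq_iff add_divide_distrib diff_divide_distrib
      flip: exp_minus) (simp add: exp_eq_polar complex_eq_iff cis.sel field_simps)

lemma phase_to_complex_add: "phase_to_complex (X + Y) i = phase_to_complex X i + phase_to_complex Y i"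
  by (simp add: phase_to_complex_def add_divide_distrib[symmetric] diff_divide_distrib[symmetric] algebra_simps)

text \<open>Lets a Gaussian be recentred: the cross term of |X - Y|^2 / 4 is the real part of an
  expression complex linear in the coordinate of X.\<close>

lemma sum_phase_to_complex_cnj: "Re (\<Sum>i\<in>UNIV. phase_to_complex X i * cnj (phase_to_complex Y i)) = (X \<bullet> Y) / 2" for X Y :: "(real ^ 'd::finite) \<times> (real ^ 'd)"
proof -
  have "Re (phase_to_complex X i * cnj (phase_to_complex Y i)) = (fst X $ i * fst Y $ i + snd X $ i * snd Y $ i) / 2" for i
    by (simp add: phase_to_complex_def field_simps)
  then show ?thesis
    by (simp add: inner_prod_def inner_vec_def sum.distrib add_divide_distrib sum_divide_distrib)
qed

text \<open>The modulus of the transform carries a Gaussian factor, but after multiplication by exp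
  (|X - X0|^2 / 4) only the modulus of an entire function remains: the quadratic terms cancel and
  the cross term is absorbed into a holomorphic exponential. On the unit ball about X0 the
  multiplier is at most exp (1 / 4).\<close>

lemma stft_submean:
  fixes X0 :: "(real ^ 'd::finite) \<times> (real ^ 'd)"
  assumes f: "f \<in> Hflat_dual"
  defines "v \<equiv> \<lambda>X. cmod (stft f X) * exp ((norm (X - X0))\<^sup>2 / 4)"
  shows "emeasure lborel (ball X d) * ennreal (v X) \<le> (\<integral>\<^sup>+Y\<in>ball X d. ennreal (v Y) \<partial>lborel)"
proof (rule submean_ball)
  show "continuous_on UNIV v"
    unfolding v_def by (rule continuous_on_mult[OF continuous_on_norm_stft[OF f]]) (auto intro!: continuous_intros)
  define c where "c = (2 * pi) powr (- real CARD('d) / 2) * exp ((norm X0)\<^sup>2 / 4)"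
  have c: "c \<ge> 0" by (simp add: c_def)
  let ?H = "\<lambda>z. entire_fun (fock_coeffs f) z * exp (- (\<Sum>i\<in>UNIV. z i * cnj (phase_to_complex X0 i)))"
  have vH: "v Y = c * cmod (?H (phase_to_complex Y))" for Y
  proof -
    have "(norm (Y - X0))\<^sup>2 = (norm Y)\<^sup>2 - 2 * (Y \<bullet> X0) + (norm X0)\<^sup>2"
      by (simp only: power2_norm_eq_inner inner_diff_left inner_diff_right) (simp add: inner_commute)
    then have "exp (- (norm Y)\<^sup>2 / 4) * exp ((norm (Y - X0))\<^sup>2 / 4) = exp ((norm X0)\<^sup>2 / 4) * exp (- ((Y \<bullet> X0) / 2))"
      by (simp add: exp_add[symmetric] field_simps)
    then show ?thesis
    proof -
      assume e: "exp (- (norm Y)\<^sup>2 / 4) * exp ((norm (Y - X0))\<^sup>2 / 4) = exp ((norm X0)\<^sup>2 / 4) * exp (- ((Y \<bullet> X0) / 2))"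
      have H: "cmod (exp (- (\<Sum>i\<in>UNIV. phase_to_complex Y i * cnj (phase_to_complex X0 i)))) = exp (- ((Y \<bullet> X0) / 2))"
        by (simp only: norm_exp_eq_Re uminus_complex.sel sum_phase_to_complex_cnj)
      have "v Y = (2 * pi) powr (- real CARD('d) / 2) * (exp (- (norm Y)\<^sup>2 / 4) * exp ((norm (Y - X0))\<^sup>2 / 4)) * cmod (entire_fun (fock_coeffs f) (phase_to_complex Y))"
        by (simp add: v_def norm_stft)
      then show ?thesis by (simp only: e c_def norm_mult H mult_ac)
    qed
  qed
  fix X W :: "(real ^ 'd) \<times> (real ^ 'd)"
  \<comment> \<open>The restriction to the complex line through X in direction W. Rotating W by - 2
    pi t multiplies its coordinate by exp (2 pi i t), so the mean over the unit circle is the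
    rotation mean.\<close>
  define h where "h \<zeta> = ?H (\<lambda>i. phase_to_complex X i + \<zeta> * phase_to_complex W i)" for \<zeta>
  have "h holomorphic_on UNIV"
    unfolding h_def using f
    by (intro holomorphic_intros holomorphic_entire_fun_line) (auto simp: Hflat_dual_iff)
  from holomorphic_mean_value[OF this]
  have "ennreal c * ennreal (cmod (h 0)) \<le> ennreal c * (\<integral>\<^sup>+t\<in>{0..1}. ennreal (cmod (h (exp (2 * of_real pi * \<i> * of_real t)))) \<partial>lborel)"
    by (rule mult_left_mono) simp
  also have "\<dots> = (\<integral>\<^sup>+t\<in>{0..1}. ennreal (v (X + phase_rotation (- (2 * pi * t)) W)) \<partial>lborel)"
  proof -
    have "continuous_on UNIV h" using \<open>h holomorphic_on UNIV\<close> by (rule holomorphic_on_imp_continuous_on)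
    then have "continuous_on UNIV (\<lambda>t::real. cmod (h (exp (2 * of_real pi * \<i> * of_real t))))"
      by (intro continuous_intros continuous_on_compose2[where f="\<lambda>t. exp (2 * of_real pi * \<i> * of_real t)"]) auto
    then have [measurable]: "(\<lambda>t::real. cmod (h (exp (2 * of_real pi * \<i> * of_real t)))) \<in> borel_measurable borel"
      by (rule borel_measurable_continuous_onI)
    have "v (X + phase_rotation (- (2 * pi * t)) W) = c * cmod (h (exp (2 * of_real pi * \<i> * of_real t)))" for t
      by (simp add: vH h_def phase_to_complex_add[abs_def] phase_to_complex_rotation mult_ac)
    then have "(\<integral>\<^sup>+t\<in>{0..1}. ennreal (v (X + phase_rotation (- (2 * pi * t)) W)) \<partial>lborel) =
        (\<integral>\<^sup>+t. ennreal c * (ennreal (cmod (h (exp (2 * of_real pi * \<i> * of_real t)))) * indicator {0..1} t) \<partial>lborel)"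
      using c by (simp only: ennreal_mult' mult.assoc)
    also have "\<dots> = ennreal c * (\<integral>\<^sup>+t\<in>{0..1}. ennreal (cmod (h (exp (2 * of_real pi * \<i> * of_real t)))) \<partial>lborel)"
      by (rule nn_integral_cmult) measurable
    finally show ?thesis by simp
  qed
  finally show "ennreal (v X) \<le> (\<integral>\<^sup>+t\<in>{0..1}. ennreal (v (X + phase_rotation (- (2 * pi * t)) W)) \<partial>lborel)"
    using c by (simp add: vH h_def ennreal_mult')
qed

definition weighted_norm :: "(real \<Rightarrow> ennreal) \<Rightarrow> (real \<Rightarrow> ennreal) \<Rightarrow> ((real ^ 'd::finite) \<times> (real ^ 'd) \<Rightarrow> real) \<Rightarrow> 'd hermite_series \<Rightarrow> ennreal" where
  "weighted_norm \<Phi> \<Psi> w f = mixed_norm \<Phi> \<Psi> (\<lambda>X. ennreal (cmod (stft f X) * w X))"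

lemma modulation_norm_eq: "(\<And>X. 0 < w X) \<Longrightarrow> modulation_norm \<Phi> \<Psi> w f = weighted_norm \<Phi> \<Psi> w f"
  by (simp add: modulation_norm_def mixed_orlicz_norm_def weighted_norm_def mixed_norm_def norm_mult less_imp_le)

lemma measurable_stft_weight:
  assumes "regular_weight w" "f \<in> Hflat_dual"
  shows "(\<lambda>X. cmod (stft f X) * w X) \<in> borel_measurable borel"
  using assms by (intro borel_measurable_continuous_onI continuous_intros continuous_on_norm_stft) (auto simp: regular_weight_def)

text \<open>At every point X0 the sub-mean value property for p-th powers is applied to the
  transform recentred there; the unit ball lies in a product of unit balls, over which the mixed
  norm controls p-th powers. All constants are independent of X0 because the recentring and the
  variation of w are translation invariant.\<close>

lemma stft_pointwise_bound:
  fixes w :: "(real ^ 'd::finite) \<times> (real ^ 'd) \<Rightarrow> real"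
  assumes \<Phi>: "quasi_young \<Phi>" and \<Psi>: "quasi_young \<Psi>" and w: "regular_weight w"
  obtains K where "K > 0" "\<And>f X. f \<in> Hflat_dual \<Longrightarrow> ennreal (cmod (stft f X) * w X) \<le> ennreal K * weighted_norm \<Phi> \<Psi> w f"
proof -
  obtain p C where p: "0 < p" "p \<le> 1" "C > 0"
    "\<And>u x0 (\<xi>0::real ^ 'd) L. u \<in> borel_measurable borel \<Longrightarrow> (\<And>X. 0 \<le> u X) \<Longrightarrow>
      mixed_norm \<Phi> \<Psi> (\<lambda>X. ennreal (u X)) < ennreal L \<Longrightarrow>
      (\<integral>\<^sup>+X\<in>cball x0 1 \<times> cball \<xi>0 1. ennreal (u X powr p) \<partial>lborel) \<le> ennreal (C * L powr p)"
    using mixed_norm_nn_integral_powr[OF \<Phi> \<Psi>, where 'a="real ^ 'd"] by blast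
  obtain D where D: "D > 0"
    "\<And>u (z0 :: (real ^ 'd) \<times> (real ^ 'd)). continuous_on UNIV u \<Longrightarrow> (\<And>x. 0 \<le> u x) \<Longrightarrow>
      (\<And>z d. 0 < d \<Longrightarrow> emeasure lborel (ball z d) * ennreal (u z) \<le> (\<integral>\<^sup>+x\<in>ball z d. ennreal (u x) \<partial>lborel)) \<Longrightarrow>
      ennreal (u z0 powr p) \<le> ennreal D * (\<integral>\<^sup>+x\<in>ball z0 1. ennreal (u x powr p) \<partial>lborel)"
    using submean_powr[OF p(1,2), where 'a="(real ^ 'd) \<times> (real ^ 'd)"] by blast
  obtain r where r: "r \<ge> 0" "\<And>x y. w x \<le> exp (r * norm (x - y)) * w y" 
    using w unfolding regular_weight_def by blast
  have wpos: "0 < w X" for X by (rule regular_weight_pos[OF w])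
  define K where "K = (D * C) powr (1 / p) * exp (1 / 4 + r)"
  have K: "K > 0" using D p by (simp add: K_def)
  have "ennreal (cmod (stft f X0) * w X0) \<le> ennreal K * weighted_norm \<Phi> \<Psi> w f" if f: "f \<in> Hflat_dual" for f X0
    unfolding weighted_norm_def
  proof (rule ennreal_le_cmult_dense[OF K])
    fix L :: real assume L: "0 < L" "mixed_norm \<Phi> \<Psi> (\<lambda>X. ennreal (cmod (stft f X) * w X)) < ennreal L"
    define v where "v X = cmod (stft f X) * exp ((norm (X - X0))\<^sup>2 / 4)" for X
    define u where "u X = cmod (stft f X) * w X" for X
    \<comment> \<open>On the unit ball about X0 the recentred Gaussian costs at most exp (1 / 4) and
      replacing w X0 by w X costs at most exp r.\<close>
    define A where "A = exp (1 / 4 + r) / w X0"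
    have A: "A > 0" using wpos by (simp add: A_def)
    have u0: "0 \<le> u X" for X using wpos[of X] by (simp add: u_def)
    have um[measurable]: "u \<in> borel_measurable borel"
      unfolding u_def[abs_def] by (rule measurable_stft_weight[OF w f])
    have vu: "v X \<le> A * u X" if X: "X \<in> ball X0 1" for X
    proof -
      have n: "norm (X - X0) \<le> 1" using X by (simp add: dist_norm norm_minus_commute)
      then have "(norm (X - X0))\<^sup>2 \<le> 1" by (simp add: power_le_one)
      then have e1: "exp ((norm (X - X0))\<^sup>2 / 4) \<le> exp (1 / 4)" by simp
      have "w X0 \<le> exp (r * norm (X0 - X)) * w X" by (rule r)
      also have "\<dots> \<le> exp r * w X"
        using n r(1) wpos[of X] by (intro mult_right_mono) (auto simp: norm_minus_commute mult_left_le)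
      finally have e2: "1 \<le> exp r * w X / w X0" using wpos[of X0] by simp
      have "v X \<le> cmod (stft f X) * exp (1 / 4)" unfolding v_def by (intro mult_left_mono e1) auto
      also have "\<dots> \<le> cmod (stft f X) * exp (1 / 4) * (exp r * w X / w X0)"
        using mult_left_mono[OF e2, of "cmod (stft f X) * exp (1 / 4)"] by simp
      also have "\<dots> = A * u X" by (simp add: A_def u_def exp_add)
      finally show ?thesis .
    qed
    have v0: "0 \<le> v X" for X by (simp add: v_def)
    have "ennreal (v X0 powr p) \<le> ennreal D * (\<integral>\<^sup>+X\<in>ball X0 1. ennreal (v X powr p) \<partial>lborel)"
    proof (rule D(2))
      show "continuous_on UNIV v"
        unfolding v_def by (rule continuous_on_mult[OF continuous_on_norm_stft[OF f]]) (auto intro!: continuous_intros)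
    qed (use v0 stft_submean[OF f, of _ _ X0] in \<open>auto simp: v_def\<close>)
    also have "(\<integral>\<^sup>+X\<in>ball X0 1. ennreal (v X powr p) \<partial>lborel) \<le>
        (\<integral>\<^sup>+X. ennreal (A powr p) * (ennreal (u X powr p) * indicator (cball (fst X0) 1 \<times> cball (snd X0) 1) X) \<partial>lborel)"
    proof (rule nn_integral_mono)
      fix X
      show "ennreal (v X powr p) * indicator (ball X0 1) X \<le>
          ennreal (A powr p) * (ennreal (u X powr p) * indicator (cball (fst X0) 1 \<times> cball (snd X0) 1) X)"
      proof (cases "X \<in> ball X0 1")
        case True
        have "dist (fst X0) (fst X) \<le> dist X0 X" "dist (snd X0) (snd X) \<le> dist X0 X"
          by (simp_all add: dist_fst_le dist_snd_le)
        then have "X \<in> cball (fst X0) 1 \<times> cball (snd X0) 1"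
          using True by (cases X) auto
        moreover have "v X powr p \<le> A powr p * u X powr p"
          using vu[OF True] v0[of X] A u0[of X] p by (subst powr_mult[symmetric]) (auto intro: powr_mono2)
        ultimately show ?thesis using True
          by (simp add: ennreal_mult'[symmetric] ennreal_leI)
      qed simp
    qed
    also have "\<dots> = ennreal (A powr p) * (\<integral>\<^sup>+X\<in>cball (fst X0) 1 \<times> cball (snd X0) 1. ennreal (u X powr p) \<partial>lborel)"
    proof -
      have [measurable]: "cball (fst X0) 1 \<times> cball (snd X0) 1 \<in> sets borel"
        by (intro borel_closed closed_Times) auto
      show ?thesis by (rule nn_integral_cmult) measurable
    qed
    also have "\<dots> \<le> ennreal (A powr p) * ennreal (C * L powr p)"
      using p(4)[OF um u0] L(2) by (intro mult_left_mono) (auto simp: u_def)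
    finally have "ennreal (v X0 powr p) \<le> ennreal D * (ennreal (A powr p) * ennreal (C * L powr p))"
      by (simp add: mult_left_mono)
    also have "\<dots> = ennreal (D * C * (A powr p * L powr p))"
      using D p by (simp add: ennreal_mult'[symmetric] mult_ac)
    finally have "v X0 powr p \<le> D * C * (A powr p * L powr p)"
      using D p by (subst (asm) ennreal_le_iff) auto
    then have "(v X0 powr p) powr (1 / p) \<le> (D * C * (A powr p * L powr p)) powr (1 / p)"
      using p by (intro powr_mono2) auto
    also have "\<dots> = (D * C) powr (1 / p) * (A * L)"
      using D p A L by (simp add: powr_mult powr_powr)
    also have "(v X0 powr p) powr (1 / p) = cmod (stft f X0)"
      using p by (simp add: powr_powr v_def)
    finally have "cmod (stft f X0) * w X0 \<le> (D * C) powr (1 / p) * (A * L) * w X0"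
      using wpos[of X0] by (intro mult_right_mono) auto
    also have "\<dots> = K * L" using wpos[of X0] by (simp add: K_def A_def)
    finally show "ennreal (cmod (stft f X0) * w X0) \<le> ennreal K * ennreal L"
      using K L by (simp add: ennreal_mult'[symmetric] ennreal_leI)
  qed
  with K show ?thesis by (rule that)
qed

section \<open>Gaussians in mixed Orlicz spaces\<close>

lemma gaussian_nn_integral_finite:
  assumes "s > 0"
  shows "(\<integral>\<^sup>+x. ennreal (exp (- (s * (norm (x::'a::euclidean_space))\<^sup>2))) \<partial>lborel) < \<infinity>"
proof -
  have "integrable lborel (\<lambda>t. exp (- (0 + sqrt (2 * s) * t)\<^sup>2 / 2))"
    by (rule lborel_integrable_real_affine[OF integrable_half_gaussian]) (use assms in simp)
  then have int: "integrable lborel (\<lambda>t::real. exp (- (s * t\<^sup>2)))"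
    using assms by (simp add: power_mult_distrib)
  have "(\<integral>\<^sup>+x. ennreal (exp (- (s * (norm (x::'a))\<^sup>2))) \<partial>lborel) = (\<integral>\<^sup>+x. (\<Prod>b\<in>Basis. ennreal (exp (- (s * ((x::'a) \<bullet> b)\<^sup>2)))) \<partial>lborel)"
  proof (intro nn_integral_cong)
    fix x :: 'a
    have "(norm x)\<^sup>2 = (\<Sum>b\<in>Basis. (x \<bullet> b)\<^sup>2)"
      by (simp only: power2_norm_eq_inner) (subst euclidean_inner, simp add: power2_eq_square)
    then have "exp (- (s * (norm x)\<^sup>2)) = (\<Prod>b\<in>Basis. exp (- (s * (x \<bullet> b)\<^sup>2)))"
      by (simp add: exp_sum[symmetric] sum_negf sum_distrib_left)
    then show "ennreal (exp (- (s * (norm x)\<^sup>2))) = (\<Prod>b\<in>Basis. ennreal (exp (- (s * (x \<bullet> b)\<^sup>2))))"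
      by (simp add: prod_ennreal)
  qed
  also have "\<dots> = (\<Prod>b\<in>(Basis::'a set). (\<integral>\<^sup>+t. ennreal (exp (- (s * t\<^sup>2))) \<partial>lborel))"
    by (rule nn_integral_lborel_prod) auto
  also have "\<dots> < \<infinity>"
    using int by (simp add: nn_integral_eq_integral power_less_top_ennreal)
  finally show ?thesis .
qed

text \<open>Translation invariance makes K independent of the centre. The rate 1/8 is half that of a
  Gaussian's transform; the other half absorbs the exponential growth of a weight.\<close>

lemma orlicz_norm_gaussian:
  fixes \<Phi> :: "real \<Rightarrow> ennreal"
  assumes "quasi_young \<Phi>" "t > 0" "\<Phi> t < \<infinity>"
  obtains K where "K > 0" "\<And>a::'a::euclidean_space. orlicz_norm \<Phi> (\<lambda>x. ennreal (exp (- (norm (x - a))\<^sup>2 / 8))) \<le> ennreal K"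
proof -
  obtain r where r: "0 < r" "r \<le> 1"
    "\<And>I. \<exists>K. \<forall>h::'a \<Rightarrow> real. h \<in> borel_measurable borel \<longrightarrow> (\<forall>x. 0 \<le> h x \<and> h x \<le> 1) \<longrightarrow>
      (\<integral>\<^sup>+x. ennreal (h x powr r) \<partial>lborel) \<le> ennreal I \<longrightarrow> orlicz_norm \<Phi> (\<lambda>x. ennreal (h x)) \<le> ennreal K"
    using orlicz_norm_bounded[OF assms, where 'a='a] by blast
  obtain I where I: "(\<integral>\<^sup>+x. ennreal (exp (- (r / 8 * (norm (x::'a))\<^sup>2))) \<partial>lborel) = ennreal I"
    using gaussian_nn_integral_finite[of "r / 8", where 'a='a] r(1) by (metis ennreal_cases less_irrefl infinity_ennreal_def zero_less_divide_iff zero_less_numeral)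
  obtain K where K: "\<And>h::'a \<Rightarrow> real. h \<in> borel_measurable borel \<Longrightarrow> (\<forall>x. 0 \<le> h x \<and> h x \<le> 1) \<Longrightarrow>
      (\<integral>\<^sup>+x. ennreal (h x powr r) \<partial>lborel) \<le> ennreal I \<Longrightarrow> orlicz_norm \<Phi> (\<lambda>x. ennreal (h x)) \<le> ennreal K"
    using r(3)[of I] by blast
  have "orlicz_norm \<Phi> (\<lambda>x. ennreal (exp (- (norm (x - a))\<^sup>2 / 8))) \<le> ennreal (max K 1)" for a :: 'a
  proof -
    have "(\<integral>\<^sup>+x. ennreal (exp (- (norm (x - a))\<^sup>2 / 8) powr r) \<partial>lborel) = (\<integral>\<^sup>+x. (\<lambda>x. ennreal (exp (- (r / 8 * (norm x)\<^sup>2)))) (- a + x) \<partial>lborel)"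
      by (intro nn_integral_cong) (simp add: powr_def mult.commute)
    also have "\<dots> = ennreal I" unfolding I[symmetric] by (rule nn_integral_lborel_translate) simp
    finally have "orlicz_norm \<Phi> (\<lambda>x. ennreal (exp (- (norm (x - a))\<^sup>2 / 8))) \<le> ennreal K"
      by (intro K) auto
    also have "\<dots> \<le> ennreal (max K 1)" by (intro ennreal_leI) auto
    finally show ?thesis .
  qed
  then show ?thesis by (intro that[of "max K 1"]) auto
qed

text \<open>A Gaussian on the product space is a tensor product, so its mixed norm is at most the
  product of the two one-variable bounds.\<close>

lemma mixed_norm_gaussian:
  assumes \<Phi>: "quasi_young \<Phi>" "t > 0" "\<Phi> t < \<infinity>" and \<Psi>: "quasi_young \<Psi>" "s > 0" "\<Psi> s < \<infinity>"
  obtains K where "K > 0" "\<And>Y::'a::euclidean_space \<times> 'a. mixed_norm \<Phi> \<Psi> (\<lambda>X. ennreal (exp (- (norm (X - Y))\<^sup>2 / 8))) \<le> ennreal K"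
proof -
  obtain K where K: "K > 0" "\<And>a::'a. orlicz_norm \<Phi> (\<lambda>x. ennreal (exp (- (norm (x - a))\<^sup>2 / 8))) \<le> ennreal K"
    using orlicz_norm_gaussian[OF \<Phi>, where 'a='a] by blast
  obtain L where L: "L > 0" "\<And>a::'a. orlicz_norm \<Psi> (\<lambda>x. ennreal (exp (- (norm (x - a))\<^sup>2 / 8))) \<le> ennreal L"
    using orlicz_norm_gaussian[OF \<Psi>, where 'a='a] by blast
  have "mixed_norm \<Phi> \<Psi> (\<lambda>X. ennreal (exp (- (norm (X - Y))\<^sup>2 / 8))) \<le> ennreal (K * L)" for Y :: "'a \<times> 'a"
  proof -
    let ?e = "\<lambda>b y::'a. exp (- (norm (y - b))\<^sup>2 / 8)"
    have split: "exp (- (norm ((x, y) - Y))\<^sup>2 / 8) = ?e (snd Y) y * ?e (fst Y) x" for x y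
      by (cases Y) (simp add: norm_Pair exp_add[symmetric] add_divide_distrib)
    have "mixed_norm \<Phi> \<Psi> (\<lambda>X. ennreal (exp (- (norm (X - Y))\<^sup>2 / 8))) =
        orlicz_norm \<Psi> (\<lambda>y. orlicz_norm \<Phi> (\<lambda>x. ennreal (?e (snd Y) y) * ennreal (?e (fst Y) x)))"
      unfolding mixed_norm_def split by (simp add: ennreal_mult')
    also have "\<dots> \<le> orlicz_norm \<Psi> (\<lambda>y. ennreal K * ennreal (?e (snd Y) y))"
    proof (rule orlicz_norm_mono[OF \<Psi>(1)])
      fix y
      have "orlicz_norm \<Phi> (\<lambda>x. ennreal (?e (snd Y) y) * ennreal (?e (fst Y) x)) \<le> ennreal (?e (snd Y) y) * orlicz_norm \<Phi> (\<lambda>x. ennreal (?e (fst Y) x))"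
        by (rule orlicz_norm_cmult_le[OF \<Phi>(1)]) simp
      also have "\<dots> \<le> ennreal (?e (snd Y) y) * ennreal K" by (intro mult_left_mono K) auto
      finally show "orlicz_norm \<Phi> (\<lambda>x. ennreal (?e (snd Y) y) * ennreal (?e (fst Y) x)) \<le> ennreal K * ennreal (?e (snd Y) y)"
        by (simp add: mult.commute)
    qed
    also have "\<dots> \<le> ennreal K * orlicz_norm \<Psi> (\<lambda>y. ennreal (?e (snd Y) y))"
      by (rule orlicz_norm_cmult_le[OF \<Psi>(1) K(1)])
    also have "\<dots> \<le> ennreal K * ennreal L" by (intro mult_left_mono L) auto
    finally show ?thesis using K by (simp add: ennreal_mult')
  qed
  moreover have "K * L > 0" using K L by simp
  ultimately show ?thesis by (intro that[of "K * L"]) auto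
qed

section \<open>Bounded sequences in modulation spaces\<close>

lemma weighted_norm_mono:
  assumes "quasi_young \<Phi>" "quasi_young \<Psi>" "0 < C" "\<And>X. w X \<le> C * w' X"
  shows "weighted_norm \<Phi> \<Psi> w f \<le> ennreal C * weighted_norm \<Phi> \<Psi> w' f"
  unfolding weighted_norm_def
proof (rule mixed_norm_le_cmult[OF assms(1-3)])
  fix X
  have "cmod (stft f X) * w X \<le> C * (cmod (stft f X) * w' X)"
    using mult_left_mono[OF assms(4), of "cmod (stft f X)" X] by (simp add: mult_ac)
  then show "ennreal (cmod (stft f X) * w X) \<le> ennreal C * ennreal (cmod (stft f X) * w' X)"
    using assms(3) by (simp add: ennreal_mult'[symmetric] ennreal_leI)
qed

lemma orlicz_norm_zero:
  assumes "quasi_young \<Phi>"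
  shows "orlicz_norm \<Phi> (\<lambda>x. 0) = 0"
proof -
  have "orlicz_norm \<Phi> (\<lambda>x. 0) \<le> 0 + ennreal e" if "e > 0" for e
    using orlicz_norm_le[OF that, of \<Phi> "\<lambda>x. 0"] assms by simp
  then have "orlicz_norm \<Phi> (\<lambda>x. 0) \<le> 0" by (rule ennreal_le_epsilon)
  then show ?thesis by simp
qed

lemma weighted_norm_diff_self:
  assumes "quasi_young \<Phi>" "quasi_young \<Psi>"
  shows "weighted_norm \<Phi> \<Psi> w (f - f) = 0"
proof -
  have "f - f = (\<lambda>\<alpha>. 0)" by (simp add: fun_eq_iff)
  then have "stft (f - f) X = 0" for X by (simp add: stft_eq fock_coeffs_def entire_fun_def)
  then show ?thesis by (simp add: weighted_norm_def mixed_norm_def orlicz_norm_zero assms)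
qed

text \<open>A sum is at most twice the larger summand, so the maximum estimate applies and K = 2
  \<kappa> works for all weights. The version with g in the middle gives the axioms of
  \<open>quasi_normed\<close>; the other bounds the difference of two members of a space.\<close>

lemma weighted_norm_triangle:
  fixes \<Phi> \<Psi> :: "real \<Rightarrow> ennreal"
  assumes \<Phi>: "quasi_young \<Phi>" and \<Psi>: "quasi_young \<Psi>"
  shows "\<exists>K\<ge>1. (\<forall>w. \<forall>f::'d::finite hermite_series. \<forall>g h. regular_weight w \<longrightarrow>
      f \<in> Hflat_dual \<longrightarrow> g \<in> Hflat_dual \<longrightarrow> h \<in> Hflat_dual \<longrightarrow>
      weighted_norm \<Phi> \<Psi> w (f - h) \<le> ennreal K * max (weighted_norm \<Phi> \<Psi> w (f - g)) (weighted_norm \<Phi> \<Psi> w (g - h))) \<and>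
    (\<forall>w. \<forall>f::'d hermite_series. \<forall>g. regular_weight w \<longrightarrow> f \<in> Hflat_dual \<longrightarrow> g \<in> Hflat_dual \<longrightarrow>
      weighted_norm \<Phi> \<Psi> w (f - g) \<le> ennreal K * max (weighted_norm \<Phi> \<Psi> w f) (weighted_norm \<Phi> \<Psi> w g))"
proof -
  obtain \<kappa> where \<kappa>: "\<kappa> \<ge> 1" "\<And>u v :: (real ^ 'd) \<times> (real ^ 'd) \<Rightarrow> ennreal.
    u \<in> borel_measurable borel \<Longrightarrow> v \<in> borel_measurable borel \<Longrightarrow>
    mixed_norm \<Phi> \<Psi> (\<lambda>X. max (u X) (v X)) \<le> ennreal \<kappa> * max (mixed_norm \<Phi> \<Psi> u) (mixed_norm \<Phi> \<Psi> v)"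
    using mixed_norm_max_le[OF \<Phi> \<Psi>, where 'a="real ^ 'd"] by blast
  have gen: "weighted_norm \<Phi> \<Psi> w a \<le> ennreal (2 * \<kappa>) * max (weighted_norm \<Phi> \<Psi> w b) (weighted_norm \<Phi> \<Psi> w c)"
    if w: "regular_weight w" and b: "b \<in> Hflat_dual" and c: "c \<in> Hflat_dual"
      and abc: "\<And>X. cmod (stft a X) \<le> cmod (stft b X) + cmod (stft c X)" for w a and b c :: "'d hermite_series"
  proof -
    let ?u = "\<lambda>X. ennreal (cmod (stft b X) * w X)" and ?v = "\<lambda>X. ennreal (cmod (stft c X) * w X)"
    have m: "?u \<in> borel_measurable borel" "?v \<in> borel_measurable borel"
      using measurable_stft_weight[OF w b] measurable_stft_weight[OF w c] by simp_all
    have "weighted_norm \<Phi> \<Psi> w a \<le> ennreal 2 * mixed_norm \<Phi> \<Psi> (\<lambda>X. max (?u X) (?v X))"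
      unfolding weighted_norm_def
    proof (rule mixed_norm_le_cmult[OF \<Phi> \<Psi>])
      fix X
      have wX: "0 \<le> w X" using regular_weight_pos[OF w, of X] by simp
      have "cmod (stft a X) * w X \<le> (cmod (stft b X) + cmod (stft c X)) * w X"
        using abc wX by (rule mult_right_mono)
      also have "\<dots> \<le> 2 * max (cmod (stft b X) * w X) (cmod (stft c X) * w X)"
        by (simp add: distrib_right)
      finally have "ennreal (cmod (stft a X) * w X) \<le> ennreal (2 * max (cmod (stft b X) * w X) (cmod (stft c X) * w X))"
        by (rule ennreal_leI)
      also have "\<dots> = ennreal 2 * ennreal (max (cmod (stft b X) * w X) (cmod (stft c X) * w X))"
        by (rule ennreal_mult') simp
      also have "ennreal (max (cmod (stft b X) * w X) (cmod (stft c X) * w X)) = max (?u X) (?v X)"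
        using wX by (simp add: max_def ennreal_le_iff)
      finally show "ennreal (cmod (stft a X) * w X) \<le> ennreal 2 * max (?u X) (?v X)" .
    qed simp
    also have "\<dots> \<le> ennreal 2 * (ennreal \<kappa> * max (mixed_norm \<Phi> \<Psi> ?u) (mixed_norm \<Phi> \<Psi> ?v))"
      by (intro mult_left_mono \<kappa>(2) m) simp
    also have "\<dots> = ennreal (2 * \<kappa>) * max (weighted_norm \<Phi> \<Psi> w b) (weighted_norm \<Phi> \<Psi> w c)"
      unfolding weighted_norm_def mult.assoc[symmetric] by (subst ennreal_mult'[symmetric]) simp_all
    finally show ?thesis .
  qed
  show ?thesis
  proof (intro exI[of _ "2 * \<kappa>"] conjI allI impI)
    show "1 \<le> 2 * \<kappa>" using \<kappa> by simp
  next
    fix w :: "(real ^ 'd) \<times> (real ^ 'd) \<Rightarrow> real" and f g h :: "'d hermite_series"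
    assume H: "regular_weight w" "f \<in> Hflat_dual" "g \<in> Hflat_dual" "h \<in> Hflat_dual"
    have "cmod (stft (f - h) X) \<le> cmod (stft (f - g) X) + cmod (stft (g - h) X)" for X
      using norm_triangle_ineq[of "stft (f - g) X" "stft (g - h) X"] H by (simp add: stft_diff)
    then show "weighted_norm \<Phi> \<Psi> w (f - h) \<le> ennreal (2 * \<kappa>) * max (weighted_norm \<Phi> \<Psi> w (f - g)) (weighted_norm \<Phi> \<Psi> w (g - h))"
      by (rule gen[OF H(1) Hflat_dual_diff[OF H(2,3)] Hflat_dual_diff[OF H(3,4)]])
  next
    fix w :: "(real ^ 'd) \<times> (real ^ 'd) \<Rightarrow> real" and f g :: "'d hermite_series"
    assume H: "regular_weight w" "f \<in> Hflat_dual" "g \<in> Hflat_dual"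
    have "cmod (stft (f - g) X) \<le> cmod (stft f X) + cmod (stft g X)" for X
      using H by (simp add: stft_diff norm_triangle_ineq4)
    then show "weighted_norm \<Phi> \<Psi> w (f - g) \<le> ennreal (2 * \<kappa>) * max (weighted_norm \<Phi> \<Psi> w f) (weighted_norm \<Phi> \<Psi> w g)"
      by (rule gen[OF H])
  qed
qed

lemma weighted_norm_commute:
  assumes "f \<in> Hflat_dual" "g \<in> Hflat_dual"
  shows "weighted_norm \<Phi> \<Psi> w (f - g) = weighted_norm \<Phi> \<Psi> w (g - f)"
  using assms by (simp add: weighted_norm_def stft_diff norm_minus_commute)

text \<open>Keeps the limit of a bounded sequence in the first space, although the convergence found
  there is only locally uniform.\<close>

lemma weighted_norm_liminf:
  assumes "quasi_young \<Phi>" "quasi_young \<Psi>" "regular_weight w" "\<And>n. g n \<in> Hflat_dual"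
    and lim: "\<And>X. (\<lambda>n. stft (g n) X) \<longlonglongrightarrow> stft f X"
  shows "weighted_norm \<Phi> \<Psi> w f \<le> liminf (\<lambda>n. weighted_norm \<Phi> \<Psi> w (g n))"
  unfolding weighted_norm_def
proof (rule mixed_norm_liminf[OF assms(1,2)])
  show "(\<lambda>X. ennreal (cmod (stft (g n) X) * w X)) \<in> borel_measurable borel" for n
    using measurable_stft_weight[OF assms(3) assms(4)[of n]] by simp
  show "ennreal (cmod (stft f X) * w X) \<le> liminf (\<lambda>n. ennreal (cmod (stft (g n) X) * w X))" for X
  proof -
    have "(\<lambda>n. ennreal (cmod (stft (g n) X) * w X)) \<longlonglongrightarrow> ennreal (cmod (stft f X) * w X)"
      by (intro tendsto_ennrealI tendsto_intros lim)
    then show ?thesis by (simp add: lim_imp_Liminf)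
  qed
qed

lemma norm_phase_to_complex_le: "cmod (phase_to_complex X i) \<le> norm X" for X :: "(real ^ 'd::finite) \<times> (real ^ 'd)"
proof -
  have "(cmod (phase_to_complex X i))\<^sup>2 = ((fst X $ i)\<^sup>2 + (snd X $ i)\<^sup>2) / 2"
    by (simp add: phase_to_complex_def cmod_power2 power_divide add_divide_distrib)
  also have "\<dots> \<le> ((norm (fst X))\<^sup>2 + (norm (snd X))\<^sup>2) / 2"
    using component_le_norm_cart[of "fst X" i] component_le_norm_cart[of "snd X" i]
    by (intro divide_right_mono add_mono) (auto intro: power2_le_imp_le simp: abs_le_square_iff[symmetric])
  also have "\<dots> \<le> (norm X)\<^sup>2" by (simp add: norm_prod_def)
  finally show ?thesis by (rule power2_le_imp_le) simp
qed

lemma phase_to_complex_surj: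
  fixes z :: "'d::finite \<Rightarrow> complex"
  assumes "\<And>i. cmod (z i) \<le> R"
  obtains X :: "(real ^ 'd) \<times> (real ^ 'd)" where "phase_to_complex X = z" "norm X \<le> 2 * real CARD('d) * sqrt 2 * R"
proof -
  define x :: "real ^ 'd" where "x = (\<chi> i. sqrt 2 * Re (z i))"
  define \<xi> :: "real ^ 'd" where "\<xi> = (\<chi> i. - (sqrt 2 * Im (z i)))"
  have "phase_to_complex (x, \<xi>) = z" by (simp add: fun_eq_iff phase_to_complex_def x_def \<xi>_def complex_eq_iff)
  moreover have "norm (x, \<xi>) \<le> 2 * real CARD('d) * sqrt 2 * R"
  proof -
    have xi: "\<bar>x $ i\<bar> \<le> sqrt 2 * R" "\<bar>\<xi> $ i\<bar> \<le> sqrt 2 * R" for i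
      using abs_Re_le_cmod[of "z i"] abs_Im_le_cmod[of "z i"] assms[of i]
      by (auto simp: x_def \<xi>_def abs_mult)
    have "norm x \<le> (\<Sum>i\<in>UNIV. \<bar>x $ i\<bar>)" "norm \<xi> \<le> (\<Sum>i\<in>UNIV. \<bar>\<xi> $ i\<bar>)"
      by (rule norm_le_l1_cart)+
    moreover have "(\<Sum>i\<in>UNIV. \<bar>x $ i\<bar>) \<le> (\<Sum>i\<in>(UNIV::'d set). sqrt 2 * R)" "(\<Sum>i\<in>UNIV. \<bar>\<xi> $ i\<bar>) \<le> (\<Sum>i\<in>(UNIV::'d set). sqrt 2 * R)"
      by (intro sum_mono xi)+
    moreover have "norm (x, \<xi>) \<le> norm x + norm \<xi>" by (rule norm_Pair_le)
    ultimately show ?thesis by simp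
  qed
  ultimately show ?thesis by (rule that)
qed

lemma regular_weight_bounds:
  assumes "regular_weight w"
  shows "\<exists>r\<ge>0. \<forall>X R. norm X \<le> R \<longrightarrow> w X \<le> w 0 * exp (r * R) \<and> w 0 * exp (- (r * R)) \<le> w X"
proof -
  obtain r where r: "r \<ge> 0" "\<And>x y. w x \<le> exp (r * norm (x - y)) * w y" 
    using assms unfolding regular_weight_def by blast
  have pos: "0 < w X" for X by (rule regular_weight_pos[OF assms])
  have 1: "w X \<le> w 0 * exp (r * R)" if "norm X \<le> R" for X R
  proof -
    have "w X \<le> exp (r * norm (X - 0)) * w 0" by (rule r)
    also have "\<dots> \<le> exp (r * R) * w 0" using r(1) pos[of 0] that by (intro mult_right_mono) (auto intro: mult_left_mono)
    finally show ?thesis by (simp add: mult.commute)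
  qed
  have 2: "w 0 * exp (- (r * R)) \<le> w X" if "norm X \<le> R" for X R
  proof -
    have "w 0 \<le> exp (r * norm (0 - X)) * w X" by (rule r)
    also have "\<dots> \<le> exp (r * R) * w X" using r(1) pos[of X] that by (intro mult_right_mono) (auto intro: mult_left_mono)
    finally show ?thesis by (simp add: exp_minus field_simps)
  qed
  show ?thesis using r(1) 1 2 by blast
qed

text \<open>Any torus in C^d is the image of points X in a fixed ball, where w and the Gaussian
  factor are bounded below; so the pointwise bound for transforms becomes a bound for the entire
  functions there, as Montel's theorem requires.\<close>

lemma bounded_sequence_subsequence:
  fixes g :: "nat \<Rightarrow> 'd::finite hermite_series"
  assumes \<Phi>: "quasi_young \<Phi>" and \<Psi>: "quasi_young \<Psi>" and w: "regular_weight w"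
    and g: "\<And>n. g n \<in> Hflat_dual" and M: "\<And>n. weighted_norm \<Phi> \<Psi> w (g n) \<le> ennreal M"
  obtains k f where "strict_mono k" "f \<in> Hflat_dual"
    "\<forall>R. \<forall>e>0. \<forall>\<^sub>F n in sequentially. \<forall>X. norm X \<le> R \<longrightarrow> cmod (stft (g (k n) - f) X) < e"
    "weighted_norm \<Phi> \<Psi> w f \<le> ennreal M"
proof -
  define c where "c = (2 * pi) powr (- real CARD('d) / 2)"
  have c: "c > 0" by (simp add: c_def)
  obtain K where K: "K > 0" "\<And>f X. f \<in> Hflat_dual \<Longrightarrow> ennreal (cmod (stft f X) * w X) \<le> ennreal K * weighted_norm \<Phi> \<Psi> w f"
    using stft_pointwise_bound[OF \<Phi> \<Psi> w] by blast
  obtain r where "r \<ge> 0" and r: "\<forall>X R. norm X \<le> R \<longrightarrow> w X \<le> w 0 * exp (r * R) \<and> w 0 * exp (- (r * R)) \<le> w X"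
    using regular_weight_bounds[OF w] by blast
  have wpos: "0 < w X" for X by (rule regular_weight_pos[OF w])
  \<comment> \<open>\<open>ennreal M\<close> is 0 for negative M, hence \<open>max M 0\<close> in
    the real bound.\<close>
  have pw: "cmod (stft (g n) X) * w X \<le> K * max M 0" for n X
  proof -
    have "ennreal (cmod (stft (g n) X) * w X) \<le> ennreal K * ennreal M"
      using K(2)[OF g, of n X] mult_left_mono[OF M[of n], of "ennreal K"] by (rule order_trans) simp
    also have "\<dots> \<le> ennreal K * ennreal (max M 0)" by (intro mult_left_mono ennreal_leI) auto
    also have "\<dots> = ennreal (K * max M 0)" using K(1) by (simp add: ennreal_mult')
    finally show ?thesis using K(1) by (subst (asm) ennreal_le_iff) auto
  qed
  have "\<exists>B. \<forall>n z. (\<forall>i. cmod (z i) = R) \<longrightarrow> cmod (entire_fun (fock_coeffs (g n)) z) \<le> B" if "R > 0" for R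
  proof -
    define P where "P = 2 * real CARD('d) * sqrt 2 * R"
    \<comment> \<open>The two divisors are lower bounds on the ball of radius P: for the weight, and
      for the modulus of \<open>stft_factor\<close>.\<close>
    have "cmod (entire_fun (fock_coeffs (g n)) z) \<le> K * max M 0 / (w 0 * exp (- (r * P))) / (c * exp (- P\<^sup>2 / 4))"
      if z: "\<forall>i. cmod (z i) = R" for n z
    proof -
      obtain X where X: "phase_to_complex X = z" "norm X \<le> P" using phase_to_complex_surj[of z R] z unfolding P_def by auto
      have "cmod (stft (g n) X) * (w 0 * exp (- (r * P))) \<le> K * max M 0"
        using mult_left_mono[OF conjunct2[OF r[rule_format, OF X(2)]], of "cmod (stft (g n) X)"] pw[of n X] by simp
      then have s: "cmod (stft (g n) X) \<le> K * max M 0 / (w 0 * exp (- (r * P)))"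
        using wpos[of 0] by (simp add: pos_le_divide_eq)
      have "(norm X)\<^sup>2 \<le> P\<^sup>2" using X(2) by (intro power_mono) auto
      then have "c * exp (- P\<^sup>2 / 4) * cmod (entire_fun (fock_coeffs (g n)) z) \<le> c * exp (- (norm X)\<^sup>2 / 4) * cmod (entire_fun (fock_coeffs (g n)) z)"
        using c by (intro mult_right_mono mult_left_mono) auto
      also have "\<dots> = cmod (stft (g n) X)" by (simp add: norm_stft X(1) c_def)
      also note s
      finally have le: "c * exp (- P\<^sup>2 / 4) * cmod (entire_fun (fock_coeffs (g n)) z) \<le> K * max M 0 / (w 0 * exp (- (r * P)))" .
      have ce: "0 < c * exp (- P\<^sup>2 / 4)" using c by simp
      show ?thesis unfolding pos_le_divide_eq[OF ce] using le by (simp only: mult.commute)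
    qed
    then show ?thesis by blast
  qed
  moreover have "entire_coeffs (fock_coeffs (g n))" for n using g by (simp add: Hflat_dual_iff)
  ultimately obtain k b where kb: "strict_mono k" "entire_coeffs b"
    "\<And>R e. e > 0 \<Longrightarrow> \<forall>\<^sub>F n in sequentially. \<forall>z. (\<forall>i. cmod (z i) \<le> R) \<longrightarrow> cmod (entire_fun (fock_coeffs (g (k n))) z - entire_fun b z) < e"
    using entire_fun_convergent_subsequence[of "\<lambda>n. fock_coeffs (g n)"] by blast
  define f where "f \<alpha> = b \<alpha> * of_real (sqrt (\<Prod>i\<in>UNIV. fact (\<alpha> i)))" for \<alpha>
  have "(\<Prod>i\<in>UNIV. fact (\<alpha> i)) \<noteq> (0::real)" for \<alpha> :: "'d \<Rightarrow> nat" by simp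
  then have bf: "fock_coeffs f = b" by (simp add: fun_eq_iff fock_coeffs_def f_def)
  have f: "f \<in> Hflat_dual" using kb(2) by (simp add: Hflat_dual_iff bf)
  have conv: "\<forall>\<^sub>F n in sequentially. \<forall>X. norm X \<le> R \<longrightarrow> cmod (stft (g (k n) - f) X) < e" if e: "e > 0" for R e
  proof -
    have "\<forall>\<^sub>F n in sequentially. \<forall>z. (\<forall>i. cmod (z i) \<le> R) \<longrightarrow> cmod (entire_fun (fock_coeffs (g (k n))) z - entire_fun b z) < e / c"
      using kb(3) e c by simp
    then show ?thesis
    proof eventually_elim
      case (elim n)
      show ?case
      proof (intro allI impI)
        fix X :: "(real ^ 'd) \<times> (real ^ 'd)" assume X: "norm X \<le> R"
        have "cmod (phase_to_complex X i) \<le> R" for i using norm_phase_to_complex_le[of X i] X by simp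
        then have lt: "cmod (entire_fun (fock_coeffs (g (k n))) (phase_to_complex X) - entire_fun b (phase_to_complex X)) < e / c" using elim by blast
        have "stft (g (k n) - f) X = stft_factor X * (entire_fun (fock_coeffs (g (k n))) (phase_to_complex X) - entire_fun b (phase_to_complex X))"
          using f g by (simp add: stft_diff) (simp add: stft_eq bf right_diff_distrib)
        then have "cmod (stft (g (k n) - f) X) = c * exp (- (norm X)\<^sup>2 / 4) * cmod (entire_fun (fock_coeffs (g (k n))) (phase_to_complex X) - entire_fun b (phase_to_complex X))"
          by (simp add: norm_mult norm_stft_factor c_def)
        also have "\<dots> \<le> c * 1 * cmod (entire_fun (fock_coeffs (g (k n))) (phase_to_complex X) - entire_fun b (phase_to_complex X))"
          using c by (intro mult_right_mono mult_left_mono) auto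
        also have "\<dots> < c * 1 * (e / c)" using lt c by (intro mult_strict_left_mono) auto
        finally show "cmod (stft (g (k n) - f) X) < e" using c by simp
      qed
    qed
  qed
  have "weighted_norm \<Phi> \<Psi> w f \<le> liminf (\<lambda>n. weighted_norm \<Phi> \<Psi> w (g (k n)))"
  proof (rule weighted_norm_liminf[OF \<Phi> \<Psi> w])
    show "g (k n) \<in> Hflat_dual" for n by (rule g)
    show "(\<lambda>n. stft (g (k n)) X) \<longlonglongrightarrow> stft f X" for X
    proof (rule tendstoI)
      fix e :: real assume "e > 0"
      from conv[OF this, of "norm X"] show "\<forall>\<^sub>F n in sequentially. dist (stft (g (k n)) X) (stft f X) < e"
        
      proof eventually_elim
        case (elim n)
        then have "cmod (stft (g (k n) - f) X) < e" by blast
        then show ?case by (simp only: stft_diff[OF g f] dist_norm)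
      qed
    qed
  qed
  also have "\<dots> \<le> ennreal M"
    by (rule Liminf_le) (use M in \<open>auto intro!: always_eventually\<close>)
  finally have "weighted_norm \<Phi> \<Psi> w f \<le> ennreal M" .
  moreover have "\<forall>R. \<forall>e>0. \<forall>\<^sub>F n in sequentially. \<forall>X. norm X \<le> R \<longrightarrow> cmod (stft (g (k n) - f) X) < e"
    using conv by blast
  ultimately show ?thesis using kb(1) f by (intro that)
qed

text \<open>The weighted difference is at most the maximum of two functions: on a large ball, where
  it is uniformly small, a small multiple of a fixed Gaussian; outside, a small multiple of the
  w1-weighted difference, whose norm is bounded.\<close>

lemma weighted_norm_subsequence_tendsto:
  fixes g :: "nat \<Rightarrow> 'd::finite hermite_series"
  assumes \<Phi>: "quasi_young \<Phi>" "t > 0" "\<Phi> t < \<infinity>" and \<Psi>: "quasi_young \<Psi>" "s > 0" "\<Psi> s < \<infinity>"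
    and w1: "regular_weight w1" and w2: "regular_weight w2"
    and lim: "((\<lambda>X. w2 X / w1 X) \<longlongrightarrow> 0) at_infinity"
    and g: "\<And>n. g n \<in> Hflat_dual" and M: "\<And>n. weighted_norm \<Phi> \<Psi> w1 (g n) \<le> ennreal M"
  obtains k f where "strict_mono k" "f \<in> Hflat_dual" "weighted_norm \<Phi> \<Psi> w1 f \<le> ennreal M"
    "(\<lambda>n. weighted_norm \<Phi> \<Psi> w2 (g (k n) - f)) \<longlonglongrightarrow> 0"
proof -
  obtain k f where kf: "strict_mono k" "f \<in> Hflat_dual"
    "\<forall>R. \<forall>e>0. \<forall>\<^sub>F n in sequentially. \<forall>X. norm X \<le> R \<longrightarrow> cmod (stft (g (k n) - f) X) < e"
    "weighted_norm \<Phi> \<Psi> w1 f \<le> ennreal M"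
    using bounded_sequence_subsequence[where g=g and w=w1 and M=M, OF \<Phi>(1) \<Psi>(1) w1 g M] by blast
  obtain K where K: "K \<ge> 1" "\<forall>w. \<forall>f::'d hermite_series. \<forall>g. regular_weight w \<longrightarrow> f \<in> Hflat_dual \<longrightarrow> g \<in> Hflat_dual \<longrightarrow>
    weighted_norm \<Phi> \<Psi> w (f - g) \<le> ennreal K * max (weighted_norm \<Phi> \<Psi> w f) (weighted_norm \<Phi> \<Psi> w g)"
    using weighted_norm_triangle[OF \<Phi>(1) \<Psi>(1), where 'd='d] by (elim exE conjE)
  obtain \<kappa> where \<kappa>: "\<kappa> \<ge> 1" "\<And>u v :: (real ^ 'd) \<times> (real ^ 'd) \<Rightarrow> ennreal.
    u \<in> borel_measurable borel \<Longrightarrow> v \<in> borel_measurable borel \<Longrightarrow>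
    mixed_norm \<Phi> \<Psi> (\<lambda>X. max (u X) (v X)) \<le> ennreal \<kappa> * max (mixed_norm \<Phi> \<Psi> u) (mixed_norm \<Phi> \<Psi> v)"
    using mixed_norm_max_le[OF \<Phi>(1) \<Psi>(1), where 'a="real ^ 'd"] by blast
  obtain G where G: "G > 0" "\<And>Y::(real ^ 'd) \<times> (real ^ 'd). mixed_norm \<Phi> \<Psi> (\<lambda>X. ennreal (exp (- (norm (X - Y))\<^sup>2 / 8))) \<le> ennreal G"
    using mixed_norm_gaussian[OF \<Phi> \<Psi>, where 'a="real ^ 'd"] by blast
  have pos: "0 < w1 X" "0 < w2 X" for X by (rule regular_weight_pos[OF w1], rule regular_weight_pos[OF w2])
  obtain r where "r \<ge> 0" and r: "\<forall>X R. norm X \<le> R \<longrightarrow> w2 X \<le> w2 0 * exp (r * R) \<and> w2 0 * exp (- (r * R)) \<le> w2 X"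
    using regular_weight_bounds[OF w2] by blast
  define Q where "Q = K * max M 1"
  have Q: "Q > 0" using K by (simp add: Q_def)
  have N1: "weighted_norm \<Phi> \<Psi> w1 (g (k n) - f) \<le> ennreal Q" for n
  proof -
    have "weighted_norm \<Phi> \<Psi> w1 (g (k n) - f) \<le> ennreal K * max (weighted_norm \<Phi> \<Psi> w1 (g (k n))) (weighted_norm \<Phi> \<Psi> w1 f)"
      by (rule K(2)[rule_format, OF w1 g kf(2)])
    also have "\<dots> \<le> ennreal K * ennreal (max M 1)"
    proof (intro mult_left_mono max.boundedI)
      have "ennreal M \<le> ennreal (max M 1)" by (intro ennreal_leI) auto
      then show "weighted_norm \<Phi> \<Psi> w1 (g (k n)) \<le> ennreal (max M 1)" "weighted_norm \<Phi> \<Psi> w1 f \<le> ennreal (max M 1)"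
        using M[of "k n"] kf(4) by (auto intro: order_trans)
    qed simp
    finally show ?thesis using K by (simp add: Q_def ennreal_mult')
  qed
  have "\<forall>\<^sub>F n in sequentially. weighted_norm \<Phi> \<Psi> w2 (g (k n) - f) \<le> ennreal e" if e: "e > 0" for e
  proof -
    \<comment> \<open>Q bounds the w1-norms of the differences and \<kappa> is the cost of the
      maximum, so the outer part contributes at most e.\<close>
    define \<eta> where "\<eta> = e / (\<kappa> * Q)"
    have \<eta>: "\<eta> > 0" using e \<kappa> Q by (simp add: \<eta>_def)
    have "\<forall>\<^sub>F X in at_infinity. dist (w2 X / w1 X) 0 < \<eta>" using lim \<eta> by (rule tendstoD)
    then obtain R where R: "\<And>X. norm X \<ge> R \<Longrightarrow> w2 X / w1 X < \<eta>"
      using pos by (auto simp: eventually_at_infinity dist_real_def less_imp_le abs_of_pos)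
    define P where "P = max R 0"
    define a where "a = e / (\<kappa> * G)"
    have a: "a > 0" using e \<kappa> G by (simp add: a_def)
    \<comment> \<open>On the ball of radius P the majorant a exp (- |X|^2 / 8) is at least a exp (-
      P^2 / 8), while w2 is at most w2(0) exp (r P). A difference below q thus lies under the
      majorant.\<close>
    define q where "q = a * exp (- P\<^sup>2 / 8) / (w2 0 * exp (r * P))"
    have q: "q > 0" using a pos by (simp add: q_def)
    have "\<forall>\<^sub>F n in sequentially. \<forall>X. norm X \<le> P \<longrightarrow> cmod (stft (g (k n) - f) X) < q"
      using kf(3) q by blast
    then show ?thesis
    proof eventually_elim
      case (elim n)
      let ?h = "g (k n) - f"
      have h: "?h \<in> Hflat_dual" by (intro Hflat_dual_diff g kf)
      let ?u = "\<lambda>X::(real ^ 'd) \<times> (real ^ 'd). ennreal a * ennreal (exp (- (norm (X - 0))\<^sup>2 / 8))"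
      let ?v = "\<lambda>X. ennreal \<eta> * ennreal (cmod (stft ?h X) * w1 X)"
      have m: "?u \<in> borel_measurable borel" "?v \<in> borel_measurable borel"
        using measurable_stft_weight[OF w1 h] by simp_all
      have "weighted_norm \<Phi> \<Psi> w2 ?h \<le> mixed_norm \<Phi> \<Psi> (\<lambda>X. max (?u X) (?v X))"
        unfolding weighted_norm_def
      proof (rule mixed_norm_mono[OF \<Phi>(1) \<Psi>(1)])
        fix X
        show "ennreal (cmod (stft ?h X) * w2 X) \<le> max (?u X) (?v X)"
        proof (cases "norm X \<le> P")
          case True
          have lt: "cmod (stft ?h X) < q" using elim True by blast
          have "cmod (stft ?h X) * w2 X \<le> q * (w2 0 * exp (r * P))"
            using lt conjunct1[OF r[rule_format, OF True]] pos(2)[of X] q by (intro mult_mono) (simp_all add: less_imp_le)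
          also have "\<dots> = a * exp (- P\<^sup>2 / 8)" using pos(2)[of 0] by (simp add: q_def)
          also have "\<dots> \<le> a * exp (- (norm (X - 0))\<^sup>2 / 8)"
          proof -
            have "(norm X)\<^sup>2 \<le> P\<^sup>2" using True by (intro power_mono) auto
            then show ?thesis using a by (intro mult_left_mono) auto
          qed
          finally have "ennreal (cmod (stft ?h X) * w2 X) \<le> ?u X"
            using a by (simp add: ennreal_mult'[symmetric] ennreal_leI)
          then show ?thesis by (rule order_trans) simp
        next
          case False
          then have "R \<le> norm X" by (simp add: P_def)
          then have "w2 X \<le> \<eta> * w1 X" using R[of X] pos[of X] by (simp add: pos_divide_less_eq)
          then have "cmod (stft ?h X) * w2 X \<le> \<eta> * (cmod (stft ?h X) * w1 X)"
            using mult_left_mono[of "w2 X" "\<eta> * w1 X" "cmod (stft ?h X)"] by (simp add: mult_ac)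
          then have "ennreal (cmod (stft ?h X) * w2 X) \<le> ?v X"
            using \<eta> by (simp add: ennreal_mult'[symmetric] ennreal_leI)
          then show ?thesis by (rule order_trans) simp
        qed
      qed
      also have "\<dots> \<le> ennreal \<kappa> * max (mixed_norm \<Phi> \<Psi> ?u) (mixed_norm \<Phi> \<Psi> ?v)" by (rule \<kappa>(2)[OF m])
      also have "\<dots> \<le> ennreal \<kappa> * ennreal (e / \<kappa>)"
      proof (intro mult_left_mono max.boundedI)
        have "mixed_norm \<Phi> \<Psi> ?u \<le> ennreal a * ennreal G"
          by (rule order_trans[OF mixed_norm_cmult_le[OF \<Phi>(1) \<Psi>(1) a] mult_left_mono[OF G(2)]]) simp
        also have "\<dots> = ennreal (e / \<kappa>)" using a G by (simp add: ennreal_mult'[symmetric] a_def)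
        finally show "mixed_norm \<Phi> \<Psi> ?u \<le> ennreal (e / \<kappa>)" .
        have "mixed_norm \<Phi> \<Psi> ?v \<le> ennreal \<eta> * ennreal Q"
          by (rule order_trans[OF mixed_norm_cmult_le[OF \<Phi>(1) \<Psi>(1) \<eta>] mult_left_mono[OF N1[of n, unfolded weighted_norm_def]]]) simp
        also have "\<dots> = ennreal (e / \<kappa>)" using \<eta> Q by (simp add: ennreal_mult'[symmetric] \<eta>_def)
        finally show "mixed_norm \<Phi> \<Psi> ?v \<le> ennreal (e / \<kappa>)" .
      qed simp
      also have "\<dots> = ennreal e" using \<kappa> by (simp add: ennreal_mult'[symmetric])
      finally show ?case .
    qed
  qed
  note le = this
  have "(\<lambda>n. weighted_norm \<Phi> \<Psi> w2 (g (k n) - f)) \<longlonglongrightarrow> 0"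
  proof (rule order_tendstoI)
    fix e :: ennreal assume "0 < e"
    then obtain d where d: "0 < d" "d < e" using dense by blast
    have "d \<noteq> top" using d(2) by auto
    then obtain d' where d0: "d = ennreal d'" "0 \<le> d'" by (cases d) auto
    have "d' \<noteq> 0" using d(1) d0 by auto
    with d0 have d': "d = ennreal d'" "d' > 0" by auto
    have "\<forall>\<^sub>F n in sequentially. weighted_norm \<Phi> \<Psi> w2 (g (k n) - f) \<le> ennreal d'" by (rule le[OF d'(2)])
    then show "\<forall>\<^sub>F n in sequentially. weighted_norm \<Phi> \<Psi> w2 (g (k n) - f) < e"
      by eventually_elim (use d d' in auto)
  qed simp
  with kf(1,2,4) show ?thesis by (rule that)
qed

section \<open>Compactness of the embedding\<close>

definition weighted_space :: "(real \<Rightarrow> ennreal) \<Rightarrow> (real \<Rightarrow> ennreal) \<Rightarrow> ((real ^ 'd::finite) \<times> (real ^ 'd) \<Rightarrow> real) \<Rightarrow> 'd hermite_series set" where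
  "weighted_space \<Phi> \<Psi> w = {f \<in> Hflat_dual. weighted_norm \<Phi> \<Psi> w f < \<infinity>}"

lemma quasi_normed_weighted_space:
  fixes w :: "(real ^ 'd::finite) \<times> (real ^ 'd) \<Rightarrow> real"
  assumes "quasi_young \<Phi>" "quasi_young \<Psi>" "regular_weight w"
  obtains K where "quasi_normed (weighted_space \<Phi> \<Psi> w) (weighted_norm \<Phi> \<Psi> w) K"
proof -
  obtain K where K: "K \<ge> 1" "\<forall>w. \<forall>f::'d hermite_series. \<forall>g h. regular_weight w \<longrightarrow>
    f \<in> Hflat_dual \<longrightarrow> g \<in> Hflat_dual \<longrightarrow> h \<in> Hflat_dual \<longrightarrow>
    weighted_norm \<Phi> \<Psi> w (f - h) \<le> ennreal K * max (weighted_norm \<Phi> \<Psi> w (f - g)) (weighted_norm \<Phi> \<Psi> w (g - h))"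
    using weighted_norm_triangle[OF assms(1,2), where 'd='d] by (elim exE conjE)
  have "quasi_normed (weighted_space \<Phi> \<Psi> w) (weighted_norm \<Phi> \<Psi> w) K"
  proof
    show "1 \<le> K" by (rule K(1))
    show "weighted_norm \<Phi> \<Psi> w (f - f) = 0" for f by (rule weighted_norm_diff_self[OF assms(1,2)])
    show "weighted_norm \<Phi> \<Psi> w (f - h) \<le> ennreal K * max (weighted_norm \<Phi> \<Psi> w (f - g)) (weighted_norm \<Phi> \<Psi> w (g - h))"
      if "f \<in> weighted_space \<Phi> \<Psi> w" "g \<in> weighted_space \<Phi> \<Psi> w" "h \<in> weighted_space \<Phi> \<Psi> w" for f g h
      using that assms(3) by (intro K(2)[rule_format]) (auto simp: weighted_space_def)
    show "weighted_norm \<Phi> \<Psi> w (f - g) = weighted_norm \<Phi> \<Psi> w (g - f)" if "f \<in> weighted_space \<Phi> \<Psi> w" "g \<in> weighted_space \<Phi> \<Psi> w" for f g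
      using that by (intro weighted_norm_commute) (auto simp: weighted_space_def)
  qed
  then show ?thesis by (rule that)
qed

text \<open>Gives the inclusion of the spaces, which is part of \<open>compact_map\<close>; on a
  ball it follows from the bounds for regular weights.\<close>

lemma weight_ratio_bounded:
  fixes w1 w2 :: "'a::real_normed_vector \<Rightarrow> real"
  assumes w1: "regular_weight w1" and w2: "regular_weight w2"
    and lim: "((\<lambda>X. w2 X / w1 X) \<longlongrightarrow> 0) at_infinity"
  obtains C where "C > 0" "\<And>X. w2 X \<le> C * w1 X"
proof -
  have pos: "0 < w1 X" "0 < w2 X" for X by (rule regular_weight_pos[OF w1], rule regular_weight_pos[OF w2])
  obtain r1 where "r1 \<ge> 0" and r1: "\<forall>X R. norm X \<le> R \<longrightarrow> w1 X \<le> w1 0 * exp (r1 * R) \<and> w1 0 * exp (- (r1 * R)) \<le> w1 X"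
    using regular_weight_bounds[OF w1] by blast
  obtain r2 where "r2 \<ge> 0" and r2: "\<forall>X R. norm X \<le> R \<longrightarrow> w2 X \<le> w2 0 * exp (r2 * R) \<and> w2 0 * exp (- (r2 * R)) \<le> w2 X"
    using regular_weight_bounds[OF w2] by blast
  have "\<forall>\<^sub>F X in at_infinity. dist (w2 X / w1 X) 0 < 1" using lim by (rule tendstoD) simp
  then obtain R where R: "\<And>X. norm X \<ge> R \<Longrightarrow> w2 X / w1 X < 1"
    using pos by (auto simp: eventually_at_infinity dist_real_def less_imp_le abs_of_pos)
  define C where "C = max 1 (w2 0 * exp (r2 * R) / (w1 0 * exp (- (r1 * R))))"
  have "w2 X \<le> C * w1 X" for X
  proof (cases "norm X \<le> R")
    case True
    have "w2 X \<le> w2 0 * exp (r2 * R)" using r2 True by blast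
    also have "\<dots> = w2 0 * exp (r2 * R) / (w1 0 * exp (- (r1 * R))) * (w1 0 * exp (- (r1 * R)))"
      using pos(1)[of 0] by simp
    also have "\<dots> \<le> C * w1 X"
      using r1 True pos by (intro mult_mono) (auto simp: C_def less_imp_le)
    finally show ?thesis .
  next
    case False
    then have "w2 X \<le> 1 * w1 X" using R[of X] pos[of X] by (simp add: field_simps)
    also have "\<dots> \<le> C * w1 X" using pos[of X] by (intro mult_right_mono) (auto simp: C_def)
    finally show ?thesis .
  qed
  moreover have "C > 0" by (simp add: C_def)
  ultimately show ?thesis by (intro that)
qed

lemma compact_map_of_limit:
  fixes w1 w2 :: "(real ^ 'd::finite) \<times> (real ^ 'd) \<Rightarrow> real"
  assumes \<Phi>: "quasi_young \<Phi>" "t > 0" "\<Phi> t < \<infinity>" and \<Psi>: "quasi_young \<Psi>" "s > 0" "\<Psi> s < \<infinity>"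
    and w1: "regular_weight w1" and w2: "regular_weight w2"
    and lim: "((\<lambda>X. w2 X / w1 X) \<longlongrightarrow> 0) at_infinity"
  shows "compact_map (weighted_space \<Phi> \<Psi> w1) (weighted_norm \<Phi> \<Psi> w1) (weighted_space \<Phi> \<Psi> w2) (weighted_norm \<Phi> \<Psi> w2) (\<lambda>f. f)"
  unfolding compact_map_def
proof (intro conjI allI impI)
  obtain C where C: "C > 0" "\<And>X. w2 X \<le> C * w1 X" using weight_ratio_bounded[OF w1 w2 lim] by blast
  \<comment> \<open>Besides the inclusion, this puts the limit of a subsequence, known to lie in the
    first space, into the second.\<close>
  have fin: "f \<in> weighted_space \<Phi> \<Psi> w2" if "f \<in> Hflat_dual" "weighted_norm \<Phi> \<Psi> w1 f < \<infinity>" for f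
  proof -
    have "weighted_norm \<Phi> \<Psi> w2 f \<le> ennreal C * weighted_norm \<Phi> \<Psi> w1 f" by (rule weighted_norm_mono[OF \<Phi>(1) \<Psi>(1) C])
    also have "\<dots> < \<infinity>" using that(2) by (simp add: ennreal_mult_less_top)
    finally show ?thesis using that(1) by (simp add: weighted_space_def)
  qed
  then show sub: "(\<lambda>f. f) ` weighted_space \<Phi> \<Psi> w1 \<subseteq> weighted_space \<Phi> \<Psi> w2" by (auto simp: weighted_space_def)
  obtain K where "quasi_normed (weighted_space \<Phi> \<Psi> w2) (weighted_norm \<Phi> \<Psi> w2) K"
    using quasi_normed_weighted_space[OF \<Phi>(1) \<Psi>(1) w2] by blast
  then interpret quasi_normed "weighted_space \<Phi> \<Psi> w2" "weighted_norm \<Phi> \<Psi> w2" K .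
  fix B assume B: "B \<subseteq> weighted_space \<Phi> \<Psi> w1" "\<exists>C<\<infinity>. \<forall>f\<in>B. weighted_norm \<Phi> \<Psi> w1 f \<le> C"
  then obtain M where M: "\<And>f. f \<in> B \<Longrightarrow> weighted_norm \<Phi> \<Psi> w1 f \<le> ennreal M"
    by (metis ennreal_cases infinity_ennreal_def order_less_irrefl)
  show "compactin T (T closure_of (\<lambda>f. f) ` B)"
  proof (rule compactin_closure)
    show "(\<lambda>f. f) ` B \<subseteq> weighted_space \<Phi> \<Psi> w2" using B(1) sub by auto
    fix g :: "nat \<Rightarrow> 'd hermite_series" assume "\<And>n. g n \<in> (\<lambda>f. f) ` B"
    then have g: "g n \<in> B" for n by auto
    then have gH: "g n \<in> Hflat_dual" for n using B(1) by (auto simp: weighted_space_def)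
    obtain k f where kf: "strict_mono k" "f \<in> Hflat_dual" "weighted_norm \<Phi> \<Psi> w1 f \<le> ennreal M"
      "(\<lambda>n. weighted_norm \<Phi> \<Psi> w2 (g (k n) - f)) \<longlonglongrightarrow> 0"
      using weighted_norm_subsequence_tendsto[where g=g and M=M, OF \<Phi> \<Psi> w1 w2 lim gH M[OF g]] by blast
    have "f \<in> weighted_space \<Phi> \<Psi> w2" by (rule fin[OF kf(2)]) (use le_less_trans[OF kf(3) ennreal_less_top] in simp)
    with kf(1,4) show "\<exists>f\<in>weighted_space \<Phi> \<Psi> w2. \<exists>k::nat \<Rightarrow> nat. strict_mono k \<and> (\<lambda>n. weighted_norm \<Phi> \<Psi> w2 (g (k n) - f)) \<longlonglongrightarrow> 0"
      by blast
  qed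
qed

text \<open>Up to a factor of modulus 1, a times the Hermite coefficients of the Gaussian window
  moved to the phase space point Y; in the Fock picture, a multiple of the reproducing kernel at
  Y.\<close>

definition coherent :: "real \<Rightarrow> (real ^ 'd::finite) \<times> (real ^ 'd) \<Rightarrow> 'd hermite_series" where
  "coherent a Y \<alpha> = of_real (a * exp (- (norm Y)\<^sup>2 / 4)) * (\<Prod>i\<in>UNIV. cnj (phase_to_complex Y i) ^ \<alpha> i / of_real (sqrt (fact (\<alpha> i))))"

lemma fock_coeffs_coherent:
  "fock_coeffs (coherent a Y) \<alpha> = of_real (a * exp (- (norm Y)\<^sup>2 / 4)) * (\<Prod>i\<in>UNIV. cnj (phase_to_complex Y i) ^ \<alpha> i / fact (\<alpha> i))"
proof -
  have sq: "sqrt (\<Prod>i\<in>A. fact (\<alpha> i)) = (\<Prod>i\<in>A. sqrt (fact (\<alpha> i)))" for A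
    by (induction A rule: infinite_finite_induct) (auto simp: real_sqrt_mult)
  have "(of_real (sqrt (fact (\<alpha> i))) * of_real (sqrt (fact (\<alpha> i))) :: complex) = fact (\<alpha> i)" for i
    by (simp flip: of_real_mult)
  then show ?thesis
    unfolding fock_coeffs_def coherent_def sq of_real_prod by (simp add: prod_dividef prod.distrib[symmetric])
qed

lemma power_div_fact_le_exp: "0 \<le> x \<Longrightarrow> x ^ n / fact n \<le> exp (x::real)"
  using sums_unique[OF exp_converges[of x]] sum_le_suminf[OF summable_exp_generic[of x], of "{n}"]
  by (simp add: divide_inverse mult.commute scaleR_conv_of_real)

text \<open>Factorials beat every geometric rate: s^n / n! \<le> exp (s / r) r^n, from one term of
  the series of exp (s / r).\<close>

lemma coherent_Hflat_dual: "coherent a Y \<in> Hflat_dual" for Y :: "(real ^ 'd::finite) \<times> (real ^ 'd)"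
  unfolding Hflat_dual_iff entire_coeffs_def
proof (intro allI impI)
  fix r :: real assume r: "r > 0"
  have "cmod (fock_coeffs (coherent a Y) \<alpha>) \<le> (\<bar>a * exp (- (norm Y)\<^sup>2 / 4)\<bar> * exp (norm Y / r) ^ CARD('d)) * r ^ (\<Sum>i\<in>UNIV. \<alpha> i)" for \<alpha>
  proof -
    have 1: "cmod (cnj (phase_to_complex Y i) ^ \<alpha> i / fact (\<alpha> i)) \<le> exp (norm Y / r) * r ^ \<alpha> i" for i
    proof -
      have "cmod (cnj (phase_to_complex Y i) ^ \<alpha> i / fact (\<alpha> i)) \<le> norm Y ^ \<alpha> i / fact (\<alpha> i)"
        by (simp add: norm_divide norm_power divide_right_mono power_mono norm_phase_to_complex_le)
      also have "\<dots> = (norm Y / r) ^ \<alpha> i / fact (\<alpha> i) * r ^ \<alpha> i" using r by (simp add: power_divide)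
      also have "\<dots> \<le> exp (norm Y / r) * r ^ \<alpha> i" using r by (intro mult_right_mono power_div_fact_le_exp) auto
      finally show ?thesis .
    qed
    have "cmod (\<Prod>i\<in>UNIV. cnj (phase_to_complex Y i) ^ \<alpha> i / fact (\<alpha> i)) \<le> (\<Prod>i\<in>UNIV. exp (norm Y / r) * r ^ \<alpha> i)"
      unfolding prod_norm[symmetric] by (intro prod_mono conjI norm_ge_zero 1)
    also have "\<dots> = exp (norm Y / r) ^ CARD('d) * r ^ (\<Sum>i\<in>UNIV. \<alpha> i)"
      by (simp add: prod.distrib power_sum)
    finally show ?thesis
      unfolding fock_coeffs_coherent norm_mult norm_of_real mult.assoc by (rule mult_left_mono) simp
  qed
  then show "\<exists>C. \<forall>\<alpha>. cmod (fock_coeffs (coherent a Y) \<alpha>) \<le> C * r ^ (\<Sum>i\<in>UNIV. \<alpha> i)" by blast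
qed

lemma exp_has_sum: "((\<lambda>n. x ^ n / fact n) has_sum exp x) UNIV" for x :: complex
proof (rule norm_summable_imp_has_sum)
  show "(\<lambda>n. x ^ n / fact n) sums exp x"
    using exp_converges[of x] by (simp add: scaleR_conv_of_real divide_inverse mult.commute)
  show "summable (\<lambda>n. norm (x ^ n / fact n))"
    using summable_norm_exp[of x] by (simp add: scaleR_conv_of_real divide_inverse mult.commute)
qed

lemma infsum_exp_multi: "(\<Sum>\<^sub>\<infinity>\<alpha>. \<Prod>i\<in>UNIV. x i ^ \<alpha> i / fact (\<alpha> i)) = exp (\<Sum>i\<in>UNIV. x i)" for x :: "'d::finite \<Rightarrow> complex"
proof -
  have "(\<lambda>n. norm (x i ^ n / fact n)) summable_on UNIV" for i
    by (intro norm_summable_imp_summable_on)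
      (use summable_norm_exp[of "x i"] in \<open>simp add: scaleR_conv_of_real divide_inverse mult.commute\<close>)
  then have "(\<Sum>\<^sub>\<infinity>\<alpha>\<in>PiE UNIV (\<lambda>_. UNIV). \<Prod>i\<in>UNIV. x i ^ \<alpha> i / fact (\<alpha> i)) = (\<Prod>i\<in>UNIV. \<Sum>\<^sub>\<infinity>n. x i ^ n / fact n)"
    by (intro infsum_prod_PiE_abs) auto
  also have "\<dots> = exp (\<Sum>i\<in>UNIV. x i)" by (simp add: infsumI[OF exp_has_sum] exp_sum)
  finally show ?thesis by simp
qed

text \<open>The series sums to an exponential of modulus exp ((X . Y) / 2), the cross term that
  joins the two centred Gaussians into one in X - Y.\<close>

lemma norm_stft_coherent:
  "cmod (stft (coherent a Y) X) = (2 * pi) powr (- real CARD('d) / 2) * \<bar>a\<bar> * exp (- (norm (X - Y))\<^sup>2 / 4)"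
  for X Y :: "(real ^ 'd::finite) \<times> (real ^ 'd)"
proof -
  have "fock_coeffs (coherent a Y) \<alpha> * monomial (phase_to_complex X) \<alpha> =
     of_real (a * exp (- (norm Y)\<^sup>2 / 4)) * (\<Prod>i\<in>UNIV. (phase_to_complex X i * cnj (phase_to_complex Y i)) ^ \<alpha> i / fact (\<alpha> i))" for \<alpha>
    by (simp add: fock_coeffs_coherent monomial_def prod_dividef power_mult_distrib prod.distrib mult_ac)
  then have "entire_fun (fock_coeffs (coherent a Y)) (phase_to_complex X) = of_real (a * exp (- (norm Y)\<^sup>2 / 4)) * exp (\<Sum>i\<in>UNIV. phase_to_complex X i * cnj (phase_to_complex Y i))"
    by (simp only: entire_fun_def infsum_cmult_right' infsum_exp_multi)
  then have "cmod (entire_fun (fock_coeffs (coherent a Y)) (phase_to_complex X)) = \<bar>a\<bar> * exp (- (norm Y)\<^sup>2 / 4) * exp ((X \<bullet> Y) / 2)"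
    by (simp only: norm_mult norm_of_real norm_exp_eq_Re sum_phase_to_complex_cnj abs_mult abs_exp_cancel)
  moreover have gauss: "exp (- (norm X)\<^sup>2 / 4) * (exp (- (norm Y)\<^sup>2 / 4) * exp ((X \<bullet> Y) / 2)) = exp (- (norm (X - Y))\<^sup>2 / 4)"
  proof -
    have "(norm (X - Y))\<^sup>2 = (norm X)\<^sup>2 - 2 * (X \<bullet> Y) + (norm Y)\<^sup>2"
      by (simp only: power2_norm_eq_inner inner_diff_left inner_diff_right) (simp add: inner_commute)
    then show ?thesis by (simp add: exp_add[symmetric] field_simps)
  qed
  moreover have "cmod (stft (coherent a Y) X) = (2 * pi) powr (- real CARD('d) / 2) * exp (- (norm X)\<^sup>2 / 4) * cmod (entire_fun (fock_coeffs (coherent a Y)) (phase_to_complex X))"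
    by (rule norm_stft)
  ultimately have "cmod (stft (coherent a Y) X) = (2 * pi) powr (- real CARD('d) / 2) * exp (- (norm X)\<^sup>2 / 4) *
      (\<bar>a\<bar> * exp (- (norm Y)\<^sup>2 / 4) * exp ((X \<bullet> Y) / 2))" by simp
  also have "\<dots> = (2 * pi) powr (- real CARD('d) / 2) * \<bar>a\<bar> * (exp (- (norm X)\<^sup>2 / 4) * (exp (- (norm Y)\<^sup>2 / 4) * exp ((X \<bullet> Y) / 2)))"
    by (simp only: mult_ac)
  finally show ?thesis by (simp only: gauss)
qed

text \<open>From (4 r - t)^2 \<ge> 0: half of the Gaussian decay is spent on the exponential growth
  of the weight.\<close>

lemma exp_linear_gaussian_le: "exp (r * t) * exp (- t\<^sup>2 / 4) \<le> exp (2 * r\<^sup>2) * exp (- t\<^sup>2 / 8)" for r t :: real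
proof -
  have "0 \<le> (4 * r - t)\<^sup>2 / 8" by simp
  also have "\<dots> = 2 * r\<^sup>2 - r * t + t\<^sup>2 / 8" by (simp add: power2_eq_square field_simps)
  finally have "r * t + - t\<^sup>2 / 4 \<le> 2 * r\<^sup>2 + - t\<^sup>2 / 8" by simp
  then show ?thesis by (simp only: exp_add[symmetric] exp_le_cancel_iff)
qed

text \<open>Compactness yields only a cluster point f in the second space. Closeness in its norm
  implies closeness of the w2-weighted transforms at all points at once: at a fixed X this forces f
  to have zero transform, and at the moving points Y n it then contradicts the lower bound.\<close>

lemma limit_of_compact_map:
  fixes w1 w2 :: "(real ^ 'd::finite) \<times> (real ^ 'd) \<Rightarrow> real"
  assumes \<Phi>: "quasi_young \<Phi>" "t > 0" "\<Phi> t < \<infinity>" and \<Psi>: "quasi_young \<Psi>" "s > 0" "\<Psi> s < \<infinity>"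
    and w1: "regular_weight w1" and w2: "regular_weight w2"
    and cm: "compact_map (weighted_space \<Phi> \<Psi> w1) (weighted_norm \<Phi> \<Psi> w1) (weighted_space \<Phi> \<Psi> w2) (weighted_norm \<Phi> \<Psi> w2) (\<lambda>f. f)"
  shows "((\<lambda>X. w2 X / w1 X) \<longlongrightarrow> 0) at_infinity"
proof (rule ccontr)
  assume "\<not> ?thesis"
  have pos: "0 < w1 X" "0 < w2 X" for X by (rule regular_weight_pos[OF w1], rule regular_weight_pos[OF w2])
  from \<open>\<not> ?thesis\<close> obtain e where e: "e > 0" "\<not> (\<forall>\<^sub>F X in at_infinity. dist (w2 X / w1 X) 0 < e)"
    unfolding tendsto_iff by blast
  have "\<forall>n. \<exists>X. norm X \<ge> real n \<and> e \<le> w2 X / w1 X"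
  proof (rule ccontr)
    assume "\<not> ?thesis"
    then have "\<exists>n::nat. \<forall>X. \<not> (norm X \<ge> real n \<and> e \<le> w2 X / w1 X)" by blast
    then obtain n :: nat where n: "\<forall>X. \<not> (norm X \<ge> real n \<and> e \<le> w2 X / w1 X)" ..
    have "dist (w2 X / w1 X) 0 < e" if "norm X \<ge> real n" for X
    proof -
      have "w2 X / w1 X < e" using n that not_le by blast
      then show ?thesis using pos[of X] by (simp add: dist_real_def less_imp_le abs_of_pos)
    qed
    then have "\<forall>\<^sub>F X in at_infinity. dist (w2 X / w1 X) 0 < e" unfolding eventually_at_infinity by blast
    with e(2) show False by blast
  qed
  from choice[OF this] obtain Y where Y: "\<forall>n. norm (Y n) \<ge> real n \<and> e \<le> w2 (Y n) / w1 (Y n)" ..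
  obtain r where r: "r \<ge> 0" "\<And>X Z. w1 X \<le> exp (r * norm (X - Z)) * w1 Z"
    using w1 unfolding regular_weight_def by blast
  define c where "c = (2 * pi) powr (- real CARD('d) / 2)"
  have c: "c > 0" by (simp add: c_def)
  \<comment> \<open>Dividing by w1 at the centre makes the w1-norms uniformly bounded; the
    w2-weighted value at the centre becomes c w2(Y n) / w1(Y n) \<ge> c e.\<close>
  define g where "g n = coherent (1 / w1 (Y n)) (Y n)" for n
  have gH: "g n \<in> Hflat_dual" for n unfolding g_def by (rule coherent_Hflat_dual)
  have ng: "cmod (stft (g n) X) = c * (1 / w1 (Y n)) * exp (- (norm (X - Y n))\<^sup>2 / 4)" for n X
    unfolding g_def norm_stft_coherent c_def using pos(1)[of "Y n"] by simp
  have gw: "cmod (stft (g n) X) * w1 X \<le> c * exp (2 * r\<^sup>2) * exp (- (norm (X - Y n))\<^sup>2 / 8)" for n X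
  proof -
    have "cmod (stft (g n) X) * w1 X = c * exp (- (norm (X - Y n))\<^sup>2 / 4) * (w1 X / w1 (Y n))"
      by (simp add: ng)
    also have "\<dots> \<le> c * exp (- (norm (X - Y n))\<^sup>2 / 4) * exp (r * norm (X - Y n))"
      using r(2)[of X "Y n"] pos(1)[of "Y n"] c by (intro mult_left_mono) (auto simp: pos_divide_le_eq)
    also have "\<dots> = c * (exp (r * norm (X - Y n)) * exp (- (norm (X - Y n))\<^sup>2 / 4))" by simp
    also have "\<dots> \<le> c * (exp (2 * r\<^sup>2) * exp (- (norm (X - Y n))\<^sup>2 / 8))"
      using c by (intro mult_left_mono exp_linear_gaussian_le) auto
    finally show ?thesis by (simp add: mult.assoc)
  qed
  obtain G where G: "G > 0" "\<And>Y::(real ^ 'd) \<times> (real ^ 'd). mixed_norm \<Phi> \<Psi> (\<lambda>X. ennreal (exp (- (norm (X - Y))\<^sup>2 / 8))) \<le> ennreal G"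
    using mixed_norm_gaussian[OF \<Phi> \<Psi>, where 'a="real ^ 'd"] by blast
  define M where "M = c * exp (2 * r\<^sup>2) * G"
  have gM: "weighted_norm \<Phi> \<Psi> w1 (g n) \<le> ennreal M" for n
  proof -
    have "weighted_norm \<Phi> \<Psi> w1 (g n) \<le> ennreal (c * exp (2 * r\<^sup>2)) * mixed_norm \<Phi> \<Psi> (\<lambda>X. ennreal (exp (- (norm (X - Y n))\<^sup>2 / 8)))"
      unfolding weighted_norm_def
    proof (rule mixed_norm_le_cmult[OF \<Phi>(1) \<Psi>(1)])
      show "ennreal (cmod (stft (g n) X) * w1 X) \<le> ennreal (c * exp (2 * r\<^sup>2)) * ennreal (exp (- (norm (X - Y n))\<^sup>2 / 8))" for X
        using ennreal_leI[OF gw[of n X]] c by (simp only: ennreal_mult' mult_nonneg_nonneg exp_ge_zero less_imp_le)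
    qed (use c in simp)
    also have "\<dots> \<le> ennreal (c * exp (2 * r\<^sup>2)) * ennreal G" by (intro mult_left_mono G) simp
    also have "\<dots> = ennreal M" using c by (simp add: M_def ennreal_mult')
    finally show ?thesis .
  qed
  have gE1: "g n \<in> weighted_space \<Phi> \<Psi> w1" for n
    using gH gM[of n] by (auto simp: weighted_space_def intro: le_less_trans)
  then have gE2: "g n \<in> weighted_space \<Phi> \<Psi> w2" for n using cm unfolding compact_map_def by blast
  obtain K where "quasi_normed (weighted_space \<Phi> \<Psi> w2) (weighted_norm \<Phi> \<Psi> w2) K"
    using quasi_normed_weighted_space[OF \<Phi>(1) \<Psi>(1) w2] by blast
  then interpret quasi_normed "weighted_space \<Phi> \<Psi> w2" "weighted_norm \<Phi> \<Psi> w2" K .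
  have comp: "compactin T (T closure_of range g)"
  proof -
    have "range g \<subseteq> weighted_space \<Phi> \<Psi> w1" using gE1 by blast
    moreover have "\<exists>C<\<infinity>. \<forall>f\<in>range g. weighted_norm \<Phi> \<Psi> w1 f \<le> C" using gM by (intro exI[of _ "ennreal M"]) auto
    ultimately have "compactin T (T closure_of (\<lambda>f. f) ` range g)" using cm unfolding compact_map_def by blast
    then show ?thesis by simp
  qed
  have "range g \<subseteq> T closure_of range g" by (rule closure_of_subset) (use gE2 in auto)
  then have "g n \<in> T closure_of range g" for n by blast
  from compactin_subsequence[where g=g, OF comp this] obtain f
    where f: "f \<in> T closure_of range g" "\<And>e. 0 < e \<Longrightarrow> \<exists>\<^sub>F n in sequentially. weighted_norm \<Phi> \<Psi> w2 (g n - f) < e"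
    by blast
  have "f \<in> weighted_space \<Phi> \<Psi> w2" using f(1) by (simp add: in_closure_of)
  then have fH: "f \<in> Hflat_dual" by (simp add: weighted_space_def)
  obtain P where P: "P > 0" "\<And>f X. f \<in> Hflat_dual \<Longrightarrow> ennreal (cmod (stft f X) * w2 X) \<le> ennreal P * weighted_norm \<Phi> \<Psi> w2 f"
    using stft_pointwise_bound[OF \<Phi>(1) \<Psi>(1) w2] by blast
  have close: "\<exists>\<^sub>F n in sequentially. \<forall>X. cmod (stft (g n - f) X) * w2 X \<le> d" if "d > 0" for d
  proof -
    have "\<exists>\<^sub>F n in sequentially. weighted_norm \<Phi> \<Psi> w2 (g n - f) < ennreal (d / P)" using that P by (intro f(2)) simp
    then show ?thesis
    proof (rule frequently_elim1, intro allI)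
      fix n X assume lt: "weighted_norm \<Phi> \<Psi> w2 (g n - f) < ennreal (d / P)"
      have "ennreal (cmod (stft (g n - f) X) * w2 X) \<le> ennreal P * weighted_norm \<Phi> \<Psi> w2 (g n - f)"
        by (rule P(2)[OF Hflat_dual_diff[OF gH fH]])
      also have "\<dots> \<le> ennreal P * ennreal (d / P)" using lt by (intro mult_left_mono) auto
      also have "\<dots> = ennreal d" using P(1) by (simp add: ennreal_mult'[symmetric])
      finally show "cmod (stft (g n - f) X) * w2 X \<le> d" using that by (subst (asm) ennreal_le_iff) auto
    qed
  qed
  have gto0: "(\<lambda>n. cmod (stft (g n) X)) \<longlonglongrightarrow> 0" for X
  proof (rule tendsto_sandwich[where f="\<lambda>_. 0" and h="\<lambda>n. c * exp (2 * r\<^sup>2) * exp (- (norm (X - Y n))\<^sup>2 / 8) / w1 X"])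
    show "\<forall>\<^sub>F n in sequentially. cmod (stft (g n) X) \<le> c * exp (2 * r\<^sup>2) * exp (- (norm (X - Y n))\<^sup>2 / 8) / w1 X"
      using gw[of _ X] pos(1)[of X] by (intro always_eventually allI) (simp add: pos_le_divide_eq)
    have "filterlim (\<lambda>n. norm (X - Y n)) at_top sequentially"
    proof (rule filterlim_at_top_mono)
      show "filterlim (\<lambda>n. - norm X + real n) at_top sequentially"
        by (intro filterlim_tendsto_add_at_top[OF tendsto_const] filterlim_real_sequentially)
      show "\<forall>\<^sub>F n in sequentially. - norm X + real n \<le> norm (X - Y n)"
      proof (intro always_eventually allI)
        fix n
        have "real n \<le> norm (Y n)" using Y by blast
        then show "- norm X + real n \<le> norm (X - Y n)" using norm_triangle_ineq2[of "Y n" X] by (simp add: norm_minus_commute)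
      qed
    qed
    moreover have "((\<lambda>t::real. c * exp (2 * r\<^sup>2) * exp (- t\<^sup>2 / 8) / w1 X) \<longlongrightarrow> 0) at_top"
    proof -
      have "((\<lambda>t::real. exp (- t\<^sup>2 / 8)) \<longlongrightarrow> 0) at_top" by real_asymp
      from tendsto_mult_right_zero[OF this, of "c * exp (2 * r\<^sup>2) / w1 X"] show ?thesis by simp
    qed
    ultimately show "(\<lambda>n. c * exp (2 * r\<^sup>2) * exp (- (norm (X - Y n))\<^sup>2 / 8) / w1 X) \<longlonglongrightarrow> 0"
      by (rule filterlim_compose[rotated])
  qed auto
  \<comment> \<open>Closeness of g n to f holds for infinitely many n, smallness of the transform of
    g n at X for all large n; some n has both, each with a third of the supposed nonzero
    value.\<close>
  have f0: "stft f X = 0" for X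
  proof (rule ccontr)
    assume "stft f X \<noteq> 0"
    then have d: "cmod (stft f X) / 3 > 0" by simp
    then have ev: "\<forall>\<^sub>F n in sequentially. cmod (stft (g n) X) < cmod (stft f X) / 3"
      using gto0[of X] by (rule order_tendstoD(2)[rotated])
    have fr: "\<exists>\<^sub>F n in sequentially. \<forall>Z. cmod (stft (g n - f) Z) * w2 Z \<le> cmod (stft f X) / 3 * w2 X"
      using d pos(2)[of X] by (intro close) simp
    from frequently_ex[OF frequently_eventually_conj[OF fr ev]]
    obtain n where n: "cmod (stft (g n) X) < cmod (stft f X) / 3" "\<forall>Z. cmod (stft (g n - f) Z) * w2 Z \<le> cmod (stft f X) / 3 * w2 X"
      by blast
    have "cmod (stft (g n - f) X) \<le> cmod (stft f X) / 3"
      using n(2) pos(2)[of X] mult_le_cancel_right_pos by blast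
    then have "cmod (stft (g n) X - stft f X) \<le> cmod (stft f X) / 3" by (simp only: stft_diff[OF gH fH])
    moreover have "cmod (stft f X) \<le> cmod (stft (g n) X) + cmod (stft (g n) X - stft f X)"
      using norm_triangle_ineq4[of "stft (g n) X" "stft (g n) X - stft f X"] by simp
    ultimately show False using n(1) d by linarith
  qed
  have "\<exists>\<^sub>F n in sequentially. \<forall>X. cmod (stft (g n - f) X) * w2 X \<le> c * e / 2" using c e(1) by (intro close) simp
  then obtain n where n: "\<forall>X. cmod (stft (g n - f) X) * w2 X \<le> c * e / 2" using frequently_ex by blast
  have "c * e \<le> c * (w2 (Y n) / w1 (Y n))" using Y c by (intro mult_left_mono) auto
  also have "\<dots> = cmod (stft (g n - f) (Y n)) * w2 (Y n)"
    by (simp add: stft_diff[OF gH fH] f0 ng)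
  also have "\<dots> \<le> c * e / 2" using n by blast
  finally show False using c e(1) by simp
qed

section \<open>Passage to equivalent quasi-norms and weights\<close>

lemma quasi_norm_topology_le:
  assumes "0 < C" "\<And>f. N f \<le> ennreal C * N' f" "openin (quasi_norm_topology E N) U"
  shows "openin (quasi_norm_topology E N') U"
  unfolding openin_quasi_norm_topology
proof (intro conjI ballI)
  show "U \<subseteq> E" using assms(3) by (simp add: openin_quasi_norm_topology)
  fix f assume "f \<in> U"
  then obtain d where d: "d > 0" "\<forall>g\<in>E. N (g - f) < d \<longrightarrow> g \<in> U"
    using assms(3) by (auto simp: openin_quasi_norm_topology)
  have "g \<in> U" if "g \<in> E" "N' (g - f) < ennreal (1 / C) * d" for g
  proof -
    have "N (g - f) \<le> ennreal C * N' (g - f)" by (rule assms(2))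
    also have "\<dots> < ennreal C * (ennreal (1 / C) * d)"
      using assms(1) that(2) by (intro ennreal_mult_strict_left_mono) auto
    also have "\<dots> = d" using assms(1) by (simp add: mult.assoc[symmetric] ennreal_mult'[symmetric])
    finally show ?thesis using d(2) that(1) by blast
  qed
  moreover have "0 < ennreal (1 / C) * d" using d(1) assms(1) by (simp add: ennreal_zero_less_mult_iff)
  ultimately show "\<exists>d>0. \<forall>g\<in>E. N' (g - f) < d \<longrightarrow> g \<in> U" by blast
qed

text \<open>Equivalent gauges have the same open sets in the target and the same bounded sets in the
  source, which is all that \<open>compact_map\<close> depends on.\<close>

lemma compact_map_equivalent_norms:
  assumes C: "0 < C" "\<And>f. N\<^sub>1 f \<le> ennreal C * N\<^sub>1' f" "\<And>f. N\<^sub>1' f \<le> ennreal C * N\<^sub>1 f"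
    and D: "0 < D" "\<And>f. N\<^sub>2 f \<le> ennreal D * N\<^sub>2' f" "\<And>f. N\<^sub>2' f \<le> ennreal D * N\<^sub>2 f"
  shows "compact_map E N\<^sub>1 F N\<^sub>2 T \<longleftrightarrow> compact_map E N\<^sub>1' F N\<^sub>2' T"
proof -
  have top: "quasi_norm_topology F N\<^sub>2 = quasi_norm_topology F N\<^sub>2'"
    unfolding topology_eq
  proof (intro allI iffI)
    fix U
    show "openin (quasi_norm_topology F N\<^sub>2') U" if "openin (quasi_norm_topology F N\<^sub>2) U"
      by (rule quasi_norm_topology_le[where N=N\<^sub>2 and N'=N\<^sub>2', OF D(1,2) that])
    show "openin (quasi_norm_topology F N\<^sub>2) U" if "openin (quasi_norm_topology F N\<^sub>2') U"
      by (rule quasi_norm_topology_le[where N=N\<^sub>2' and N'=N\<^sub>2, OF D(1,3) that])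
  qed
  have bd: "\<exists>B<\<infinity>. \<forall>f\<in>A. N' f \<le> B" if bounded: "\<exists>B<\<infinity>. \<forall>f\<in>A. N f \<le> B" and le: "\<forall>f. N' f \<le> ennreal C * N f"
    for A :: "'a set" and N N' :: "'a \<Rightarrow> ennreal"
  proof -
    obtain B where B: "B < \<infinity>" "\<forall>f\<in>A. N f \<le> B" using bounded by blast
    have "N' f \<le> ennreal C * B" if "f \<in> A" for f
    proof -
      have "N' f \<le> ennreal C * N f" using le by simp
      also have "\<dots> \<le> ennreal C * B" using B(2) that by (intro mult_left_mono) auto
      finally show ?thesis .
    qed
    moreover have "ennreal C * B < \<infinity>" using B(1) by (simp add: ennreal_mult_less_top)
    ultimately show ?thesis by blast
  qed
  have le: "\<forall>f. N\<^sub>1 f \<le> ennreal C * N\<^sub>1' f" "\<forall>f. N\<^sub>1' f \<le> ennreal C * N\<^sub>1 f" using C by auto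
  have "(\<exists>B<\<infinity>. \<forall>f\<in>A. N\<^sub>1 f \<le> B) = (\<exists>B<\<infinity>. \<forall>f\<in>A. N\<^sub>1' f \<le> B)" for A
    by (rule iffI; erule bd) (use le in auto)
  then show ?thesis unfolding compact_map_def top by simp
qed

lemma tendsto_zero_ratio_mono:
  fixes f g :: "'a \<Rightarrow> real"
  assumes "(g \<longlongrightarrow> 0) F" "\<And>x. 0 \<le> f x" "\<And>x. f x \<le> C * g x"
  shows "(f \<longlongrightarrow> 0) F"
proof (rule tendsto_sandwich[where f="\<lambda>_. 0" and h="\<lambda>x. C * g x"])
  show "((\<lambda>x. C * g x) \<longlongrightarrow> 0) F" using tendsto_mult_right_zero[OF assms(1)] .
qed (use assms in \<open>auto intro!: always_eventually\<close>)

theorem theorem4p12: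
  fixes \<Phi>\<^sub>1 \<Phi>\<^sub>2 :: "real \<Rightarrow> ennreal"
    and \<omega>\<^sub>1 \<omega>\<^sub>2 :: "(real ^ 'd::finite) \<times> (real ^ 'd) \<Rightarrow> real"
  assumes "quasi_young \<Phi>\<^sub>1" and "quasi_young \<Phi>\<^sub>2"
    and nondegenerate: "\<exists>t>0. \<Phi>\<^sub>1 t < \<infinity>" "\<exists>t>0. \<Phi>\<^sub>2 t < \<infinity>"
    and "\<omega>\<^sub>1 \<in> moderate_weights" and "\<omega>\<^sub>2 \<in> moderate_weights"
  shows "compact_map
           (modulation_space \<Phi>\<^sub>1 \<Phi>\<^sub>2 \<omega>\<^sub>1) (modulation_norm \<Phi>\<^sub>1 \<Phi>\<^sub>2 \<omega>\<^sub>1)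
           (modulation_space \<Phi>\<^sub>1 \<Phi>\<^sub>2 \<omega>\<^sub>2) (modulation_norm \<Phi>\<^sub>1 \<Phi>\<^sub>2 \<omega>\<^sub>2)
           (\<lambda>f. f)
         \<longleftrightarrow> ((\<lambda>X. \<omega>\<^sub>2 X / \<omega>\<^sub>1 X) \<longlongrightarrow> 0) at_infinity"
proof -
  obtain t where t: "t > 0" "\<Phi>\<^sub>1 t < \<infinity>" using nondegenerate(1) by blast
  obtain s where s: "s > 0" "\<Phi>\<^sub>2 s < \<infinity>" using nondegenerate(2) by blast
  obtain w1 D1 where w1: "regular_weight w1" "D1 \<ge> 1" "\<forall>X. 0 < \<omega>\<^sub>1 X \<and> \<omega>\<^sub>1 X \<le> w1 X \<and> w1 X \<le> D1 * \<omega>\<^sub>1 X"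
    using moderate_weight_regularization[OF assms(5)] by blast
  obtain w2 D2 where w2: "regular_weight w2" "D2 \<ge> 1" "\<forall>X. 0 < \<omega>\<^sub>2 X \<and> \<omega>\<^sub>2 X \<le> w2 X \<and> w2 X \<le> D2 * \<omega>\<^sub>2 X"
    using moderate_weight_regularization[OF assms(6)] by blast
  \<comment> \<open>D serves both directions, since w lies between \<omega> and D \<omega> and D
    \<ge> 1.\<close>
  have mn: "modulation_norm \<Phi>\<^sub>1 \<Phi>\<^sub>2 \<omega> f \<le> ennreal D * weighted_norm \<Phi>\<^sub>1 \<Phi>\<^sub>2 w f" "weighted_norm \<Phi>\<^sub>1 \<Phi>\<^sub>2 w f \<le> ennreal D * modulation_norm \<Phi>\<^sub>1 \<Phi>\<^sub>2 \<omega> f"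
    if w: "regular_weight w" and D: "D \<ge> 1" and w\<omega>: "\<forall>X. 0 < \<omega> X \<and> \<omega> X \<le> w X \<and> w X \<le> D * \<omega> X"
    for \<omega> w D and f :: "'d hermite_series"
  proof -
    have eq: "modulation_norm \<Phi>\<^sub>1 \<Phi>\<^sub>2 \<omega> f = weighted_norm \<Phi>\<^sub>1 \<Phi>\<^sub>2 \<omega> f" by (rule modulation_norm_eq) (use w\<omega> in blast)
    have 1: "\<omega> X \<le> D * w X" for X
    proof -
      have "\<omega> X \<le> w X" using w\<omega> by blast
      then have "\<omega> X \<le> 1 * w X" by simp
      also have "\<dots> \<le> D * w X" using D regular_weight_pos[OF w, of X] by (intro mult_right_mono) auto
      finally show ?thesis .
    qed
    have 2: "w X \<le> D * \<omega> X" for X using w\<omega> by blast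
    have Dpos: "0 < D" using D by simp
    show "modulation_norm \<Phi>\<^sub>1 \<Phi>\<^sub>2 \<omega> f \<le> ennreal D * weighted_norm \<Phi>\<^sub>1 \<Phi>\<^sub>2 w f"
      unfolding eq by (rule weighted_norm_mono[OF assms(1,2) Dpos 1])
    show "weighted_norm \<Phi>\<^sub>1 \<Phi>\<^sub>2 w f \<le> ennreal D * modulation_norm \<Phi>\<^sub>1 \<Phi>\<^sub>2 \<omega> f"
      unfolding eq by (rule weighted_norm_mono[OF assms(1,2) Dpos 2])
  qed
  have ms: "modulation_space \<Phi>\<^sub>1 \<Phi>\<^sub>2 \<omega> = weighted_space \<Phi>\<^sub>1 \<Phi>\<^sub>2 w"
    if "regular_weight w" "D \<ge> 1" "\<forall>X. 0 < \<omega> X \<and> \<omega> X \<le> w X \<and> w X \<le> D * \<omega> X" for \<omega> w :: "(real ^ 'd) \<times> (real ^ 'd) \<Rightarrow> real" and D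
  proof -
    have "modulation_norm \<Phi>\<^sub>1 \<Phi>\<^sub>2 \<omega> f < \<infinity> \<longleftrightarrow> weighted_norm \<Phi>\<^sub>1 \<Phi>\<^sub>2 w f < \<infinity>" for f
      using le_less_trans[OF mn(1)[OF that, of f]] le_less_trans[OF mn(2)[OF that, of f]]
      by (auto simp: ennreal_mult_less_top)
    then show ?thesis by (simp add: modulation_space_def weighted_space_def)
  qed
  have "compact_map
           (modulation_space \<Phi>\<^sub>1 \<Phi>\<^sub>2 \<omega>\<^sub>1) (modulation_norm \<Phi>\<^sub>1 \<Phi>\<^sub>2 \<omega>\<^sub>1)
           (modulation_space \<Phi>\<^sub>1 \<Phi>\<^sub>2 \<omega>\<^sub>2) (modulation_norm \<Phi>\<^sub>1 \<Phi>\<^sub>2 \<omega>\<^sub>2) (\<lambda>f. f)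
      \<longleftrightarrow> compact_map (weighted_space \<Phi>\<^sub>1 \<Phi>\<^sub>2 w1) (weighted_norm \<Phi>\<^sub>1 \<Phi>\<^sub>2 w1) (weighted_space \<Phi>\<^sub>1 \<Phi>\<^sub>2 w2) (weighted_norm \<Phi>\<^sub>1 \<Phi>\<^sub>2 w2) (\<lambda>f. f)"
    unfolding ms[OF w1] ms[OF w2]
    by (rule compact_map_equivalent_norms[OF _ mn(1)[OF w1] mn(2)[OF w1] _ mn(1)[OF w2] mn(2)[OF w2]])
      (use w1(2) w2(2) in auto)
  also have "\<dots> \<longleftrightarrow> ((\<lambda>X. w2 X / w1 X) \<longlongrightarrow> 0) at_infinity"
    using compact_map_of_limit[OF assms(1) t assms(2) s w1(1) w2(1)]
      limit_of_compact_map[OF assms(1) t assms(2) s w1(1) w2(1)] by blast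
  \<comment> \<open>The ratio of the regular weights lies between 1 / D1 and D2 times the original
    ratio, so the two tend to 0 together.\<close>
  also have "\<dots> \<longleftrightarrow> ((\<lambda>X. \<omega>\<^sub>2 X / \<omega>\<^sub>1 X) \<longlongrightarrow> 0) at_infinity"
  proof
    have pos: "0 < \<omega>\<^sub>1 X" "0 < \<omega>\<^sub>2 X" "0 < w1 X" "0 < w2 X" for X
      using w1(3) w2(3) regular_weight_pos[OF w1(1)] regular_weight_pos[OF w2(1)] by blast+
    show "((\<lambda>X. \<omega>\<^sub>2 X / \<omega>\<^sub>1 X) \<longlongrightarrow> 0) at_infinity" if "((\<lambda>X. w2 X / w1 X) \<longlongrightarrow> 0) at_infinity"
    proof (rule tendsto_zero_ratio_mono[OF that])
      fix X
      show "0 \<le> \<omega>\<^sub>2 X / \<omega>\<^sub>1 X" using pos by (simp add: less_imp_le)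
      have "\<omega>\<^sub>2 X / \<omega>\<^sub>1 X \<le> w2 X / (w1 X / D1)"
      proof (rule frac_le)
        show "0 \<le> w2 X" "\<omega>\<^sub>2 X \<le> w2 X" using w2(3) less_imp_le[OF pos(4)[of X]] by blast+
        show "0 < w1 X / D1" using pos(3)[of X] w1(2) by simp
        have "w1 X \<le> D1 * \<omega>\<^sub>1 X" using w1(3) by blast
        then show "w1 X / D1 \<le> \<omega>\<^sub>1 X" using w1(2) by (simp add: pos_divide_le_eq mult.commute)
      qed
      then show "\<omega>\<^sub>2 X / \<omega>\<^sub>1 X \<le> D1 * (w2 X / w1 X)" by (simp add: mult.commute)
    qed
    show "((\<lambda>X. w2 X / w1 X) \<longlongrightarrow> 0) at_infinity" if "((\<lambda>X. \<omega>\<^sub>2 X / \<omega>\<^sub>1 X) \<longlongrightarrow> 0) at_infinity"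
    proof (rule tendsto_zero_ratio_mono[OF that])
      fix X
      show "0 \<le> w2 X / w1 X" using pos by (simp add: less_imp_le)
      have "w2 X / w1 X \<le> D2 * \<omega>\<^sub>2 X / \<omega>\<^sub>1 X"
      proof (rule frac_le)
        show "0 \<le> D2 * \<omega>\<^sub>2 X" using w2(2) pos(2)[of X] by simp
        show "w2 X \<le> D2 * \<omega>\<^sub>2 X" "0 < \<omega>\<^sub>1 X" "\<omega>\<^sub>1 X \<le> w1 X" using w1(3) w2(3) by blast+
      qed
      then show "w2 X / w1 X \<le> D2 * (\<omega>\<^sub>2 X / \<omega>\<^sub>1 X)" by simp
    qed
  qed
  finally show ?thesis .
qed

end
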